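(* Let $X\in M_d(\mathcal A)$ be a matricial second-order (MSO) semicircular element with covariance $\sigma$, with $\mathcal A\subset\mathcal B$ and $(\mathcal B,\psi)$ a tracial $C^*$-probability space as in the context. For $a,b\in M_d(\mathbb C)$ invertible, let $$\mathcal D=\{(z,w)\in\mathbb C^2: 1-zaX\text{ and }1-wbX\text{ are invertible}\}.$$ Then the mapping $$\begin{aligned}(z,w)\mapsto\ &\mathcal G_D((za)^{-1},(za)^{-\mathrm T})\Big\{\Theta[\mathcal H((za)^{-1},(wb)^{-1})]\\&+\Phi\Big[\mathcal H((za)^{-1},(wb)^{-1})^\Gamma\big(\mathcal G((za)^{-1})\otimes\mathcal G((wb)^{-1})\big)^\Gamma\mathcal H((za)^{-1},(wb)^{-1})^\Gamma\Big]\Big\}\,\mathcal G_D((wb)^{-1},(wb)^{-\mathrm T})^{\mathrm T}\end{aligned}$$ is analytic on the connected component of $\mathcal D$ containing $(0,0)$.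
   Context: Setting. $(\mathcal A,\varphi,\varphi_2)$ is a second-order probability space: $\mathcal A$ a unital complex $*$-algebra, $\varphi$ a tracial linear functional with $\varphi(1)=1$, $\varphi_2:\mathcal A\times\mathcal A\to\mathbb C$ bilinear, tracial in each argument, $\varphi_2(a,1)=\varphi_2(1,a)=0$. It is assumed that $\mathcal A=\mathbb C\langle X(p,q):p,q\in[d]\rangle$, where $[d]=\{1,\dots,d\}$, that $X=(X(p,q))_{p,q}\in M_d(\mathcal A)$ is an MSO semicircular element with covariance $\sigma:[d]^2\times[d]^2\to\mathbb R$, that there is a tracial $C^*$-probability space $(\mathcal B,\psi)$ with $\mathcal A\subset\mathcal B$ and $\varphi=\psi|_{\mathcal A}$, and that $X$ and $M_d=M_d(\mathbb C)$ are algebraically free (monomials $a_0X\cdots Xa_n$ with $a_j\in M_d$ of different lengths $n$ are linearly independent). Invertibility of $1-zaX$ etc. is in $M_d(\mathcal B)$. MSO semicircular element with covariance $\sigma$: $X(p,q)=X(q,p)$ for all $p,q$, the entries are selfadjoint, and they form a second-order semicircular family with covariance $\sigma$: for $c'_1,\dots,c'_m,c''_1,\dots,c''_n\in[d]^2$, with $c_s=c'_s$ ($s\le m$), $c_s=c''_{s-m}$ ($s>m$), $\varphi(\prod_{w=1}^mX(c'_w))=\sum_{\pi\in NC_2(m)}\prod_{\{u,v\}\in\pi}\sigma(c'_u;c'_v)$ and $\varphi_2(\prod_{w=1}^mX(c'_w),\prod_{w=1}^nX(c''_w))=\sum_{\pi\in NC_2(m,n)}\prod_{\{u,v\}\in\pi}\sigma(c_u;c_v)$.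 Here $NC_2(m)$ is the set of non-crossing pairings of $[m]$, and $NC_2(m,n)$ the set of annular non-crossing pairings: pairings $\pi$ of $[m+n]$ (viewed as involutions) such that $\gamma_{m,n}\pi$ has $(m+n)/2$ cycles, where $\gamma_{m,n}=(1\,\dots\,m)(m+1\,\dots\,m+n)$, and some $\{u,v\}\in\pi$ has $u\le m<v$. In particular $\sigma(p,q;r,s)=\sigma(p,q;s,r)=\sigma(q,p;r,s)=\sigma(q,p;s,r)$. Matrix notation: for a $d^2\times d^2$ matrix $A$, $A(p,q;r,s)=A((p-1)d+r,(q-1)d+s)$; $(A\otimes B)(p,q;r,s)=A(p,q)B(r,s)$; $\Sigma(p,q;r,s)=\sigma(p,q;r,s)$; $\Theta(A)(p,q;r,s)=A(p,r;q,s)$; $A^\Gamma(p,q;r,s)=A(p,q;s,r)$; $\Phi(A)=\Theta(A^\Gamma)$; ${}^{\mathrm T}$ is the usual transpose and $a^{-\mathrm T}=(a^{\mathrm T})^{-1}$. Transforms: $\mathcal G(a)=(\mathrm{id}_{M_d}\otimes\psi)\big((a-X)^{-1}\big)$, $\mathcal G_D(a,b)=[\mathcal G(a)\otimes\mathcal G(b)]\big(I_{d^2}-\Sigma[\mathcal G(a)\otimes\mathcal G(b)]\big)^{-1}$, $\mathcal H(a,b)=\big(I_{d^2}-\Sigma[\mathcal G(a)\otimes\mathcal G(b)]\big)^{-1}\Sigma$. Since $\mathcal G(a^{-1})=(\mathrm{id}_{M_d}\otimes\psi)\big((1-aX)^{-1}\big)a$, the map $a\mapsto\mathcal G(a^{-1})$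 is also defined by this last formula for non-invertible $a$ with $1-aX$ invertible (in particular $\mathcal G(a^{-1})=0$ at $a=0$); this extension is still denoted $\mathcal G(a^{-1})$, and likewise for $\mathcal G_D(a^{-1},b^{-1})$, $\mathcal H(a^{-1},b^{-1})$. With this convention the mapping in the statement is defined in a neighbourhood of $(0,0)$.
   Formalization: If ψ is not faithful, 1−zaᵀX or 1−wbᵀX may be singular on the component, so the mapping is undefined there; the theorem gives an analytic F on the whole component equal to the mapping wherever both are invertible, and proves the mapping defined everywhere on it when ψ is faithful. *)

theory Defs
  imports "HOL-Analysis.Analysis" "HOL-Combinatorics.Orbits"
begin

text \<open>
  Complex unital algebras are modelled on a type with its library (real) Banach algebra structure
  together with an explicit complex scalar multiplication \<open>scl\<close> extending the real one and an
  involution \<open>star\<close>. The index set \<open>[d]\<close> is a finite type \<open>'d\<close>.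
\<close>

locale cstar_algebra =
  fixes scl :: "complex \<Rightarrow> 'b \<Rightarrow> 'b :: {real_normed_algebra_1, banach}"
    and star :: "'b \<Rightarrow> 'b"
  assumes scl_add_right: "scl c (x + y) = scl c x + scl c y"
    and scl_add_left: "scl (c + c') x = scl c x + scl c' x"
    and scl_scl: "scl c (scl c' x) = scl (c * c') x"
    and scl_of_real: "scl (complex_of_real r) x = r *\<^sub>R x"
    and scl_mult_left: "scl c x * y = scl c (x * y)"
    and scl_mult_right: "x * scl c y = scl c (x * y)"
    and norm_scl: "norm (scl c x) = cmod c * norm x"
    and star_add: "star (x + y) = star x + star y"
    and star_scl: "star (scl c x) = scl (cnj c) (star x)"
    and star_mult: "star (x * y) = star y * star x"
    and star_star: "star (star x) = x"
    and cstar_identity: "norm (star x * x) = (norm x)\<^sup>2"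

definition complex_linear_on ::
  "(complex \<Rightarrow> 'b \<Rightarrow> 'b) \<Rightarrow> 'b set \<Rightarrow> ('b :: ring_1 \<Rightarrow> complex) \<Rightarrow> bool" where
  "complex_linear_on scl A f \<longleftrightarrow>
     (\<forall>x\<in>A. \<forall>y\<in>A. f (x + y) = f x + f y) \<and> (\<forall>c. \<forall>x\<in>A. f (scl c x) = c * f x)"

definition tracial_on :: "'b set \<Rightarrow> ('b :: ring_1 \<Rightarrow> complex) \<Rightarrow> bool" where
  "tracial_on A f \<longleftrightarrow> (\<forall>x\<in>A. \<forall>y\<in>A. f (x * y) = f (y * x))"

text \<open>The tracial state is not required to be faithful.\<close>

locale tracial_cstar_prob_space = cstar_algebra scl star
  for scl :: "complex \<Rightarrow> 'b \<Rightarrow> 'b :: {real_normed_algebra_1, banach}" and star :: "'b \<Rightarrow> 'b" +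
  fixes \<psi> :: "'b \<Rightarrow> complex"
  assumes state_linear: "complex_linear_on scl UNIV \<psi>"
    and state_one: "\<psi> 1 = 1"
    and state_pos: "\<psi> (star x * x) \<in> \<real>\<^sub>\<ge>\<^sub>0"
    and state_tracial: "tracial_on UNIV \<psi>"

definition faithful_state :: "('b :: ring_1 \<Rightarrow> 'b) \<Rightarrow> ('b \<Rightarrow> complex) \<Rightarrow> bool" where
  "faithful_state star \<psi> \<longleftrightarrow> (\<forall>x. \<psi> (star x * x) = 0 \<longrightarrow> x = 0)"

definition unital_subalgebra :: "(complex \<Rightarrow> 'b \<Rightarrow> 'b) \<Rightarrow> 'b :: ring_1 set \<Rightarrow> bool" where
  "unital_subalgebra scl A \<longleftrightarrow>
     1 \<in> A \<and> (\<forall>x\<in>A. \<forall>y\<in>A. x + y \<in> A \<and> x * y \<in> A) \<and> (\<forall>c. \<forall>x\<in>A. scl c x \<in> A)"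

text \<open>
  The algebra carrying the second-order structure is a unital \<open>*\<close>-subalgebra \<open>A\<close> of the ambient
  algebra; \<open>\<phi>\<close> and \<open>\<phi>\<^sub>2\<close> only matter on \<open>A\<close>.
\<close>

definition second_order_prob_space ::
  "(complex \<Rightarrow> 'b \<Rightarrow> 'b) \<Rightarrow> ('b \<Rightarrow> 'b) \<Rightarrow> 'b :: ring_1 set \<Rightarrow>
     ('b \<Rightarrow> complex) \<Rightarrow> ('b \<Rightarrow> 'b \<Rightarrow> complex) \<Rightarrow> bool" where
  "second_order_prob_space scl star A \<phi> \<phi>\<^sub>2 \<longleftrightarrow>
     unital_subalgebra scl A \<and> (\<forall>x\<in>A. star x \<in> A) \<and>
     complex_linear_on scl A \<phi> \<and> tracial_on A \<phi> \<and> \<phi> 1 = 1 \<and>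
     (\<forall>x\<in>A. complex_linear_on scl A (\<phi>\<^sub>2 x) \<and> tracial_on A (\<phi>\<^sub>2 x) \<and>
             complex_linear_on scl A (\<lambda>y. \<phi>\<^sub>2 y x) \<and> tracial_on A (\<lambda>y. \<phi>\<^sub>2 y x)) \<and>
     (\<forall>x\<in>A. \<phi>\<^sub>2 x 1 = 0 \<and> \<phi>\<^sub>2 1 x = 0)"


text \<open>
  Pairings are fixed-point free involutions; positions are numbered from \<open>0\<close>, so the set
  \<open>{1,\<dots>,k}\<close> becomes \<open>{..<k}\<close>.
\<close>

definition pairings :: "nat \<Rightarrow> (nat \<Rightarrow> nat) set" where
  "pairings k = {\<pi>. \<pi> permutes {..<k} \<and> (\<forall>i<k. \<pi> i \<noteq> i \<and> \<pi> (\<pi> i) = i)}"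

definition NC2 :: "nat \<Rightarrow> (nat \<Rightarrow> nat) set" where
  "NC2 m = {\<pi> \<in> pairings m. \<not> (\<exists>i j. i < j \<and> j < \<pi> i \<and> \<pi> i < \<pi> j \<and> \<pi> j < m)}"

definition annular_cycle :: "nat \<Rightarrow> nat \<Rightarrow> nat \<Rightarrow> nat" where
  "annular_cycle m n i =
     (if i < m then Suc i mod m
      else if i < m + n then m + Suc (i - m) mod n
      else i)"

definition num_cycles :: "nat \<Rightarrow> (nat \<Rightarrow> nat) \<Rightarrow> nat" where
  "num_cycles k p = card (orbit p ` {..<k})"

definition annular_NC2 :: "nat \<Rightarrow> nat \<Rightarrow> (nat \<Rightarrow> nat) set" where
  "annular_NC2 m n =
     {\<pi> \<in> pairings (m + n). 2 * num_cycles (m + n) (annular_cycle m n \<circ> \<pi>) = m + n \<and>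
                            (\<exists>u<m. m \<le> \<pi> u)}"

text \<open>
  Each pair \<open>{u, v}\<close> of \<open>\<pi>\<close> is counted once, through its smaller element. The order of the
  arguments of \<open>\<sigma>\<close> is immaterial, as traciality forces \<open>\<sigma>\<close> to be symmetric.
\<close>

definition pairing_weight :: "('c \<Rightarrow> 'c \<Rightarrow> real) \<Rightarrow> 'c list \<Rightarrow> (nat \<Rightarrow> nat) \<Rightarrow> complex" where
  "pairing_weight \<sigma> cs \<pi> =
     (\<Prod>u\<in>{u. u < length cs \<and> u < \<pi> u}. complex_of_real (\<sigma> (cs ! u) (cs ! \<pi> u)))"

definition word :: "'b :: ring_1 ^ 'd ^ 'd \<Rightarrow> ('d \<times> 'd) list \<Rightarrow> 'b" where
  "word X cs = prod_list (map (\<lambda>(p, q). X $ p $ q) cs)"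

definition MSO_semicircular ::
  "('b \<Rightarrow> 'b) \<Rightarrow> 'b :: ring_1 set \<Rightarrow> ('b \<Rightarrow> complex) \<Rightarrow> ('b \<Rightarrow> 'b \<Rightarrow> complex) \<Rightarrow>
     'b ^ 'd ^ 'd \<Rightarrow> ('d \<times> 'd \<Rightarrow> 'd \<times> 'd \<Rightarrow> real) \<Rightarrow> bool" where
  "MSO_semicircular star A \<phi> \<phi>\<^sub>2 X \<sigma> \<longleftrightarrow>
     (\<forall>p q. X $ p $ q \<in> A \<and> X $ p $ q = X $ q $ p \<and> star (X $ p $ q) = X $ p $ q) \<and>
     (\<forall>cs. \<phi> (word X cs) = (\<Sum>\<pi>\<in>NC2 (length cs). pairing_weight \<sigma> cs \<pi>)) \<and>
     (\<forall>cs ds. \<phi>\<^sub>2 (word X cs) (word X ds) =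
        (\<Sum>\<pi>\<in>annular_NC2 (length cs) (length ds). pairing_weight \<sigma> (cs @ ds) \<pi>))"


definition emb_mat ::
  "(complex \<Rightarrow> 'b \<Rightarrow> 'b) \<Rightarrow> complex ^ 'd ^ 'd \<Rightarrow> 'b :: ring_1 ^ 'd ^ 'd" where
  "emb_mat scl a = (\<chi> i j. scl (a $ i $ j) 1)"

definition id_tensor :: "('b \<Rightarrow> complex) \<Rightarrow> 'b ^ 'd ^ 'd \<Rightarrow> complex ^ 'd ^ 'd" where
  "id_tensor \<psi> M = (\<chi> i j. \<psi> (M $ i $ j))"

definition scale_mat :: "complex \<Rightarrow> complex ^ 'd ^ 'd \<Rightarrow> complex ^ 'd ^ 'd" where
  "scale_mat z a = (\<chi> i j. z * a $ i $ j)"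

text \<open>\<open>X_monomial scl X a\<^sub>0 [a\<^sub>1, \<dots>, a\<^sub>n]\<close> is \<open>a\<^sub>0 X a\<^sub>1 \<dots> X a\<^sub>n\<close>.\<close>

fun X_monomial ::
  "(complex \<Rightarrow> 'b \<Rightarrow> 'b) \<Rightarrow> 'b :: ring_1 ^ 'd ^ 'd \<Rightarrow>
     complex ^ 'd ^ 'd \<Rightarrow> (complex ^ 'd ^ 'd) list \<Rightarrow> 'b ^ 'd ^ 'd" where
  "X_monomial scl X a0 [] = emb_mat scl a0"
| "X_monomial scl X a0 (a # as) = emb_mat scl a0 ** X ** X_monomial scl X a as"

text \<open>
  Nonzero monomials of pairwise different lengths are linearly independent; the scalar
  coefficients of a linear combination are absorbed in the factors \<open>a\<^sub>0\<close>.
\<close>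

definition algebraically_free ::
  "(complex \<Rightarrow> 'b \<Rightarrow> 'b) \<Rightarrow> 'b :: ring_1 ^ 'd ^ 'd \<Rightarrow> bool" where
  "algebraically_free scl X \<longleftrightarrow>
     (\<forall>N (a0 :: nat \<Rightarrow> complex ^ 'd ^ 'd) as.
        (\<forall>n\<le>N. length (as n) = n) \<longrightarrow>
        (\<Sum>n\<le>N. X_monomial scl X (a0 n) (as n)) = 0 \<longrightarrow>
        (\<forall>n\<le>N. X_monomial scl X (a0 n) (as n) = 0))"


text \<open>
  A \<open>d\<^sup>2 \<times> d\<^sup>2\<close> matrix has rows indexed by \<open>(p, r)\<close> and columns by \<open>(q, s)\<close>, so that
  \<open>A(p,q;r,s) = A((p-1)d+r, (q-1)d+s)\<close> becomes \<open>A $ (p, r) $ (q, s)\<close>.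
\<close>

type_synonym 'd sqmat = "complex ^ ('d \<times> 'd) ^ ('d \<times> 'd)"

definition entry :: "'d sqmat \<Rightarrow> 'd :: finite \<Rightarrow> 'd \<Rightarrow> 'd \<Rightarrow> 'd \<Rightarrow> complex" where
  "entry A p q r s = A $ (p, r) $ (q, s)"

definition mk_sqmat :: "('d :: finite \<Rightarrow> 'd \<Rightarrow> 'd \<Rightarrow> 'd \<Rightarrow> complex) \<Rightarrow> 'd sqmat" where
  "mk_sqmat f = (\<chi> u v. f (fst u) (fst v) (snd u) (snd v))"

lemma entry_mk_sqmat [simp]: "entry (mk_sqmat f) p q r s = f p q r s"
  by (simp add: entry_def mk_sqmat_def)

definition kron :: "complex ^ 'd ^ 'd \<Rightarrow> complex ^ 'd ^ 'd \<Rightarrow> 'd :: finite sqmat"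
    (infixl \<open>\<otimes>\<^sub>K\<close> 75) where
  "A \<otimes>\<^sub>K B = mk_sqmat (\<lambda>p q r s. A $ p $ q * B $ r $ s)"

definition cov_mat :: "('d \<times> 'd \<Rightarrow> 'd \<times> 'd \<Rightarrow> real) \<Rightarrow> 'd :: finite sqmat" where
  "cov_mat \<sigma> = mk_sqmat (\<lambda>p q r s. complex_of_real (\<sigma> (p, q) (r, s)))"

definition Theta :: "'d :: finite sqmat \<Rightarrow> 'd sqmat" where
  "Theta A = mk_sqmat (\<lambda>p q r s. entry A p r q s)"

definition partial_transpose :: "'d :: finite sqmat \<Rightarrow> 'd sqmat" where
  "partial_transpose A = mk_sqmat (\<lambda>p q r s. entry A p q s r)"

definition Phi :: "'d :: finite sqmat \<Rightarrow> 'd sqmat" where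
  "Phi A = Theta (partial_transpose A)"


definition cauchy_transform ::
  "(complex \<Rightarrow> 'b \<Rightarrow> 'b) \<Rightarrow> ('b \<Rightarrow> complex) \<Rightarrow> 'b :: ring_1 ^ 'd ^ 'd \<Rightarrow>
     complex ^ 'd ^ 'd \<Rightarrow> complex ^ 'd ^ 'd" where
  "cauchy_transform scl \<psi> X a = id_tensor \<psi> (matrix_inv (emb_mat scl a - X))"

definition resolvent_arg ::
  "(complex \<Rightarrow> 'b \<Rightarrow> 'b) \<Rightarrow> 'b :: ring_1 ^ 'd ^ 'd \<Rightarrow> complex ^ 'd ^ 'd \<Rightarrow> 'b ^ 'd ^ 'd" where
  "resolvent_arg scl X a = mat 1 - emb_mat scl a ** X"

text \<open>
  \<open>G_inv scl \<psi> X a\<close> is the extended \<open>\<G>(a\<^sup>-\<^sup>1)\<close>; by \<open>cauchy_transform_matrix_inv\<close> below it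
  is the Cauchy transform at the inverse of \<open>a\<close> whenever \<open>a\<close> is invertible. It is meaningful
  only if \<open>resolvent_arg scl X a\<close> is invertible.
\<close>

definition G_inv ::
  "(complex \<Rightarrow> 'b \<Rightarrow> 'b) \<Rightarrow> ('b \<Rightarrow> complex) \<Rightarrow> 'b :: ring_1 ^ 'd ^ 'd \<Rightarrow>
     complex ^ 'd ^ 'd \<Rightarrow> complex ^ 'd ^ 'd" where
  "G_inv scl \<psi> X a = id_tensor \<psi> (matrix_inv (resolvent_arg scl X a)) ** a"

text \<open>
  In the next three definitions \<open>g\<close> and \<open>h\<close> stand for \<open>\<G>(a)\<close> and \<open>\<G>(b)\<close>:
  \<open>\<G>\<^sub>D(a,b)\<close> and \<open>\<H>(a,b)\<close> depend on \<open>a\<close> and \<open>b\<close> through these values only.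
\<close>

definition denom :: "('d \<times> 'd \<Rightarrow> 'd \<times> 'd \<Rightarrow> real) \<Rightarrow> complex ^ 'd ^ 'd \<Rightarrow>
    complex ^ 'd ^ 'd \<Rightarrow> 'd :: finite sqmat" where
  "denom \<sigma> g h = mat 1 - cov_mat \<sigma> ** (g \<otimes>\<^sub>K h)"

definition GD_of :: "('d \<times> 'd \<Rightarrow> 'd \<times> 'd \<Rightarrow> real) \<Rightarrow> complex ^ 'd ^ 'd \<Rightarrow>
    complex ^ 'd ^ 'd \<Rightarrow> 'd :: finite sqmat" where
  "GD_of \<sigma> g h = (g \<otimes>\<^sub>K h) ** matrix_inv (denom \<sigma> g h)"

definition H_of :: "('d \<times> 'd \<Rightarrow> 'd \<times> 'd \<Rightarrow> real) \<Rightarrow> complex ^ 'd ^ 'd \<Rightarrow>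
    complex ^ 'd ^ 'd \<Rightarrow> 'd :: finite sqmat" where
  "H_of \<sigma> g h = matrix_inv (denom \<sigma> g h) ** cov_mat \<sigma>"

text \<open>
  \<open>second_order_map scl \<psi> X \<sigma> \<alpha> \<beta>\<close> is the displayed expression with \<open>\<alpha> = za\<close>, \<open>\<beta> = wb\<close>. Since
  \<open>\<alpha>\<^sup>-\<^sup>T\<close> is the inverse of the transpose of \<open>\<alpha>\<close>, \<open>\<G>(\<alpha>\<^sup>-\<^sup>T)\<close> is \<open>G_inv scl \<psi> X (transpose \<alpha>)\<close>.
\<close>

definition second_order_map ::
  "(complex \<Rightarrow> 'b \<Rightarrow> 'b) \<Rightarrow> ('b \<Rightarrow> complex) \<Rightarrow> 'b :: ring_1 ^ 'd ^ 'd \<Rightarrow>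
     ('d \<times> 'd \<Rightarrow> 'd \<times> 'd \<Rightarrow> real) \<Rightarrow> complex ^ 'd ^ 'd \<Rightarrow> complex ^ 'd ^ 'd \<Rightarrow> 'd :: finite sqmat"
  where
  "second_order_map scl \<psi> X \<sigma> \<alpha> \<beta> =
     (let G = G_inv scl \<psi> X;
          H = H_of \<sigma> (G \<alpha>) (G \<beta>)
      in GD_of \<sigma> (G \<alpha>) (G (transpose \<alpha>)) **
         (Theta H +
          Phi (partial_transpose H ** partial_transpose (G \<alpha> \<otimes>\<^sub>K G \<beta>) ** partial_transpose H)) **
         transpose (GD_of \<sigma> (G \<beta>) (G (transpose \<beta>))))"

text \<open>All inverses occurring in \<open>second_order_map\<close> exist.\<close>

definition second_order_map_defined ::
  "(complex \<Rightarrow> 'b \<Rightarrow> 'b) \<Rightarrow> ('b \<Rightarrow> complex) \<Rightarrow> 'b :: ring_1 ^ 'd ^ 'd \<Rightarrow>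
     ('d \<times> 'd \<Rightarrow> 'd \<times> 'd \<Rightarrow> real) \<Rightarrow> complex ^ 'd ^ 'd \<Rightarrow> complex ^ 'd :: finite ^ 'd \<Rightarrow> bool"
  where
  "second_order_map_defined scl \<psi> X \<sigma> \<alpha> \<beta> \<longleftrightarrow>
     (let G = G_inv scl \<psi> X
      in invertible (resolvent_arg scl X \<alpha>) \<and> invertible (resolvent_arg scl X (transpose \<alpha>)) \<and>
         invertible (resolvent_arg scl X \<beta>) \<and> invertible (resolvent_arg scl X (transpose \<beta>)) \<and>
         invertible (denom \<sigma> (G \<alpha>) (G \<beta>)) \<and>
         invertible (denom \<sigma> (G \<alpha>) (G (transpose \<alpha>))) \<and>
         invertible (denom \<sigma> (G \<beta>) (G (transpose \<beta>))))"

definition resolvent_domain ::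
  "(complex \<Rightarrow> 'b \<Rightarrow> 'b) \<Rightarrow> 'b :: ring_1 ^ 'd ^ 'd \<Rightarrow>
     complex ^ 'd ^ 'd \<Rightarrow> complex ^ 'd ^ 'd \<Rightarrow> (complex \<times> complex) set" where
  "resolvent_domain scl X a b =
     {(z, w). invertible (resolvent_arg scl X (scale_mat z a)) \<and>
              invertible (resolvent_arg scl X (scale_mat w b))}"

text \<open>Analyticity in two complex variables: local expansion into a convergent power series.\<close>

definition analytic2_on :: "(complex \<times> complex \<Rightarrow> complex) \<Rightarrow> (complex \<times> complex) set \<Rightarrow> bool"
  where
  "analytic2_on f S \<longleftrightarrow>
     (\<forall>(z0, w0)\<in>S. \<exists>r>0. \<exists>c :: nat \<Rightarrow> nat \<Rightarrow> complex.
        \<forall>z\<in>ball z0 r. \<forall>w\<in>ball w0 r.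
          ((\<lambda>(m, n). c m n * (z - z0) ^ m * (w - w0) ^ n) has_sum f (z, w)) UNIV)"


lemma matrix_inv_inverse:
  fixes A :: "'b :: ring_1 ^ 'd :: finite ^ 'd"
  assumes "invertible A"
  shows "A ** matrix_inv A = mat 1" "matrix_inv A ** A = mat 1"
  using assms someI_ex[of "\<lambda>B. A ** B = mat 1 \<and> B ** A = mat 1"]
  unfolding matrix_inv_def invertible_def by blast+

lemma matrix_inv_unique:
  fixes A B :: "'b :: ring_1 ^ 'd :: finite ^ 'd"
  assumes "A ** B = mat 1" "B ** A = mat 1"
  shows "matrix_inv A = B"
proof -
  have inv: "invertible A" using assms unfolding invertible_def by blast
  have "matrix_inv A = (B ** A) ** matrix_inv A" using assms by simp
  also have "\<dots> = B"
    by (simp add: matrix_inv_inverse[OF inv] flip: matrix_mul_assoc)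
  finally show ?thesis .
qed

lemma (in tracial_cstar_prob_space) cauchy_transform_matrix_inv:
  fixes X :: "'b ^ 'd :: finite ^ 'd"
  assumes a: "invertible a" and inv: "invertible (resolvent_arg scl X a)"
  shows "cauchy_transform scl \<psi> X (matrix_inv a) = G_inv scl \<psi> X a"
proof -
  have scl_0: "scl 0 x = 0" for x
    using scl_of_real[of 0 x] by simp
  have scl_1: "scl 1 x = x" for x
    using scl_of_real[of 1 x] by simp
  have psi_0: "\<psi> 0 = 0"
    using state_linear unfolding complex_linear_on_def by (metis UNIV_I add_cancel_right_right)
  have scl_sum: "scl (sum f S) 1 = (\<Sum>k\<in>S. scl (f k) 1)" for f :: "'d \<Rightarrow> complex" and S
    by (induction S rule: infinite_finite_induct) (auto simp: scl_0 scl_add_left)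
  have psi_sum: "\<psi> (sum f S) = (\<Sum>k\<in>S. \<psi> (f k))" for f :: "'d \<Rightarrow> 'b" and S
    using state_linear
    by (induction S rule: infinite_finite_induct) (auto simp: psi_0 complex_linear_on_def)
  have emb_mult: "emb_mat scl (u ** v) = emb_mat scl u ** emb_mat scl v" for u v :: "complex ^ 'd ^ 'd"
    by (simp add: emb_mat_def matrix_matrix_mult_def vec_eq_iff scl_sum scl_mult_left scl_scl)
  have emb_1: "emb_mat scl (mat 1) = mat 1"
    by (simp add: emb_mat_def mat_def vec_eq_iff scl_0 scl_1)
  have psi_emb: "id_tensor \<psi> (M ** emb_mat scl a) = id_tensor \<psi> M ** a" for M :: "'b ^ 'd ^ 'd"
    using state_linear
    by (simp add: id_tensor_def emb_mat_def matrix_matrix_mult_def vec_eq_iff psi_sum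
        scl_mult_right complex_linear_on_def mult.commute)
  define a' where "a' = matrix_inv a"
  have aa': "a ** a' = mat 1" "a' ** a = mat 1"
    using matrix_inv_inverse[OF a] unfolding a'_def by simp_all
  define R where "R = matrix_inv (resolvent_arg scl X a)"
  have R: "resolvent_arg scl X a ** R = mat 1" "R ** resolvent_arg scl X a = mat 1"
    using matrix_inv_inverse[OF inv] unfolding R_def by simp_all
  have e: "emb_mat scl a' ** emb_mat scl a = mat 1" "emb_mat scl a ** emb_mat scl a' = mat 1"
    by (simp_all add: aa' emb_1 flip: emb_mult)
  have diff_distrib: "M ** (N - K) = M ** N - M ** K" for M N K :: "'b ^ 'd ^ 'd"
    by (simp add: matrix_matrix_mult_def vec_eq_iff right_diff_distrib sum_subtractf)
  have sub: "emb_mat scl a' - X = emb_mat scl a' ** resolvent_arg scl X a"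
    unfolding resolvent_arg_def by (simp add: diff_distrib matrix_mul_assoc e)
  have "matrix_inv (emb_mat scl a' - X) = R ** emb_mat scl a"
  proof (rule matrix_inv_unique)
    have "(emb_mat scl a' - X) ** (R ** emb_mat scl a) =
        emb_mat scl a' ** (resolvent_arg scl X a ** R) ** emb_mat scl a"
      unfolding sub by (simp add: matrix_mul_assoc)
    then show "(emb_mat scl a' - X) ** (R ** emb_mat scl a) = mat 1"
      by (simp add: R e)
    have "(R ** emb_mat scl a) ** (emb_mat scl a' - X) =
        R ** (emb_mat scl a ** emb_mat scl a') ** resolvent_arg scl X a"
      unfolding sub by (simp add: matrix_mul_assoc)
    then show "(R ** emb_mat scl a) ** (emb_mat scl a' - X) = mat 1"
      by (simp add: R e)
  qed
  then show ?thesis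
    unfolding cauchy_transform_def G_inv_def a'_def[symmetric] R_def[symmetric]
    by (simp add: psi_emb)
qed

end

theory Submission
  imports Defs "HOL-Complex_Analysis.Conformal_Mappings"
begin

text \<open>
  Write \<open>U\<^sub>a(z) = (1 - z a X)\<^sup>-\<^sup>1 z a\<close>, so that \<open>\<G>((z a)\<^sup>-\<^sup>1)\<close> is the mean of \<open>U\<^sub>a(z)\<close>, and
  \<open>L = \<G>((z a)\<^sup>-\<^sup>1) \<otimes> \<G>((w b)\<^sup>-\<^sup>1)\<close>. The matrix \<open>T(z, w)\<close> of mixed second moments of the entries of
  \<open>U\<^sub>a(z)\<close> and of the transposed \<open>U\<^sub>b(w)\<close> is analytic wherever both resolvents exist. Near the
  origin the Schwinger-Dyson recursion for the non-crossing pairings gives \<open>T = L + L \<Sigma> T\<close>, and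
  analytic continuation carries this equation to the whole component. Hence
  \<open>(1 - \<Sigma> L)(1 + \<Sigma> T) = 1\<close>: the denominators never vanish, \<open>\<G>\<^sub>D = T\<close> and
  \<open>\<H> = \<Sigma> + \<Sigma> T \<Sigma>\<close>, so the map of the theorem is a polynomial in analytic functions.

  The transposed resolvent may fail to exist in the algebra when the state is not faithful. Reversal
  of words preserves moments, hence 2-norms, so the mixed moments with reversed entries
  still define a bounded bilinear form. For a faithful state the norm is determined by moments,
  reversal is isometric, and the transposed resolvent is the reversal of the given one.
\<close>

section \<open>C*-algebras and tracial states\<close>

text \<open>The obstacle is that the inverse of \<open>denom\<close> is a priori only meromorphic in
  (z, w), and nothing in its formula excludes poles inside the component. Moments of resolvents have
  no poles where the resolvents exist, so the inverse has to be recognised as built from such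
  moments. Which moments to take is read off from the recursion: pairing the first X of a word with
  a letter of either resolvent cuts that resolvent in two, and the terms so produced have the shape
  of the linearised equation for the mean. Joint analyticity comes from a bounded bilinear pairing
  of two algebra-valued power series. Continuation proceeds in one variable at a time, which is why
  the argument lives on the product of the two one-variable components; this product contains the
  component in the statement. The C*-structure serves mainly two facts: left multiplication is
  bounded in the 2-norm, and for a faithful state moments determine the norm. Both rest on square
  roots, which are produced by iteration instead of functional calculus.\<close>

context cstar_algebra
begin

lemma scl_zero [simp]: "scl 0 x = 0"
  using scl_of_real[of 0 x] by simp

lemma scl_one [simp]: "scl 1 x = x"
  using scl_of_real[of 1 x] by simp

lemma scl_zero_right [simp]: "scl c 0 = 0"
  using scl_scl[of c 0 0] by simp

lemma scl_minus_one: "scl (-1) x = - x"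
  using scl_of_real[of "-1" x] by simp

lemma scl_minus_right: "scl c (- x) = - scl c x"
  using scl_scl[of c "-1" x] scl_scl[of "-1" c x] by (simp add: scl_minus_one)

lemma scl_diff_right: "scl c (x - y) = scl c x - scl c y"
  using scl_add_right[of c x "- y"] by (simp add: scl_minus_right)

lemma scl_sum_right: "scl c (sum f S) = (\<Sum>k\<in>S. scl c (f k))"
  by (induction S rule: infinite_finite_induct) (auto simp: scl_add_right)

lemma scl_scaleR: "scl c (r *\<^sub>R x) = r *\<^sub>R scl c x"
  by (simp add: mult.commute scl_scl flip: scl_of_real)

lemma bounded_linear_scl: "bounded_linear (scl c)"
  by (rule bounded_linear_intro[of _ "cmod c"])
    (simp_all add: scl_add_right scl_scaleR norm_scl mult.commute)

lemma scl_one_mult: "scl c 1 * x = scl c x" "x * scl c 1 = scl c x"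
  by (simp_all add: scl_mult_left scl_mult_right)

lemma star_zero [simp]: "star 0 = 0"
  using star_add[of 0 0] by simp

lemma star_one [simp]: "star 1 = 1"
proof -
  have "star (star 1 * 1) = star (star 1)" by simp
  also have "star (star 1 * 1) = star 1 * star (star 1)" by (rule star_mult)
  finally show ?thesis by (simp add: star_star)
qed

lemma star_scaleR: "star (r *\<^sub>R x) = r *\<^sub>R star x"
  using star_scl[of "complex_of_real r" x] by (simp add: scl_of_real)

lemma star_minus: "star (- x) = - star x"
  using star_scaleR[of "-1" x] by simp

lemma star_diff: "star (x - y) = star x - star y"
  using star_add[of x "- y"] by (simp add: star_minus)

lemma star_power: "star (x ^ n) = star x ^ n"
  by (induction n) (simp_all add: star_mult power_commutes)

lemma norm_star: "norm (star x) = norm x"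
proof -
  have le: "norm x \<le> norm (star x)" for x
  proof (cases "x = 0")
    case False
    have "norm x * norm x \<le> norm (star x) * norm x"
      using cstar_identity[of x] norm_mult_ineq[of "star x" x] by (simp add: power2_eq_square)
    then show ?thesis using False by simp
  qed simp
  show ?thesis using le[of x] le[of "star x"] by (simp add: star_star)
qed

lemma bounded_linear_star: "bounded_linear star"
  by (rule bounded_linear_intro[of _ 1]) (simp_all add: star_add star_scaleR norm_star)

text \<open>
  The iteration \<open>u \<mapsto> (y + u\<^sup>2) / 2\<close> has the fixed point \<open>1 - \<surd>(1 - y)\<close>; the increments are
  dominated by those of the scalar iteration with \<open>y = 1\<close>, so that \<open>norm y = 1\<close> is allowed.
\<close>

lemma sqrt_one_minus:
  assumes ny: "norm y \<le> 1" and sy: "star y = y"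
  obtains s where "star s = s" "s * s = 1 - y" "norm (1 - s) \<le> 1"
    "\<And>c. c * y = y * c \<Longrightarrow> c * s = s * c"
proof -
  define t :: "nat \<Rightarrow> real" where "t = rec_nat 0 (\<lambda>_ t. (1 + t\<^sup>2) / 2)"
  define u where "u = rec_nat 0 (\<lambda>_ u. (1/2) *\<^sub>R (y + u * u))"
  have t0: "t 0 = 0" and tS: "t (Suc n) = (1 + (t n)\<^sup>2) / 2" for n by (simp_all add: t_def)
  have u0: "u 0 = 0" and uS: "u (Suc n) = (1/2) *\<^sub>R (y + u n * u n)" for n
    by (simp_all add: u_def)
  have t01: "0 \<le> t n \<and> t n \<le> 1" for n
    by (induction n) (auto simp: t0 tS power_le_one)
  have nu: "norm (u n) \<le> t n" for n
  proof (induction n)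
    case (Suc n)
    have "norm (y + u n * u n) \<le> 1 + (t n)\<^sup>2"
      using ny norm_triangle_ineq[of y "u n * u n"] norm_mult_ineq[of "u n" "u n"]
        mult_mono[OF Suc Suc] t01[of n] by (simp add: power2_eq_square)
    then show ?case by (simp add: uS tS)
  qed (simp add: t0 u0)
  \<comment> \<open>The iterates are polynomials in y. This commutation survives the limit and takes
    the place of functional calculus later.\<close>
  have comm: "c * u n = u n * c" if "c * y = y * c" for c n
  proof (induction n)
    case (Suc n)
    have "c * (u n * u n) = u n * u n * c"
      by (metis Suc mult.assoc)
    then show ?case by (simp add: uS that distrib_left distrib_right)
  qed (simp add: u0)
  have comm2: "u m * u n = u n * u m" for m n
    by (rule comm, rule comm[symmetric]) simp
  have su: "star (u n) = u n" for n
    by (induction n) (simp_all add: u0 uS star_scaleR star_add star_mult sy)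
  have diff: "norm (u (Suc n) - u n) \<le> t (Suc n) - t n" for n
  proof (induction n)
    case 0
    then show ?case using ny by (simp add: u0 uS t0 tS)
  next
    case (Suc n)
    have "u (Suc (Suc n)) - u (Suc n) = (1/2) *\<^sub>R (u (Suc n) * u (Suc n) - u n * u n)"
      by (simp add: uS[of "Suc n"] uS[of n] algebra_simps)
    also have "u (Suc n) * u (Suc n) - u n * u n = (u (Suc n) + u n) * (u (Suc n) - u n)"
      using comm2[of n "Suc n"] by (simp add: algebra_simps)
    finally have "norm (u (Suc (Suc n)) - u (Suc n))
        \<le> (1/2) * (norm (u (Suc n) + u n) * norm (u (Suc n) - u n))"
      using norm_mult_ineq[of "u (Suc n) + u n" "u (Suc n) - u n"] by simp
    also have "\<dots> \<le> (1/2) * ((t (Suc n) + t n) * (t (Suc n) - t n))"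
    proof (intro mult_left_mono mult_mono Suc)
      show "norm (u (Suc n) + u n) \<le> t (Suc n) + t n"
        using nu[of "Suc n"] nu[of n] norm_triangle_ineq[of "u (Suc n)" "u n"] by linarith
      show "0 \<le> t (Suc n) + t n"
        using t01[of "Suc n"] t01[of n] by linarith
    qed auto
    also have "\<dots> = t (Suc (Suc n)) - t (Suc n)"
      by (simp add: tS[of "Suc n"] tS[of n] power2_eq_square field_simps)
    finally show ?case .
  qed
  \<comment> \<open>Monotonicity of \<open>t\<close> is read off from the domination just proved,
    since norms are nonnegative.\<close>
  have "incseq t"
  proof (rule incseq_SucI)
    show "t n \<le> t (Suc n)" for n
      using diff[of n] norm_ge_zero[of "u (Suc n) - u n"] by linarith
  qed
  then have "convergent t"
    using t01 incseq_convergent[of t 1] by (metis convergent_def)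
  then have "summable (\<lambda>n. t (Suc n) - t n)"
    by (auto simp: convergent_def intro: telescope_summable)
  then have "summable (\<lambda>n. u (Suc n) - u n)"
    by (rule summable_comparison_test'[where N = 0]) (rule diff)
  then have "convergent (\<lambda>n. \<Sum>i<n. u (Suc i) - u i)"
    by (simp add: summable_iff_convergent)
  then have "convergent u"
    by (simp add: sum_lessThan_telescope u0)
  then obtain v where v: "u \<longlonglongrightarrow> v" by (auto simp: convergent_def)
  have "(\<lambda>n. u (Suc n)) \<longlonglongrightarrow> (1/2) *\<^sub>R (y + v * v)"
    unfolding uS by (intro tendsto_intros v)
  then have vfix: "v = (1/2) *\<^sub>R (y + v * v)"
    using LIMSEQ_Suc[OF v] LIMSEQ_unique by blast
  have sv: "star v = v"
    using bounded_linear.tendsto[OF bounded_linear_star v] v by (simp add: su LIMSEQ_unique)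
  have nv: "norm v \<le> 1"
    using Lim_bounded[OF tendsto_norm[OF v], of 0 1] nu t01 by (meson order_trans)
  show ?thesis
  proof (rule that[of "1 - v"])
    have "2 *\<^sub>R v = y + v * v" by (subst vfix) simp
    then show "(1 - v) * (1 - v) = 1 - y" by (simp add: algebra_simps scaleR_2)
    show "c * (1 - v) = (1 - v) * c" if "c * y = y * c" for c
    proof -
      have "(\<lambda>n. c * u n) \<longlonglongrightarrow> c * v" "(\<lambda>n. u n * c) \<longlonglongrightarrow> v * c"
        by (intro tendsto_intros v)+
      then have "c * v = v * c" using comm[OF that] LIMSEQ_unique by auto
      then show ?thesis by (simp add: algebra_simps)
    qed
  qed (use sv nv in \<open>auto simp: star_diff\<close>)
qed

text \<open>\<open>h\<close> is the real part of \<open>h + \<i> k\<close>.\<close>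

lemma norm_le_sum_squares:
  assumes "star h = h" "star k = k" "h * k = k * h"
  shows "(norm h)\<^sup>2 \<le> norm (h * h + k * k)"
proof -
  define u where "u = h + scl \<i> k"
  have su: "star u = h - scl \<i> k"
    using scl_scl[of "-1" \<i> k] by (simp add: u_def star_add star_scl assms scl_minus_one)
  have "star u * u = h * h + k * k"
    unfolding su unfolding u_def
    by (simp add: algebra_simps scl_mult_left scl_mult_right scl_scl scl_minus_one assms(3)
        scl_diff_right)
  then have eq: "(norm u)\<^sup>2 = norm (h * h + k * k)" by (simp flip: cstar_identity)
  have "h = (1/2) *\<^sub>R (u + star u)"
    unfolding su unfolding u_def by (simp flip: scaleR_2)
  then have "norm h = (1/2) * norm (u + star u)" by (metis norm_scaleR abs_of_pos half_gt_zero_iff zero_less_one)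
  also have "\<dots> \<le> norm u"
    using norm_triangle_ineq[of u "star u"] by (simp add: norm_star)
  finally show ?thesis by (simp flip: eq)
qed

text \<open>\<open>k * k\<close> plays the role of the absolute value of \<open>g\<close>.\<close>

lemma absolute_value_sqrt:
  assumes ng: "norm g \<le> 1" and sg: "star g = g"
  obtains k where "star k = k" "k * k * (k * k) = g * g" "\<And>c. c * g = g * c \<Longrightarrow> c * k = k * c"
proof -
  have "norm (g * g) \<le> 1"
    using norm_mult_ineq[of g g] mult_mono[OF ng ng] by simp
  moreover have "star (g * g) = g * g" by (simp add: star_mult sg)
  ultimately obtain s where s: "star s = s" "s * s = 1 - g * g" "\<And>c. c * (g * g) = g * g * c \<Longrightarrow> c * s = s * c"
    using sqrt_one_minus[of "g * g"] by metis
  have gg: "c * (g * g) = g * g * c" if "c * g = g * c" for c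
    by (metis that mult.assoc)
  \<comment> \<open>Here s*s + g*g = 1, so \<open>norm s\<close> is at most 1 and a root of 1 - s*s
    can be taken next.\<close>
  have "(norm s)\<^sup>2 \<le> norm (s * s + g * g)"
    by (intro norm_le_sum_squares s(1) sg s(3)[symmetric] gg) simp
  then have "(norm s)\<^sup>2 \<le> 1" by (simp add: s)
  then have "norm (s * s) \<le> 1" using norm_mult_ineq[of s s] by (simp add: power2_eq_square)
  moreover have "star (s * s) = s * s" by (simp add: star_mult s(1))
  \<comment> \<open>\<open>m\<close> is the absolute value of \<open>g\<close>, as m*m = g*g. The
    bound on \<open>1 - m\<close> permits a third root, that of m = 1 - (1 - m).\<close>
  ultimately obtain m where m: "star m = m" "m * m = 1 - s * s" "norm (1 - m) \<le> 1"
      "\<And>c. c * (s * s) = s * s * c \<Longrightarrow> c * m = m * c"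
    using sqrt_one_minus[of "s * s"] by metis
  have "star (1 - m) = 1 - m" by (simp add: star_diff m)
  then obtain k where k: "star k = k" "k * k = 1 - (1 - m)"
      "\<And>c. c * (1 - m) = (1 - m) * c \<Longrightarrow> c * k = k * c"
    using sqrt_one_minus[of "1 - m"] m(3) by metis
  show ?thesis
  proof (rule that[of k])
    show "k * k * (k * k) = g * g" by (simp add: k(2) m(2) s(2))
    show "c * k = k * c" if "c * g = g * c" for c
    proof -
      have "c * (s * s) = s * s * c" using gg[OF that] by (simp add: s algebra_simps)
      then have "c * m = m * c" by (rule m)
      then show ?thesis by (intro k) (simp add: algebra_simps)
    qed
  qed (rule k(1))
qed

end

section \<open>Tracial states and the 2-norm\<close>

context tracial_cstar_prob_space
begin

lemma psi_add: "\<psi> (x + y) = \<psi> x + \<psi> y"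
  using state_linear by (simp add: complex_linear_on_def)

lemma psi_scl: "\<psi> (scl c x) = c * \<psi> x"
  using state_linear by (simp add: complex_linear_on_def)

lemma psi_zero [simp]: "\<psi> 0 = 0"
  using psi_scl[of 0 0] by simp

lemma psi_minus: "\<psi> (- x) = - \<psi> x"
  using psi_scl[of "-1" x] by (simp add: scl_minus_one)

lemma psi_diff: "\<psi> (x - y) = \<psi> x - \<psi> y"
  using psi_add[of x "- y"] by (simp add: psi_minus)

lemma psi_scaleR: "\<psi> (r *\<^sub>R x) = of_real r * \<psi> x"
  by (simp add: psi_scl flip: scl_of_real)

lemma psi_sum: "\<psi> (sum f S) = (\<Sum>k\<in>S. \<psi> (f k))"
  by (induction S rule: infinite_finite_induct) (auto simp: psi_add)

lemma psi_trace: "\<psi> (x * y) = \<psi> (y * x)"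
  using state_tracial by (simp add: tracial_on_def)

definition norm2_sq :: "'b \<Rightarrow> real" where
  "norm2_sq x = Re (\<psi> (star x * x))"

lemma psi_star_self: "\<psi> (star x * x) = of_real (norm2_sq x)"
  using state_pos[of x] by (auto simp: norm2_sq_def nonneg_Reals_def)

lemma norm2_sq_nonneg: "0 \<le> norm2_sq x"
  using state_pos[of x] by (auto simp: norm2_sq_def nonneg_Reals_def)

text \<open>Positivity at 1 + x makes \<open>\<psi> x + \<psi> (star x)\<close> real; the same fact
  for i x yields the other half of hermiticity.\<close>

lemma psi_star: "\<psi> (star x) = cnj (\<psi> x)"
proof -
  have im: "Im (\<psi> x + \<psi> (star x)) = 0" for x
  proof -
    have "star (1 + x) * (1 + x) = 1 + (x + star x) + star x * x"
      by (simp add: star_add algebra_simps)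
    then have "\<psi> (star (1 + x) * (1 + x)) = 1 + (\<psi> x + \<psi> (star x)) + \<psi> (star x * x)"
      by (simp add: psi_add state_one)
    then show ?thesis unfolding psi_star_self by (metis add_cancel_left_left complex_eq_iff Im_complex_of_real plus_complex.sel(2) one_complex.sel(2) add_cancel_right_left add.right_neutral)
  qed
  show ?thesis
    using im[of x] im[of "scl \<i> x"] by (simp add: psi_scl star_scl complex_eq_iff)
qed

lemma norm2_sq_star: "norm2_sq (star x) = norm2_sq x"
  unfolding norm2_sq_def by (simp add: star_star psi_trace[of x])

text \<open>If \<open>norm x\<close> is at most 1, write \<open>1 - star x * x = s * s\<close> with
  s selfadjoint; the defect \<open>norm2_sq y - norm2_sq (x * y)\<close> is then
  \<open>norm2_sq (s * y)\<close>. Rescaling leads to norm exactly 1, the boundary case that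
  \<open>sqrt_one_minus\<close> includes.\<close>

lemma norm2_sq_mult_le: "norm2_sq (x * y) \<le> (norm x)\<^sup>2 * norm2_sq y"
proof -
  have contr: "norm2_sq (x * y) \<le> norm2_sq y" if "norm x \<le> 1" for x
  proof -
    have "norm (star x * x) \<le> 1" using that by (simp add: cstar_identity power_le_one)
    then obtain s where s: "star s = s" "s * s = 1 - star x * x"
      using sqrt_one_minus[of "star x * x"] by (metis star_mult star_star)
    have "star (s * y) * (s * y) = star y * (s * s) * y"
      by (simp add: star_mult s(1) mult.assoc)
    also have "\<dots> = star y * y - star (x * y) * (x * y)"
      by (simp add: s star_mult algebra_simps)
    finally have "norm2_sq (s * y) = norm2_sq y - norm2_sq (x * y)"
      by (simp add: norm2_sq_def psi_diff)
    then show ?thesis using norm2_sq_nonneg[of "s * y"] by simp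
  qed
  show ?thesis
  proof (cases "x = 0")
    case False
    define x' where "x' = (1 / norm x) *\<^sub>R x"
    have x: "x = norm x *\<^sub>R x'" using False by (simp add: x'_def)
    have "norm2_sq (x * y) = (norm x)\<^sup>2 * norm2_sq (x' * y)"
      by (subst x) (simp add: norm2_sq_def star_scaleR psi_scaleR power2_eq_square)
    moreover have "norm2_sq (x' * y) \<le> norm2_sq y"
      using False by (intro contr) (simp add: x'_def)
    ultimately show ?thesis by (simp add: mult_left_mono)
  qed (simp add: norm2_sq_def)
qed

lemma norm2_sq_le: "norm2_sq x \<le> (norm x)\<^sup>2"
  using norm2_sq_mult_le[of x 1] by (simp add: norm2_sq_def state_one)

lemma Cauchy_Schwarz_star: "(cmod (\<psi> (star x * y)))\<^sup>2 \<le> norm2_sq x * norm2_sq y"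
proof -
  define c where "c = \<psi> (star x * y)"
  have yx: "\<psi> (star y * x) = cnj c"
    using psi_star[of "star x * y"] by (simp add: star_mult star_star c_def)
  have quad: "0 \<le> norm2_sq x - 2 * s * (cmod c)\<^sup>2 + s\<^sup>2 * (cmod c)\<^sup>2 * norm2_sq y" for s :: real
  proof -
    \<comment> \<open>The factor \<open>cnj c\<close> aligns the phases: both cross terms become -s
      |c|^2.\<close>
    define l where "l = - (cnj c * of_real s)"
    have "star (x + scl l y) * (x + scl l y)
        = star x * x + scl l (star x * y) + scl (cnj l) (star y * x) + scl (cnj l * l) (star y * y)"
      by (simp add: star_add star_scl algebra_simps scl_mult_left scl_mult_right scl_scl
          scl_add_right)
    then have "\<psi> (star (x + scl l y) * (x + scl l y))
        = of_real (norm2_sq x) + l * c + cnj l * cnj c + cnj l * l * of_real (norm2_sq y)"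
      by (simp add: psi_add psi_scl psi_star_self yx flip: c_def)
    also have "\<dots> = of_real (norm2_sq x) - 2 * of_real s * (c * cnj c)
        + (of_real s)\<^sup>2 * (c * cnj c) * of_real (norm2_sq y)"
      by (simp add: l_def power2_eq_square algebra_simps)
    also have "\<dots> = of_real (norm2_sq x - 2 * s * (cmod c)\<^sup>2 + s\<^sup>2 * (cmod c)\<^sup>2 * norm2_sq y)"
      by (simp flip: complex_norm_square)
    finally have "norm2_sq (x + scl l y)
        = norm2_sq x - 2 * s * (cmod c)\<^sup>2 + s\<^sup>2 * (cmod c)\<^sup>2 * norm2_sq y"
      unfolding psi_star_self of_real_eq_iff .
    then show ?thesis using norm2_sq_nonneg[of "x + scl l y"] by simp
  qed
  have "(cmod c)\<^sup>2 \<le> norm2_sq x * norm2_sq y"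
  proof (cases "norm2_sq y = 0")
    case True
    \<comment> \<open>Without faithfulness this case is genuine. The quadratic in s is affine here,
      and the chosen s would make it negative.\<close>
    have "c = 0"
    proof (rule ccontr)
      assume "c \<noteq> 0"
      then show False
        using quad[of "(norm2_sq x + 1) / (cmod c)\<^sup>2"] norm2_sq_nonneg[of x]
        by (simp add: True del: divide_le_cancel)
    qed
    then show ?thesis by (simp add: norm2_sq_nonneg)
  next
    case False
    then have pos: "norm2_sq y > 0" using norm2_sq_nonneg[of y] by simp
    have "0 \<le> norm2_sq x - (cmod c)\<^sup>2 / norm2_sq y"
      using quad[of "1 / norm2_sq y"] pos by (simp add: power2_eq_square field_simps)
    then show ?thesis using pos by (simp add: field_simps)
  qed
  then show ?thesis by (simp add: c_def)
qed

text \<open>Traciality enters here: the inequality for \<open>star x\<close> and y produces the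
  2-norm of \<open>star x\<close>, which \<open>norm2_sq_star\<close> exchanges for that of
  x.\<close>

lemma Cauchy_Schwarz: "cmod (\<psi> (x * y)) \<le> sqrt (norm2_sq x) * sqrt (norm2_sq y)"
proof -
  have "(cmod (\<psi> (x * y)))\<^sup>2 \<le> norm2_sq x * norm2_sq y"
    using Cauchy_Schwarz_star[of "star x" y] by (simp add: star_star norm2_sq_star)
  then show ?thesis by (simp add: real_le_rsqrt flip: real_sqrt_mult)
qed

lemma sqrt_norm2_sq_le: "sqrt (norm2_sq x) \<le> norm x"
  by (rule real_le_lsqrt) (simp_all add: norm2_sq_le)

lemma psi_bound: "cmod (\<psi> x) \<le> norm x"
  using Cauchy_Schwarz[of 1 x] sqrt_norm2_sq_le[of x]
  by (simp add: norm2_sq_def state_one)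

lemma bounded_linear_psi: "bounded_linear \<psi>"
  by (rule bounded_linear_intro[of _ 1])
    (use psi_scaleR in \<open>simp_all add: psi_add psi_bound scaleR_conv_of_real\<close>)

text \<open>
  If \<open>norm x > norm y\<close>, the positive part \<open>P\<close> of \<open>H\<^sup>2 - \<rho>\<close> with \<open>H = star x * x\<close> is nonzero for
  some \<open>\<rho> > norm (star y * y)\<^sup>2\<close>, and then the moments of \<open>H\<^sup>2\<close> grow at least like \<open>\<rho>\<^sup>n\<close>.
\<close>

lemma norm_le_of_moments:
  assumes faithful: "faithful_state star \<psi>"
    and mom: "\<And>n. \<psi> ((star x * x) ^ n) = \<psi> ((star y * y) ^ n)"
  shows "norm x \<le> norm y"
proof (rule ccontr)
  assume "\<not> norm x \<le> norm y"
  then have less: "norm y < norm x" by simp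
  define H where "H = star x * x"
  define K where "K = star y * y"
  have sH: "star H = H" and sK: "star K = K" by (simp_all add: H_def K_def star_mult star_star)
  have "norm K < norm H"
    using less by (simp add: H_def K_def cstar_identity power_strict_mono)
  then have "(norm K)\<^sup>2 < (norm H)\<^sup>2" by (simp add: power_strict_mono)
  then obtain \<rho> where \<rho>: "(norm K)\<^sup>2 < \<rho>" "\<rho> < (norm H)\<^sup>2" using dense by blast
  have \<rho>0: "\<rho> > 0" using \<rho>(1) by (meson zero_le_power2 le_less_trans)
  \<comment> \<open>\<open>c\<close> bounds the norm of H*H - rho, so that \<open>g\<close> has norm
    at most 1, as \<open>absolute_value_sqrt\<close> requires.\<close>
  define c where "c = norm (H * H) + \<rho>"
  have c0: "c > 0" using \<rho>0 by (simp add: c_def add_nonneg_pos)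
  define g where "g = (1 / c) *\<^sub>R (H * H - \<rho> *\<^sub>R 1)"
  have "norm (H * H - \<rho> *\<^sub>R 1) \<le> c"
    using norm_triangle_ineq4[of "H * H" "\<rho> *\<^sub>R 1"] \<rho>0 by (simp add: c_def)
  then have "norm g \<le> 1" using c0 by (simp add: g_def)
  moreover have sg: "star g = g" by (simp add: g_def star_scaleR star_diff star_mult sH)
  ultimately obtain k where k: "star k = k" "k * k * (k * k) = g * g"
      "\<And>c. c * g = g * c \<Longrightarrow> c * k = k * c"
    using absolute_value_sqrt[of g] by metis
  have HH: "H * H = \<rho> *\<^sub>R 1 + c *\<^sub>R g" using c0 by (simp add: g_def)
  have Hg: "H * g = g * H" by (simp add: g_def algebra_simps)
  have Hk: "H * k = k * H" by (rule k(3)) (rule Hg)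
  have gk: "g * k = k * g" by (rule k(3)) simp
  \<comment> \<open>\<open>k * k\<close> is the absolute value of \<open>g\<close>, so
    \<open>P\<close> is twice the positive part of \<open>g\<close>; accordingly \<open>g\<close>
    acts on \<open>P\<close> as its absolute value (\<open>gP\<close>).\<close>
  define P where "P = k * k + g"
  have sP: "star P = P" by (simp add: P_def star_add star_mult k(1) sg)
  have Hkk: "H * (k * k) = k * k * H" unfolding mult.assoc[symmetric] Hk unfolding mult.assoc Hk ..
  have gkk: "g * (k * k) = k * k * g" unfolding mult.assoc[symmetric] gk unfolding mult.assoc gk ..
  have HP: "H * P = P * H" by (simp add: P_def distrib_left distrib_right Hkk Hg)
  have gP: "g * P = k * k * P" by (simp add: P_def distrib_left k(2) gkk)
  \<comment> \<open>If the positive part vanished, H*H + c k*k would equal rho, and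
    \<open>norm_le_sum_squares\<close> would bound the square of \<open>norm H\<close> by rho,
    against the choice of rho.\<close>
  have "P \<noteq> 0"
  proof
    assume "P = 0"
    then have "k * k + g = 0" unfolding P_def .
    then have gm: "g = - (k * k)" by (rule iffD1[OF add_eq_0_iff])
    have eq: "H * H + (sqrt c *\<^sub>R k) * (sqrt c *\<^sub>R k) = \<rho> *\<^sub>R 1"
      unfolding HH gm using c0 by simp
    have "(norm H)\<^sup>2 \<le> norm (H * H + (sqrt c *\<^sub>R k) * (sqrt c *\<^sub>R k))"
      by (rule norm_le_sum_squares) (simp_all add: sH star_scaleR k(1) Hk)
    then show False using \<rho> \<rho>0 unfolding eq by simp
  qed
  then have P0: "norm2_sq P > 0"
    using faithful norm2_sq_nonneg[of P] psi_star_self[of P]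
    by (auto simp: faithful_state_def less_le)
  have HnP: "H ^ n * P = P * H ^ n" for n
    by (simp add: HP power_commuting_commutes)
  \<comment> \<open>Multiplied by \<open>P\<close>, the element H*H becomes rho + c k*k, which
    exceeds rho by a positive term.\<close>
  have step: "norm2_sq (H ^ Suc n * P) \<ge> \<rho> * norm2_sq (H ^ n * P)" for n
  proof -
    have sn: "star (H ^ n * P) = P * H ^ n" by (simp add: star_mult star_power sH sP)
    have "star (H ^ Suc n * P) = P * H ^ n * H"
      by (simp only: star_mult star_power sH sP power_Suc2 power_Suc mult.assoc power_commutes)
    then have "star (H ^ Suc n * P) * (H ^ Suc n * P) = P * H ^ n * (H * H) * (H ^ n * P)"
      by (simp only: power_Suc mult.assoc)
    also have "\<dots> = \<rho> *\<^sub>R (P * H ^ n * (H ^ n * P)) + c *\<^sub>R (P * H ^ n * (g * (H ^ n * P)))"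
      unfolding HH by (simp add: distrib_left distrib_right mult.assoc)
    also have "g * (H ^ n * P) = k * k * (H ^ n * P)"
      unfolding HnP using gP by (simp flip: mult.assoc)
    finally have "star (H ^ Suc n * P) * (H ^ Suc n * P)
        = \<rho> *\<^sub>R (star (H ^ n * P) * (H ^ n * P))
          + c *\<^sub>R (star (k * (H ^ n * P)) * (k * (H ^ n * P)))"
      unfolding star_mult[of k] sn k(1) by (simp add: mult.assoc)
    then have "norm2_sq (H ^ Suc n * P) = \<rho> * norm2_sq (H ^ n * P) + c * norm2_sq (k * (H ^ n * P))"
      by (simp add: norm2_sq_def psi_add psi_scaleR)
    then show ?thesis using c0 norm2_sq_nonneg by simp
  qed
  have low: "\<rho> ^ n * norm2_sq P \<le> norm2_sq (H ^ n * P)" for n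
  proof (induction n)
    case (Suc n)
    then have "\<rho> * (\<rho> ^ n * norm2_sq P) \<le> \<rho> * norm2_sq (H ^ n * P)"
      using \<rho>0 by (intro mult_left_mono) auto
    then show ?case using step[of n] by (simp add: mult.assoc)
  qed simp
  \<comment> \<open>Here the moments of \<open>H\<close> are exchanged for those of
    \<open>K\<close>, which the norm of \<open>K\<close> controls.\<close>
  have up: "norm2_sq (H ^ n * P) \<le> (norm P)\<^sup>2 * ((norm K)\<^sup>2) ^ n" for n
  proof -
    have "norm2_sq (H ^ n) = Re (\<psi> (H ^ (n + n)))"
      by (simp add: norm2_sq_def star_power sH power_add)
    also have "\<dots> = Re (\<psi> (K ^ (n + n)))" using mom by (simp add: H_def K_def)
    also have "\<dots> \<le> norm (K ^ (n + n))"
      using psi_bound complex_Re_le_cmod order_trans by blast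
    also have "\<dots> \<le> norm K ^ (n + n)" by (rule norm_power_ineq)
    also have "\<dots> = ((norm K)\<^sup>2) ^ n" by (simp add: power_mult mult_2 flip: power_mult)
    finally have "norm2_sq (H ^ n) \<le> ((norm K)\<^sup>2) ^ n" .
    then have "(norm P)\<^sup>2 * norm2_sq (H ^ n) \<le> (norm P)\<^sup>2 * ((norm K)\<^sup>2) ^ n"
      by (simp add: mult_left_mono)
    then show ?thesis using norm2_sq_mult_le[of P "H ^ n"] by (simp add: HnP)
  qed
  define q where "q = (norm K)\<^sup>2 / \<rho>"
  have q: "0 \<le> q" "q < 1" using \<rho> \<rho>0 by (simp_all add: q_def)
  have "norm2_sq P \<le> (norm P)\<^sup>2 * q ^ n" for n
  proof -
    have "\<rho> ^ n * norm2_sq P \<le> (norm P)\<^sup>2 * ((norm K)\<^sup>2) ^ n"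
      using low[of n] up[of n] by simp
    then show ?thesis using \<rho>0 by (simp add: q_def power_divide field_simps)
  qed
  moreover have "(\<lambda>n. (norm P)\<^sup>2 * q ^ n) \<longlonglongrightarrow> (norm P)\<^sup>2 * 0"
    using q by (intro tendsto_intros LIMSEQ_realpow_zero) auto
  ultimately have "norm2_sq P \<le> 0"
    by (intro LIMSEQ_le_const) auto
  then show False using P0 by simp
qed

end

section \<open>Non-crossing pairings\<close>

lemma pairings_iff:
  "\<pi> \<in> pairings k \<longleftrightarrow>
     (\<forall>i<k. \<pi> i < k \<and> \<pi> i \<noteq> i \<and> \<pi> (\<pi> i) = i) \<and> (\<forall>i\<ge>k. \<pi> i = i)"
proof
  assume "\<pi> \<in> pairings k"
  then have p: "\<pi> permutes {..<k}" and q: "\<forall>i<k. \<pi> i \<noteq> i \<and> \<pi> (\<pi> i) = i"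
    by (auto simp: pairings_def)
  have "\<pi> i < k" if "i < k" for i
    using permutes_in_image[OF p, of i] that by simp
  moreover have "\<pi> i = i" if "i \<ge> k" for i
    using permutes_not_in[OF p, of i] that by simp
  ultimately show "(\<forall>i<k. \<pi> i < k \<and> \<pi> i \<noteq> i \<and> \<pi> (\<pi> i) = i) \<and> (\<forall>i\<ge>k. \<pi> i = i)"
    using q by blast
next
  assume r: "(\<forall>i<k. \<pi> i < k \<and> \<pi> i \<noteq> i \<and> \<pi> (\<pi> i) = i) \<and> (\<forall>i\<ge>k. \<pi> i = i)"
  then have inv: "\<pi> (\<pi> i) = i" for i by (metis not_less)
  have "bij \<pi>" by (rule o_bij[of \<pi>]) (auto simp: inv)
  then have "\<pi> permutes {..<k}" using r by (simp add: permutes_def bij_iff)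
  then show "\<pi> \<in> pairings k" using r by (simp add: pairings_def)
qed

lemma NC2_iff:
  "\<pi> \<in> NC2 k \<longleftrightarrow>
     (\<forall>i<k. \<pi> i < k \<and> \<pi> i \<noteq> i \<and> \<pi> (\<pi> i) = i) \<and> (\<forall>i\<ge>k. \<pi> i = i) \<and>
     (\<forall>i j. i < j \<longrightarrow> j < \<pi> i \<longrightarrow> \<pi> i < \<pi> j \<longrightarrow> \<pi> j < k \<longrightarrow> False)"
  unfolding NC2_def by (auto simp: pairings_iff)

lemma finite_NC2: "finite (NC2 k)"
proof (rule finite_subset)
  show "NC2 k \<subseteq> {\<pi>. \<pi> permutes {..<k}}" by (auto simp: NC2_def pairings_def)
  show "finite {\<pi>. \<pi> permutes {..<k}}" by (simp add: finite_permutations)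
qed

text \<open>Catalan decomposition: the pair formed by 0 and its partner \<open>Suc i\<close>
  separates the \<open>i\<close> points under it from the points beyond. \<open>NC2_left\<close> and
  \<open>NC2_right\<close> recover the two parts. The subtractions are never truncated in the
  branches where they occur.\<close>

definition NC2_join :: "nat \<Rightarrow> (nat \<Rightarrow> nat) \<Rightarrow> (nat \<Rightarrow> nat) \<Rightarrow> nat \<Rightarrow> nat" where
  "NC2_join i p q j =
     (if j = 0 then Suc i else if j = Suc i then 0 else if j \<le> i then Suc (p (j - 1))
      else q (j - (i + 2)) + (i + 2))"

text \<open>Pairings fix every point outside their range, and \<open>NC2_left_join\<close> is an
  equality of functions; hence the explicit \<open>else j\<close>. \<open>NC2_right\<close> inherits
  its fixed points from \<open>\<pi>\<close>.\<close>

definition NC2_left :: "nat \<Rightarrow> (nat \<Rightarrow> nat) \<Rightarrow> nat \<Rightarrow> nat" where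
  "NC2_left i \<pi> j = (if j < i then \<pi> (Suc j) - 1 else j)"

definition NC2_right :: "nat \<Rightarrow> (nat \<Rightarrow> nat) \<Rightarrow> nat \<Rightarrow> nat" where
  "NC2_right i \<pi> j = \<pi> (j + (i + 2)) - (i + 2)"

lemma NC2_join_simps [simp]:
  "NC2_join i p q 0 = Suc i"
  "NC2_join i p q (Suc i) = 0"
  "j < i \<Longrightarrow> NC2_join i p q (Suc j) = Suc (p j)"
  "NC2_join i p q (j + (i + 2)) = q j + (i + 2)"
  by (auto simp: NC2_join_def)

lemma join_cases:
  fixes j i :: nat
  obtains (first) "j = 0" | (last) "j = Suc i" | (left) k where "j = Suc k" "k < i"
    | (right) k where "j = k + (i + 2)"
proof (cases j)
  case (Suc k)
  consider "k < i" | "k = i" | "k > i" by linarith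
  then show ?thesis
  proof cases
    case 3
    then have "j = (j - (i + 2)) + (i + 2)" using Suc by simp
    then show ?thesis using that(4) by blast
  qed (use Suc that in auto)
qed (use that in auto)

lemma NC2_join_in:
  assumes i: "i < n" and p: "p \<in> NC2 i" and q: "q \<in> NC2 (n - Suc i)"
  shows "NC2_join i p q \<in> NC2 (Suc n)"
proof -
  let ?\<pi> = "NC2_join i p q"
  have p1: "\<And>k. k < i \<Longrightarrow> p k < i \<and> p k \<noteq> k \<and> p (p k) = k"
    and p3: "\<And>j k. j < k \<Longrightarrow> k < p j \<Longrightarrow> p j < p k \<Longrightarrow> p k < i \<Longrightarrow> False"
    using p by (auto simp: NC2_iff)
  have q1: "\<And>k. k < n - Suc i \<Longrightarrow> q k < n - Suc i \<and> q k \<noteq> k \<and> q (q k) = k"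
    and q2: "\<And>k. k \<ge> n - Suc i \<Longrightarrow> q k = k"
    and q3: "\<And>j k. j < k \<Longrightarrow> k < q j \<Longrightarrow> q j < q k \<Longrightarrow> q k < n - Suc i \<Longrightarrow> False"
    using q by (auto simp: NC2_iff)
  have "?\<pi> j < Suc n \<and> ?\<pi> j \<noteq> j \<and> ?\<pi> (?\<pi> j) = j" if "j < Suc n" for j
  proof (cases rule: join_cases[where j = j and i = i])
    case (left k)
    then show ?thesis using p1[of k] i by auto
  next
    case (right k)
    then have "k < n - Suc i" using that by auto
    then show ?thesis using q1[of k] i unfolding right NC2_join_simps by auto
  qed (use i in auto)
  moreover have "?\<pi> j = j" if "j \<ge> Suc n" for j
  proof (cases rule: join_cases[where j = j and i = i])
    case (right k)
    then have "k \<ge> n - Suc i" using that by auto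
    then show ?thesis using q2[of k] unfolding right NC2_join_simps by auto
  qed (use i that in auto)
  moreover have False if l: "j < k" "k < ?\<pi> j" "?\<pi> j < ?\<pi> k" "?\<pi> k < Suc n" for j k
  proof (cases rule: join_cases[where j = j and i = i])
    case first
    then show ?thesis
      using l p1 by (cases rule: join_cases[where j = k and i = i]) (auto, fastforce)
  next
    case last
    then show ?thesis using l by simp
  next
    case (left j')
    show ?thesis
    proof (cases rule: join_cases[where j = k and i = i])
      case (left k')
      then show ?thesis using l \<open>j = Suc j'\<close> \<open>j' < i\<close> p3[of j' k'] p1[of k'] by auto
    qed (use l left p1[of j'] in auto)
  next
    case (right j')
    show ?thesis
    proof (cases rule: join_cases[where j = k and i = i])
      case (right k')
      have "q k' < n - Suc i" using l(4) i unfolding right NC2_join_simps by linarith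
      then show ?thesis
        using l q3[of j' k'] unfolding right \<open>j = j' + (i + 2)\<close> NC2_join_simps by auto
    qed (use l right in auto)
  qed
  ultimately show ?thesis unfolding NC2_iff by blast
qed

text \<open>No pair may cross the arc from 0 to \<open>Suc i\<close>, so \<open>\<pi>\<close>
  preserves the set of points under the arc (\<open>low\<close>) and the set of points beyond it
  (\<open>high\<close>).\<close>

lemma NC2_split:
  assumes \<pi>: "\<pi> \<in> NC2 (Suc n)" and i: "\<pi> 0 = Suc i"
  shows "i < n" "NC2_left i \<pi> \<in> NC2 i" "NC2_right i \<pi> \<in> NC2 (n - Suc i)"
    "NC2_join i (NC2_left i \<pi>) (NC2_right i \<pi>) = \<pi>"
proof -
  have r1: "\<And>k. k < Suc n \<Longrightarrow> \<pi> k < Suc n \<and> \<pi> k \<noteq> k \<and> \<pi> (\<pi> k) = k"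
    and r2: "\<And>k. k \<ge> Suc n \<Longrightarrow> \<pi> k = k"
    and r3: "\<And>j k. j < k \<Longrightarrow> k < \<pi> j \<Longrightarrow> \<pi> j < \<pi> k \<Longrightarrow> \<pi> k < Suc n \<Longrightarrow> False"
    using \<pi> by (auto simp: NC2_iff)
  show i': "i < n" using r1[of 0] i by simp
  have iS: "\<pi> (Suc i) = 0" using r1[of 0] i by simp
  have inv: "\<pi> (\<pi> k) = k" for k using r1[of k] r2[of k] by (cases "k < Suc n") auto
  have low: "0 < \<pi> (Suc k) \<and> \<pi> (Suc k) \<le> i" if "k < i" for k
  proof -
    have "\<pi> (Suc k) \<noteq> 0" using inv[of "Suc k"] i that by (metis nat.inject less_irrefl)
    moreover have "\<pi> (Suc k) \<noteq> Suc i" using inv[of "Suc k"] iS by auto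
    moreover have "\<not> \<pi> (Suc k) > Suc i"
      using r3[of 0 "Suc k"] r1[of "Suc k"] i i' that by auto
    ultimately show ?thesis by linarith
  qed
  have high: "\<pi> k \<ge> i + 2" if "k \<ge> i + 2" for k
  proof (rule ccontr)
    assume n: "\<not> \<pi> k \<ge> i + 2"
    have "\<pi> k \<noteq> 0"
    proof
      assume "\<pi> k = 0"
      then show False using inv[of k] i that by simp
    qed
    moreover have "\<pi> k \<noteq> Suc i" using inv[of k] iS that by auto
    ultimately have "\<pi> k \<noteq> 0" "\<pi> k \<noteq> Suc i" by simp_all
    then obtain k' where k': "\<pi> k = Suc k'" "k' < i" using n by (cases "\<pi> k") auto
    then show False using low[of k'] inv[of k] that by auto
  qed
  show "NC2_left i \<pi> \<in> NC2 i"
  proof -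
    have "NC2_left i \<pi> k < i \<and> NC2_left i \<pi> k \<noteq> k \<and> NC2_left i \<pi> (NC2_left i \<pi> k) = k"
      if "k < i" for k
      using low[OF that] that inv[of "Suc k"] r1[of "Suc k"] i' by (auto simp: NC2_left_def)
    moreover have False if "j < k" "k < NC2_left i \<pi> j" "NC2_left i \<pi> j < NC2_left i \<pi> k"
        "NC2_left i \<pi> k < i" for j k
    proof (cases "k < i")
      case True
      then have "Suc k < \<pi> (Suc j) \<and> \<pi> (Suc j) < \<pi> (Suc k)"
        using that low[of j] low[of k] by (auto simp: NC2_left_def split: if_splits)
      moreover have "\<pi> (Suc k) < Suc n" using low[OF True] i' by linarith
      ultimately show ?thesis using \<open>j < k\<close> r3[of "Suc j" "Suc k"] by blast
    qed (use that in \<open>auto simp: NC2_left_def\<close>)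
    moreover have "NC2_left i \<pi> k = k" if "k \<ge> i" for k
      using that by (simp add: NC2_left_def)
    ultimately show ?thesis unfolding NC2_iff by blast
  qed
  show "NC2_right i \<pi> \<in> NC2 (n - Suc i)"
  proof -
    have rr: "\<pi> (k + (i + 2)) = NC2_right i \<pi> k + (i + 2)" for k
      using high[of "k + (i + 2)"] unfolding NC2_right_def by linarith
    have "NC2_right i \<pi> k < n - Suc i \<and> NC2_right i \<pi> k \<noteq> k \<and> NC2_right i \<pi> (NC2_right i \<pi> k) = k"
      if "k < n - Suc i" for k
    proof -
      have "k + (i + 2) < Suc n" using that i' by linarith
      from r1[OF this] show ?thesis unfolding rr by linarith
    qed
    moreover have "NC2_right i \<pi> k = k" if "k \<ge> n - Suc i" for k
      using r2[of "k + (i + 2)"] that unfolding rr by linarith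
    moreover have False if l: "j < k" "k < NC2_right i \<pi> j" "NC2_right i \<pi> j < NC2_right i \<pi> k"
        "NC2_right i \<pi> k < n - Suc i" for j k
      using r3[of "j + (i + 2)" "k + (i + 2)"] l i' unfolding rr by linarith
    ultimately show ?thesis unfolding NC2_iff by blast
  qed
  show "NC2_join i (NC2_left i \<pi>) (NC2_right i \<pi>) = \<pi>"
  proof
    fix j show "NC2_join i (NC2_left i \<pi>) (NC2_right i \<pi>) j = \<pi> j"
    proof (cases rule: join_cases[where j = j and i = i])
      case (left k)
      then show ?thesis using low[of k] by (auto simp: NC2_left_def)
    next
      case (right k)
      show ?thesis
        unfolding right NC2_join_simps using high[of "k + (i + 2)"] by (auto simp: NC2_right_def)
    qed (use i iS in auto)
  qed
qed

lemma NC2_left_join: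
  assumes "p \<in> NC2 i"
  shows "NC2_left i (NC2_join i p q) = p"
proof
  fix j show "NC2_left i (NC2_join i p q) j = p j"
    using assms by (cases "j < i") (auto simp: NC2_left_def NC2_iff)
qed

lemma NC2_right_join: "NC2_right i (NC2_join i p q) = q"
  unfolding NC2_right_def NC2_join_simps by auto

text \<open>The left end points of the joined pairing are 0 and the shifted left end points of
  \<open>p\<close> and \<open>q\<close>, and the product splits along them.\<close>

lemma pairing_weight_join:
  assumes i: "i < length w" and p: "p \<in> NC2 i" and q: "q \<in> NC2 (length w - Suc i)"
  shows "pairing_weight \<sigma> (c # w) (NC2_join i p q) =
    of_real (\<sigma> c (w ! i)) * pairing_weight \<sigma> (take i w) p *
      pairing_weight \<sigma> (drop (Suc i) w) q"
proof -
  let ?\<pi> = "NC2_join i p q" and ?cs = "c # w"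
  let ?f = "\<lambda>u. of_real (\<sigma> (?cs ! u) (?cs ! ?\<pi> u))"
  let ?A = "{u. u < i \<and> u < p u}" and ?B = "{u. u < length w - Suc i \<and> u < q u}"
  have p1: "p k < i" if "k < i" for k
    using p that by (simp add: NC2_iff)
  have q1: "q k < length w - Suc i" if "k < length w - Suc i" for k
    using q that by (simp add: NC2_iff)
  have "{u. u < length ?cs \<and> u < ?\<pi> u} = insert 0 (Suc ` ?A \<union> (\<lambda>u. u + (i + 2)) ` ?B)" (is "?L = ?R")
  proof (rule set_eqI)
    fix u show "u \<in> ?L \<longleftrightarrow> u \<in> ?R"
    proof (cases rule: join_cases[where j = u and i = i])
      case (left k)
      then show ?thesis using i by auto
    next
      case (right k)
      have "k + (i + 2) \<notin> Suc ` ?A" by auto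
      then show ?thesis unfolding right using i NC2_join_simps(4)[of i p q k] by auto
    qed auto
  qed
  then have "pairing_weight \<sigma> ?cs ?\<pi> = prod ?f (insert 0 (Suc ` ?A \<union> (\<lambda>u. u + (i + 2)) ` ?B))"
    by (simp add: pairing_weight_def)
  also have "\<dots> = ?f 0 * (prod ?f (Suc ` ?A) * prod ?f ((\<lambda>u. u + (i + 2)) ` ?B))"
    by (subst prod.insert, simp, force, subst prod.union_disjoint) auto
  also have "prod ?f (Suc ` ?A) = pairing_weight \<sigma> (take i w) p"
    unfolding pairing_weight_def using i p1
    by (subst prod.reindex) (auto intro!: prod.cong)
  also have "prod ?f ((\<lambda>u. u + (i + 2)) ` ?B) = pairing_weight \<sigma> (drop (Suc i) w) q"
  proof -
    have "inj_on (\<lambda>u. u + (i + 2)) ?B" by (auto intro: inj_onI)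
    then have "prod ?f ((\<lambda>u. u + (i + 2)) ` ?B) = (\<Prod>u\<in>?B. ?f (u + (i + 2)))"
      by (simp add: prod.reindex del: NC2_join_simps)
    also have "\<dots> = pairing_weight \<sigma> (drop (Suc i) w) q"
      unfolding pairing_weight_def
    proof (rule prod.cong)
      fix u assume "u \<in> {u. u < length (drop (Suc i) w) \<and> u < q u}"
      then have u: "u < length w - Suc i" by auto
      have "?cs ! (u + (i + 2)) = drop (Suc i) w ! u" "?cs ! (q u + (i + 2)) = drop (Suc i) w ! q u"
        using u q1[OF u] by (simp_all add: add.commute)
      then show "?f (u + (i + 2)) =
          of_real (\<sigma> (drop (Suc i) w ! u) (drop (Suc i) w ! q u))"
        unfolding NC2_join_simps by simp
    qed auto
    finally show ?thesis .
  qed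
  finally show ?thesis by simp
qed

text \<open>Pairings are sorted by the partner of the first letter; the letters between the two and
  the letters after them are then paired independently. Every recursion below comes from this
  one.\<close>

lemma sum_NC2_Suc:
  "(\<Sum>\<pi>\<in>NC2 (Suc (length w)). pairing_weight \<sigma> (c # w) \<pi>) =
    (\<Sum>i<length w. of_real (\<sigma> c (w ! i)) *
       (\<Sum>p\<in>NC2 i. pairing_weight \<sigma> (take i w) p) *
       (\<Sum>q\<in>NC2 (length w - Suc i). pairing_weight \<sigma> (drop (Suc i) w) q))"
proof -
  let ?n = "length w"
  let ?S = "\<lambda>i. {\<pi> \<in> NC2 (Suc ?n). \<pi> 0 = Suc i}"
  have "NC2 (Suc ?n) = (\<Union>i\<in>{..<?n}. ?S i)"
  proof -
    have "\<exists>i<?n. \<pi> 0 = Suc i" if "\<pi> \<in> NC2 (Suc ?n)" for \<pi>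
      using that NC2_split(1)[OF that]
      by (metis NC2_iff not0_implies_Suc zero_less_Suc)
    then show ?thesis by auto
  qed
  then have "(\<Sum>\<pi>\<in>NC2 (Suc ?n). pairing_weight \<sigma> (c # w) \<pi>)
      = (\<Sum>\<pi>\<in>(\<Union>i\<in>{..<?n}. ?S i). pairing_weight \<sigma> (c # w) \<pi>)" by simp
  also have "\<dots> = (\<Sum>i<?n. \<Sum>\<pi>\<in>?S i. pairing_weight \<sigma> (c # w) \<pi>)"
    by (rule sum.UNION_disjoint) (auto simp: finite_NC2)
  also have "\<dots> = (\<Sum>i<?n. \<Sum>(p, q)\<in>NC2 i \<times> NC2 (?n - Suc i).
      of_real (\<sigma> c (w ! i)) * pairing_weight \<sigma> (take i w) p *
      pairing_weight \<sigma> (drop (Suc i) w) q)"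
  proof (rule sum.cong[OF refl])
    fix i assume "i \<in> {..<?n}"
    then have i: "i < ?n" by simp
    show "(\<Sum>\<pi>\<in>?S i. pairing_weight \<sigma> (c # w) \<pi>) = (\<Sum>(p, q)\<in>NC2 i \<times> NC2 (?n - Suc i).
        of_real (\<sigma> c (w ! i)) * pairing_weight \<sigma> (take i w) p *
        pairing_weight \<sigma> (drop (Suc i) w) q)"
      by (rule sum.reindex_bij_witness[where i = "\<lambda>(p, q). NC2_join i p q"
            and j = "\<lambda>\<pi>. (NC2_left i \<pi>, NC2_right i \<pi>)"])
        (use i in \<open>auto simp: NC2_split NC2_left_join NC2_right_join NC2_join_in
            pairing_weight_join[symmetric]\<close>)
  qed
  also have "\<dots> = (\<Sum>i<?n. of_real (\<sigma> c (w ! i)) *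
       (\<Sum>p\<in>NC2 i. pairing_weight \<sigma> (take i w) p) *
       (\<Sum>q\<in>NC2 (?n - Suc i). pairing_weight \<sigma> (drop (Suc i) w) q))"
    by (simp add: sum.cartesian_product[symmetric] sum_product sum_distrib_left sum_distrib_right
        mult.assoc) (intro sum.cong refl sum.swap)
  finally show ?thesis .
qed

section \<open>The Schwinger-Dyson equation\<close>

lemma sum_UNIV_prod:
  "(\<Sum>c\<in>UNIV. f c) = (\<Sum>x\<in>UNIV. \<Sum>y\<in>UNIV. f (x :: 'c :: finite, y :: 'e :: finite))"
  by (simp add: sum.cartesian_product)

lemma sum_lessThan_add:
  fixes m n :: nat
  shows "(\<Sum>i<m + n. f i) = (\<Sum>i<m. f i) + (\<Sum>j<n. f (m + j) :: 'a :: comm_monoid_add)"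
  by (induction n) (simp_all add: add.assoc)

lemma sum_lists_Suc:
  "(\<Sum>w | length w = Suc n. f w) = (\<Sum>c\<in>UNIV. \<Sum>w | length w = n. f ((c :: 'c :: finite) # w))"
proof -
  have "(\<Sum>w | length w = Suc n. f w) = (\<Sum>(c, w)\<in>UNIV \<times> {w. length w = n}. f (c # w))"
    by (rule sum.reindex_bij_witness[where i = "\<lambda>(c, w). c # w" and j = "\<lambda>w. (hd w, tl w)"])
      (auto simp: length_Suc_conv)
  then show ?thesis by (simp add: sum.cartesian_product)
qed

lemma sum_lists_split:
  assumes "i < n"
  shows "(\<Sum>w | length w = n. f w) =
    (\<Sum>u | length u = i. \<Sum>c\<in>UNIV. \<Sum>v | length v = n - Suc i. f (u @ (c :: 'c :: finite) # v))"
proof -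
  have "(\<Sum>w | length w = n. f w) =
    (\<Sum>(u, c, v)\<in>{u. length u = i} \<times> UNIV \<times> {v. length v = n - Suc i}. f (u @ c # v))"
    by (rule sum.reindex_bij_witness[where i = "\<lambda>(u, c, v). u @ c # v"
          and j = "\<lambda>w. (take i w, w ! i, drop (Suc i) w)"])
      (use assms in \<open>auto simp: id_take_nth_drop[symmetric] nth_append\<close>)
  also have "\<dots> = (\<Sum>u | length u = i. \<Sum>c\<in>UNIV. \<Sum>v | length v = n - Suc i. f (u @ c # v))"
    by (simp add: sum.cartesian_product)
  finally show ?thesis .
qed

text \<open>Coefficient of a word \<open>w\<close> in an entry of \<open>a\<^sub>0 X a\<^sub>1 \<dots> X a\<^sub>n\<close>, for \<open>length w = n\<close> only.\<close>

fun mono_coeff :: "complex ^ 'd ^ 'd \<Rightarrow> (complex ^ 'd ^ 'd) list \<Rightarrow> 'd \<Rightarrow> 'd \<Rightarrow> ('d \<times> 'd) list \<Rightarrow> complex"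
  where
  "mono_coeff a0 [] p r w = a0 $ p $ r"
| "mono_coeff a0 (a # as) p r [] = 0"
| "mono_coeff a0 (a # as) p r (c # w) = a0 $ p $ fst c * mono_coeff a as (snd c) r w"

text \<open>Removing the letter \<open>c\<close> cuts the monomial at one factor X: the coefficient
  matrix before it closes the left piece, and the one after it, \<open>as ! length u\<close>, opens
  the right piece.\<close>

lemma mono_coeff_append:
  assumes "length u < length as"
  shows "mono_coeff a0 as p r (u @ c # v) =
    mono_coeff a0 (take (length u) as) p (fst c) u *
      mono_coeff (as ! length u) (drop (Suc (length u)) as) (snd c) r v"
  using assms
proof (induction u arbitrary: a0 as p)
  case Nil
  then show ?case by (cases as) auto
next
  case (Cons x u)
  then obtain a as' where "as = a # as'" by (cases as) auto
  then show ?case using Cons by (simp add: mult.assoc)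
qed

lemma word_append: "word X (u @ v) = word X u * word X v"
  by (simp add: word_def)

lemma word_Cons: "word X (c # v) = X $ fst c $ snd c * word X v"
  by (simp add: word_def case_prod_beta)

context cstar_algebra
begin

lemma X_monomial_expand:
  fixes X :: "'b ^ 'd :: finite ^ 'd"
  shows "X_monomial scl X a0 as $ p $ r =
    (\<Sum>w | length w = length as. scl (mono_coeff a0 as p r w) (word X w))"
proof (induction as arbitrary: a0 p)
  case Nil
  then show ?case by (simp add: emb_mat_def word_def)
next
  case (Cons a as)
  have "X_monomial scl X a0 (a # as) $ p $ r =
      (\<Sum>s\<in>UNIV. (\<Sum>q\<in>UNIV. scl (a0 $ p $ q) (X $ q $ s)) * X_monomial scl X a as $ s $ r)"
    by (simp add: matrix_matrix_mult_def emb_mat_def scl_mult_left)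
  also have "\<dots> = (\<Sum>s\<in>UNIV. \<Sum>q\<in>UNIV. \<Sum>w | length w = length as.
      scl (mono_coeff a0 (a # as) p r ((q, s) # w)) (word X ((q, s) # w)))"
    by (simp add: Cons.IH sum_product scl_mult_left scl_mult_right scl_scl word_Cons mult.commute)
  also have "\<dots> = (\<Sum>q\<in>UNIV. \<Sum>s\<in>UNIV. \<Sum>w | length w = length as.
      scl (mono_coeff a0 (a # as) p r ((q, s) # w)) (word X ((q, s) # w)))"
    by (rule sum.swap)
  also have "\<dots> = (\<Sum>w | length w = length (a # as).
      scl (mono_coeff a0 (a # as) p r w) (word X w))"
    by (simp only: length_Cons sum_lists_Suc sum_UNIV_prod)
  finally show ?case .
qed

end

text \<open>Moments are prescribed for the state of the ambient algebra, because resolvents are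
  limits of words and may leave the subalgebra generated by the entries of \<open>X\<close>.\<close>

locale semicircular_matrix = tracial_cstar_prob_space scl star \<psi>
  for scl :: "complex \<Rightarrow> 'b \<Rightarrow> 'b :: {real_normed_algebra_1, banach}"
    and star :: "'b \<Rightarrow> 'b" and \<psi> :: "'b \<Rightarrow> complex" +
  fixes X :: "'b ^ 'd :: finite ^ 'd" and \<sigma> :: "'d \<times> 'd \<Rightarrow> 'd \<times> 'd \<Rightarrow> real"
  assumes X_sym: "X $ p $ q = X $ q $ p"
    and X_star: "star (X $ p $ q) = X $ p $ q"
    and X_moments: "\<psi> (word X cs) = (\<Sum>\<pi>\<in>NC2 (length cs). pairing_weight \<sigma> cs \<pi>)"
begin

lemma Schwinger_Dyson_word:
  "\<psi> (X $ k $ l * word X w) = (\<Sum>i<length w. of_real (\<sigma> (k, l) (w ! i)) *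
     \<psi> (word X (take i w)) * \<psi> (word X (drop (Suc i) w)))"
  using sum_NC2_Suc[of \<sigma> "(k, l)" w] X_moments[of "(k, l) # w"]
  by (simp add: word_Cons X_moments min_def)

lemma psi_X_X: "\<psi> (X $ p $ q * X $ r $ s) = of_real (\<sigma> (p, q) (r, s))"
  using Schwinger_Dyson_word[of p q "[(r, s)]"] by (simp add: word_def state_one)

text \<open>The covariance is a second moment, so it inherits its symmetry from that of
  \<open>X\<close>.\<close>

lemma cov_swap: "\<sigma> (p, q) (r, s) = \<sigma> (p, q) (s, r)"
  using psi_X_X[of p q r s] psi_X_X[of p q s r] X_sym[of r s] by simp

lemma star_word: "star (word X w) = word X (rev w)"
  by (induction w) (simp_all add: word_def star_mult X_star case_prod_beta)

text \<open>On words \<open>star\<close> is reversal and the state turns it into conjugation, while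
  moments of words are real because \<open>\<sigma>\<close> is real valued. All later facts about
  reversal rest on this.\<close>

lemma psi_word_rev: "\<psi> (word X (rev w)) = \<psi> (word X w)"
proof -
  have "\<psi> (word X w) \<in> \<real>"
    unfolding X_moments pairing_weight_def by (intro sum_in_Reals prod_in_Reals) auto
  then show ?thesis by (simp add: psi_star Reals_cnj_iff flip: star_word)
qed

lemma psi_monomial_monomial:
  "\<psi> (x * (X_monomial scl X a0 as $ p $ q * X_monomial scl X b0 bs $ r $ s)) =
    (\<Sum>u | length u = length as. \<Sum>v | length v = length bs.
       mono_coeff a0 as p q u * mono_coeff b0 bs r s v * \<psi> (x * word X (u @ v)))"
proof -
  have "X_monomial scl X a0 as $ p $ q * X_monomial scl X b0 bs $ r $ s =
    (\<Sum>u | length u = length as. \<Sum>v | length v = length bs.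
       scl (mono_coeff a0 as p q u * mono_coeff b0 bs r s v) (word X (u @ v)))"
    unfolding X_monomial_expand sum_product
    by (simp add: scl_mult_left scl_mult_right scl_scl word_append mult.commute)
  then show ?thesis
    by (simp add: sum_distrib_left psi_sum scl_mult_right psi_scl)
qed

text \<open>The isolated entry of \<open>X\<close> is paired with a letter of one of the two
  monomials. If it is the first, the part before the letter is enclosed by the pair and becomes a
  mean, while the rest stays multiplied with the second monomial. If it is the second, the part
  after the letter becomes the mean, and the first monomial stays with the part before it.\<close>

lemma Schwinger_Dyson_monomial:
  "\<psi> (X $ k $ l * (X_monomial scl X a0 as $ p $ q * X_monomial scl X b0 bs $ r $ s)) =
    (\<Sum>i<length as. \<Sum>c\<in>UNIV. of_real (\<sigma> (k, l) c) *
       \<psi> (X_monomial scl X a0 (take i as) $ p $ fst c) *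
       \<psi> (X_monomial scl X (as ! i) (drop (Suc i) as) $ snd c $ q * X_monomial scl X b0 bs $ r $ s)) +
    (\<Sum>j<length bs. \<Sum>c\<in>UNIV. of_real (\<sigma> (k, l) c) *
       \<psi> (X_monomial scl X a0 as $ p $ q * X_monomial scl X b0 (take j bs) $ r $ fst c) *
       \<psi> (X_monomial scl X (bs ! j) (drop (Suc j) bs) $ snd c $ s))"
  (is "?lhs = ?A + ?B")
proof -
  let ?C = "\<lambda>u v. mono_coeff a0 as p q u * mono_coeff b0 bs r s v"
  let ?sg = "\<lambda>c. of_real (\<sigma> (k, l) c)"
  let ?W = "\<lambda>n. {w :: ('d \<times> 'd) list. length w = n}"
  let ?m = "length as" and ?n = "length bs"
  have SD: "\<psi> (X $ k $ l * word X (u @ v)) =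
      (\<Sum>i<?m. ?sg (u ! i) * \<psi> (word X (take i u)) * \<psi> (word X (drop (Suc i) u @ v))) +
      (\<Sum>j<?n. ?sg (v ! j) * \<psi> (word X (u @ take j v)) * \<psi> (word X (drop (Suc j) v)))"
    if "length u = ?m" "length v = ?n" for u v
  proof -
    show ?thesis
      unfolding Schwinger_Dyson_word length_append that sum_lessThan_add
      using that by (simp add: nth_append)
  qed
  have "?lhs = (\<Sum>u\<in>?W ?m. \<Sum>v\<in>?W ?n. ?C u v * \<psi> (X $ k $ l * word X (u @ v)))"
    by (rule psi_monomial_monomial)
  also have "\<dots> = (\<Sum>u\<in>?W ?m. \<Sum>v\<in>?W ?n.
      (\<Sum>i<?m. ?C u v * (?sg (u ! i) * \<psi> (word X (take i u)) * \<psi> (word X (drop (Suc i) u @ v)))) +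
      (\<Sum>j<?n. ?C u v * (?sg (v ! j) * \<psi> (word X (u @ take j v)) * \<psi> (word X (drop (Suc j) v)))))"
    by (intro sum.cong refl) (simp add: SD distrib_left sum_distrib_left)
  also have "\<dots> =
      (\<Sum>i<?m. \<Sum>u\<in>?W ?m. \<Sum>v\<in>?W ?n.
        ?C u v * (?sg (u ! i) * \<psi> (word X (take i u)) * \<psi> (word X (drop (Suc i) u @ v)))) +
      (\<Sum>j<?n. \<Sum>u\<in>?W ?m. \<Sum>v\<in>?W ?n.
        ?C u v * (?sg (v ! j) * \<psi> (word X (u @ take j v)) * \<psi> (word X (drop (Suc j) v))))"
    by (simp only: sum.distrib sum.swap[where B = "{..<?m}"] sum.swap[where B = "{..<?n}"])
  also have "(\<Sum>i<?m. \<Sum>u\<in>?W ?m. \<Sum>v\<in>?W ?n.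
        ?C u v * (?sg (u ! i) * \<psi> (word X (take i u)) * \<psi> (word X (drop (Suc i) u @ v)))) = ?A"
  proof (rule sum.cong[OF refl])
    fix i assume "i \<in> {..<?m}"
    then have i: "i < ?m" by simp
    have "(\<Sum>u\<in>?W ?m. \<Sum>v\<in>?W ?n.
        ?C u v * (?sg (u ! i) * \<psi> (word X (take i u)) * \<psi> (word X (drop (Suc i) u @ v)))) =
      (\<Sum>u1\<in>?W i. \<Sum>c\<in>UNIV. \<Sum>u2\<in>?W (?m - Suc i). \<Sum>v\<in>?W ?n. ?sg c *
        (mono_coeff a0 (take i as) p (fst c) u1 * \<psi> (word X u1)) *
        (mono_coeff (as ! i) (drop (Suc i) as) (snd c) q u2 * mono_coeff b0 bs r s v * \<psi> (word X (u2 @ v))))"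
      unfolding sum_lists_split[OF i]
      by (intro sum.cong refl) (use i in \<open>simp add: mono_coeff_append nth_append mult_ac\<close>)
    also have "\<dots> = (\<Sum>c\<in>UNIV. \<Sum>u1\<in>?W i. ?sg c *
        (mono_coeff a0 (take i as) p (fst c) u1 * \<psi> (word X u1)) *
        (\<Sum>u2\<in>?W (?m - Suc i). \<Sum>v\<in>?W ?n.
          mono_coeff (as ! i) (drop (Suc i) as) (snd c) q u2 * mono_coeff b0 bs r s v * \<psi> (word X (u2 @ v))))"
      unfolding sum_distrib_left by (rule sum.swap)
    also have "\<dots> = (\<Sum>c\<in>UNIV. ?sg c *
        (\<Sum>u1\<in>?W i. mono_coeff a0 (take i as) p (fst c) u1 * \<psi> (word X u1)) *
        (\<Sum>u2\<in>?W (?m - Suc i). \<Sum>v\<in>?W ?n.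
          mono_coeff (as ! i) (drop (Suc i) as) (snd c) q u2 * mono_coeff b0 bs r s v * \<psi> (word X (u2 @ v))))"
      by (simp only: sum_distrib_left[symmetric] sum_distrib_right[symmetric])
    finally show "(\<Sum>u\<in>?W ?m. \<Sum>v\<in>?W ?n.
        ?C u v * (?sg (u ! i) * \<psi> (word X (take i u)) * \<psi> (word X (drop (Suc i) u @ v)))) =
      (\<Sum>c\<in>UNIV. ?sg c * \<psi> (X_monomial scl X a0 (take i as) $ p $ fst c) *
       \<psi> (X_monomial scl X (as ! i) (drop (Suc i) as) $ snd c $ q * X_monomial scl X b0 bs $ r $ s))"
      using psi_monomial_monomial[of 1 "as ! i" "drop (Suc i) as" _ q b0 bs r s] i
      by (simp add: X_monomial_expand psi_sum psi_scl min_def)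
  qed
  also have "(\<Sum>j<?n. \<Sum>u\<in>?W ?m. \<Sum>v\<in>?W ?n.
        ?C u v * (?sg (v ! j) * \<psi> (word X (u @ take j v)) * \<psi> (word X (drop (Suc j) v)))) = ?B"
  proof (rule sum.cong[OF refl])
    fix j assume "j \<in> {..<?n}"
    then have j: "j < ?n" by simp
    have "(\<Sum>u\<in>?W ?m. \<Sum>v\<in>?W ?n.
        ?C u v * (?sg (v ! j) * \<psi> (word X (u @ take j v)) * \<psi> (word X (drop (Suc j) v)))) =
      (\<Sum>u\<in>?W ?m. \<Sum>v1\<in>?W j. \<Sum>c\<in>UNIV. \<Sum>v2\<in>?W (?n - Suc j). ?sg c *
        (mono_coeff a0 as p q u * mono_coeff b0 (take j bs) r (fst c) v1 * \<psi> (word X (u @ v1))) *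
        (mono_coeff (bs ! j) (drop (Suc j) bs) (snd c) s v2 * \<psi> (word X v2)))"
      unfolding sum_lists_split[OF j]
      by (intro sum.cong refl) (use j in \<open>simp add: mono_coeff_append nth_append mult_ac\<close>)
    also have "\<dots> = (\<Sum>c\<in>UNIV. \<Sum>u\<in>?W ?m. \<Sum>v1\<in>?W j. ?sg c *
        (mono_coeff a0 as p q u * mono_coeff b0 (take j bs) r (fst c) v1 * \<psi> (word X (u @ v1))) *
        (\<Sum>v2\<in>?W (?n - Suc j). mono_coeff (bs ! j) (drop (Suc j) bs) (snd c) s v2 * \<psi> (word X v2)))"
      unfolding sum_distrib_left by (simp only: sum.swap[where B = "UNIV :: ('d \<times> 'd) set"])
    also have "\<dots> = (\<Sum>c\<in>UNIV. ?sg c *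
        (\<Sum>u\<in>?W ?m. \<Sum>v1\<in>?W j.
          mono_coeff a0 as p q u * mono_coeff b0 (take j bs) r (fst c) v1 * \<psi> (word X (u @ v1))) *
        (\<Sum>v2\<in>?W (?n - Suc j). mono_coeff (bs ! j) (drop (Suc j) bs) (snd c) s v2 * \<psi> (word X v2)))"
      by (simp only: sum_distrib_left[symmetric] sum_distrib_right[symmetric])
    finally show "(\<Sum>u\<in>?W ?m. \<Sum>v\<in>?W ?n.
        ?C u v * (?sg (v ! j) * \<psi> (word X (u @ take j v)) * \<psi> (word X (drop (Suc j) v)))) =
      (\<Sum>c\<in>UNIV. ?sg c *
       \<psi> (X_monomial scl X a0 as $ p $ q * X_monomial scl X b0 (take j bs) $ r $ fst c) *
       \<psi> (X_monomial scl X (bs ! j) (drop (Suc j) bs) $ snd c $ s))"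
      using psi_monomial_monomial[of 1 a0 as p q b0 "take j bs" r] j
      by (simp add: X_monomial_expand[of X "bs ! j" "drop (Suc j) bs"] psi_sum psi_scl min_def)
  qed
  finally show ?thesis .
qed

text \<open>This is (aX)^n a, the coefficient of z^(n+1) in (1 - zaX)^(-1) za.\<close>

definition X_power :: "complex ^ 'd ^ 'd \<Rightarrow> nat \<Rightarrow> 'b ^ 'd ^ 'd" where
  "X_power a n = X_monomial scl X a (replicate n a)"

lemma X_power_0: "X_power a 0 = emb_mat scl a"
  by (simp add: X_power_def)

lemma X_power_Suc: "X_power a (Suc n) = emb_mat scl a ** X ** X_power a n"
  by (simp add: X_power_def)

lemma Schwinger_Dyson_power:
  "\<psi> (X $ k $ l * (X_power a m $ p $ q * X_power b n $ r $ s)) =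
    (\<Sum>i<m. \<Sum>c\<in>UNIV. of_real (\<sigma> (k, l) c) *
       \<psi> (X_power a i $ p $ fst c) *
       \<psi> (X_power a (m - Suc i) $ snd c $ q * X_power b n $ r $ s)) +
    (\<Sum>j<n. \<Sum>c\<in>UNIV. of_real (\<sigma> (k, l) c) *
       \<psi> (X_power a m $ p $ q * X_power b j $ r $ fst c) *
       \<psi> (X_power b (n - Suc j) $ snd c $ s))"
  unfolding X_power_def Schwinger_Dyson_monomial
  by (simp add: min_def)

lemma X_power_Suc_entry:
  "X_power a (Suc n) $ p $ q = (\<Sum>k\<in>UNIV. \<Sum>l\<in>UNIV. scl (a $ p $ k) (X $ k $ l * X_power a n $ l $ q))"
  unfolding X_power_Suc
  by (simp add: matrix_matrix_mult_def emb_mat_def scl_mult_left sum_distrib_right)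
    (rule sum.swap)

lemma moment_power_Suc:
  "\<psi> (X_power a (Suc m) $ p $ q * X_power b n $ r $ s) =
    (\<Sum>k\<in>UNIV. \<Sum>l\<in>UNIV. a $ p $ k * (
      (\<Sum>i<m. \<Sum>c\<in>UNIV. of_real (\<sigma> (k, l) c) *
         \<psi> (X_power a i $ l $ fst c) *
         \<psi> (X_power a (m - Suc i) $ snd c $ q * X_power b n $ r $ s)) +
      (\<Sum>j<n. \<Sum>c\<in>UNIV. of_real (\<sigma> (k, l) c) *
         \<psi> (X_power a m $ l $ q * X_power b j $ r $ fst c) *
         \<psi> (X_power b (n - Suc j) $ snd c $ s))))"
  unfolding X_power_Suc_entry Schwinger_Dyson_power[symmetric]
  by (simp add: sum_distrib_right psi_sum psi_scl scl_mult_left mult.assoc)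

lemma moment_power_0:
  "\<psi> (X_power a 0 $ p $ q * X_power b n $ r $ s) = a $ p $ q * \<psi> (X_power b n $ r $ s)"
  by (simp add: X_power_0 emb_mat_def scl_one_mult psi_scl)

lemma mean_power_Suc:
  "\<psi> (X_power a (Suc m) $ p $ q) =
    (\<Sum>k\<in>UNIV. \<Sum>l\<in>UNIV. a $ p $ k *
      (\<Sum>i<m. \<Sum>c\<in>UNIV. of_real (\<sigma> (k, l) c) *
         \<psi> (X_power a i $ l $ fst c) * \<psi> (X_power a (m - Suc i) $ snd c $ q)))"
  \<comment> \<open>With identity coefficient matrix, n = 0 and a diagonal entry, the second factor
    is 1 and the second sum is empty.\<close>
  using moment_power_Suc[of a m p q "mat 1" 0 p p]
  by (simp add: X_power_0 emb_mat_def mat_def)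

end

section \<open>Double power series\<close>

lemma abs_summable_on_product:
  fixes f :: "'i \<Rightarrow> 'a :: real_normed_div_algebra"
  assumes "(\<lambda>x. norm (f x)) summable_on A" "(\<lambda>x. norm (g x)) summable_on B"
  shows "(\<lambda>p. norm (case p of (x, y) \<Rightarrow> f x * g y)) summable_on A \<times> B"
  unfolding Infinite_Sum.abs_summable_on_Sigma_iff
  using summable_on_cmult_right[OF assms(2)] summable_on_cmult_left[OF assms(1)]
  by (auto simp: norm_mult infsum_cmult_right' infsum_nonneg abs_mult
      intro!: summable_on_cmult_right assms)

lemma has_sum_product:
  fixes f :: "'i \<Rightarrow> complex"
  assumes "(f has_sum s) A" "(g has_sum t) B"
  shows "((\<lambda>(x, y). f x * g y) has_sum s * t) (A \<times> B)"
proof (rule has_sum_SigmaI)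
  show "((\<lambda>y. case (x, y) of (x, y) \<Rightarrow> f x * g y) has_sum f x * t) B" for x
    using has_sum_cmult_right[OF assms(2)] by simp
  show "((\<lambda>x. f x * t) has_sum s * t) A"
    using has_sum_cmult_left[OF assms(1)] by simp
  have "(\<lambda>x. norm (f x)) summable_on A" "(\<lambda>x. norm (g x)) summable_on B"
    using assms has_sum_imp_summable summable_on_iff_abs_summable_on_complex by blast+
  then show "(\<lambda>(x, y). f x * g y) summable_on A \<times> B"
    by (rule Infinite_Sum.abs_summable_summable[OF abs_summable_on_product])
qed

lemma has_sum_regroup:
  fixes f :: "'i \<Rightarrow> complex"
  assumes f: "(f has_sum s) UNIV" and g: "\<And>j. (f has_sum g j) {i. k i = j}"
  shows "(g has_sum s) UNIV"
proof -
  have "((\<lambda>(j, i). f i) has_sum s) (SIGMA j:UNIV. {i. k i = j}) \<longleftrightarrow> (f has_sum s) UNIV"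
    by (rule has_sum_reindex_bij_witness[where i = "\<lambda>i. (k i, i)" and j = snd]) auto
  then have "((\<lambda>(j, i). f i) has_sum s) (SIGMA j:UNIV. {i. k i = j})" using f by simp
  then show ?thesis
    by (rule has_sum_SigmaD) (use g in simp)
qed

text \<open>The predicate concerns a single point (z, w). Functional equations are proved by
  assembling the coefficients of one side and recognising those of the other; the unconditional
  convergence in \<open>has_sum\<close> makes the rearrangements legitimate.\<close>

definition double_series :: "(nat \<Rightarrow> nat \<Rightarrow> complex) \<Rightarrow> complex \<Rightarrow> complex \<Rightarrow> complex \<Rightarrow> bool"
  where
  "double_series c z w v \<longleftrightarrow> ((\<lambda>(m, n). c m n * z ^ m * w ^ n) has_sum v) UNIV"

lemma double_series_unique: "double_series c z w v \<Longrightarrow> double_series c z w v' \<Longrightarrow> v = v'"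
  unfolding double_series_def by (rule has_sum_unique)

lemma double_series_finite:
  assumes "finite B" "\<And>m n. (m, n) \<notin> B \<Longrightarrow> c m n = 0"
    and "v = (\<Sum>(m, n)\<in>B. c m n * z ^ m * w ^ n)"
  shows "double_series c z w v"
  unfolding double_series_def
  by (rule has_sum_finite_neutralI[of B]) (use assms in auto)

lemma double_series_const: "double_series (\<lambda>m n. if m = 0 \<and> n = 0 then v else 0) z w v"
  by (rule double_series_finite[of "{(0, 0)}"]) auto

lemma double_series_add:
  assumes "double_series c z w u" "double_series d z w v"
  shows "double_series (\<lambda>m n. c m n + d m n) z w (u + v)"
  using has_sum_add[OF assms[unfolded double_series_def]]
  unfolding double_series_def by (simp add: case_prod_beta' distrib_right)

lemma double_series_cmult:
  assumes "double_series c z w u"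
  shows "double_series (\<lambda>m n. a * c m n) z w (a * u)"
  using has_sum_cmult_right[OF assms[unfolded double_series_def], of a]
  unfolding double_series_def by (simp add: case_prod_beta' mult.assoc)

lemma double_series_sum:
  assumes "\<And>i. i \<in> I \<Longrightarrow> double_series (c i) z w (u i)"
  shows "double_series (\<lambda>m n. \<Sum>i\<in>I. c i m n) z w (\<Sum>i\<in>I. u i)"
  using assms
proof (induction I rule: infinite_finite_induct)
  case (insert i I)
  then show ?case using double_series_add[of "c i" z w "u i"] by simp
qed (auto intro!: double_series_finite[of "{}"])

lemma double_series_mult:
  assumes "double_series c z w u" "double_series d z w v"
  shows "double_series (\<lambda>m n. \<Sum>i\<le>m. \<Sum>j\<le>n. c i j * d (m - i) (n - j)) z w (u * v)"
proof -
  let ?f = "\<lambda>(m, n). c m n * z ^ m * w ^ n" and ?g = "\<lambda>(m, n). d m n * z ^ m * w ^ n"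
  let ?k = "\<lambda>((i :: nat, j :: nat), (i' :: nat, j' :: nat)). (i + i', j + j')"
  have "((\<lambda>(x, y). ?f x * ?g y) has_sum u * v) UNIV"
    using has_sum_product[OF assms[unfolded double_series_def]] by simp
  then show ?thesis
    unfolding double_series_def
  proof (rule has_sum_regroup[where k = ?k])
    fix mn :: "nat \<times> nat"
    obtain m n where mn: "mn = (m, n)" by (cases mn)
    have "((\<lambda>(i, j). c i j * d (m - i) (n - j) * z ^ m * w ^ n) has_sum
        (\<Sum>(i, j)\<in>{..m} \<times> {..n}. c i j * d (m - i) (n - j) * z ^ m * w ^ n)) ({..m} \<times> {..n})"
      by (intro has_sum_finite) simp
    also have "?this \<longleftrightarrow> ((\<lambda>(x, y). ?f x * ?g y) has_sum
        (\<Sum>i\<le>m. \<Sum>j\<le>n. c i j * d (m - i) (n - j)) * z ^ m * w ^ n) {p. ?k p = (m, n)}"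
    proof (rule has_sum_reindex_bij_witness[where j = "\<lambda>(i, j). ((i, j), (m - i, n - j))" and i = fst])
      show "(\<Sum>(i, j)\<in>{..m} \<times> {..n}. c i j * d (m - i) (n - j) * z ^ m * w ^ n) =
          (\<Sum>i\<le>m. \<Sum>j\<le>n. c i j * d (m - i) (n - j)) * z ^ m * w ^ n"
        by (simp add: sum.cartesian_product[symmetric] sum_distrib_right)
      fix p assume "p \<in> {..m} \<times> {..n}"
      then obtain i j where p: "p = (i, j)" "i \<le> m" "j \<le> n" by auto
      have "z ^ m = z ^ i * z ^ (m - i)" "w ^ n = w ^ j * w ^ (n - j)"
        using p by (simp_all flip: power_add)
      then show "(case case p of (i, j) \<Rightarrow> ((i, j), (m - i, n - j)) of (x, y) \<Rightarrow> ?f x * ?g y) =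
          (case p of (i, j) \<Rightarrow> c i j * d (m - i) (n - j) * z ^ m * w ^ n)"
        by (simp add: p mult_ac)
    qed (auto split: prod.splits)
    finally show "((\<lambda>(x, y). ?f x * ?g y) has_sum
        (case mn of (m, n) \<Rightarrow> (\<Sum>i\<le>m. \<Sum>j\<le>n. c i j * d (m - i) (n - j)) * z ^ m * w ^ n))
        {p. ?k p = mn}"
      by (simp add: mn)
  qed
qed

text \<open>Restriction to the diagonal, with a dummy second variable. It serves
  \<open>T_self\<close>, where both factors depend on the same variable.\<close>

lemma double_series_diag:
  assumes "double_series c t t v"
  shows "double_series (\<lambda>m n. if n = 0 then \<Sum>i\<le>m. c i (m - i) else 0) t w v"
  unfolding double_series_def
proof (rule has_sum_regroup[OF assms[unfolded double_series_def], where k = "\<lambda>(i, j). (i + j, 0)"])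
  fix mn :: "nat \<times> nat"
  obtain m n where mn: "mn = (m, n)" by (cases mn)
  show "((\<lambda>(i, j). c i j * t ^ i * t ^ j) has_sum
      (case mn of (m, n) \<Rightarrow> (if n = 0 then \<Sum>i\<le>m. c i (m - i) else 0) * t ^ m * w ^ n))
      {p. (case p of (i, j) \<Rightarrow> (i + j, 0)) = mn}"
  proof (cases "n = 0")
    case True
    have "((\<lambda>i. c i (m - i) * t ^ m) has_sum (\<Sum>i\<le>m. c i (m - i) * t ^ m)) {..m}"
      by (intro has_sum_finite) simp
    also have "?this \<longleftrightarrow> ((\<lambda>(i, j). c i j * t ^ i * t ^ j) has_sum (\<Sum>i\<le>m. c i (m - i)) * t ^ m)
        {p. (case p of (i, j) \<Rightarrow> (i + j, 0)) = mn}"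
      by (rule has_sum_reindex_bij_witness[where j = "\<lambda>i. (i, m - i)" and i = fst])
        (auto simp: mn True sum_distrib_right mult.assoc simp flip: power_add)
    finally show ?thesis by (simp add: mn True)
  next
    case False
    then have empty: "{p. (case p of (i :: nat, j :: nat) \<Rightarrow> (i + j, 0 :: nat)) = mn} = {}"
      by (auto simp: mn)
    show ?thesis unfolding empty by (simp add: mn False)
  qed
qed

lemma double_series_swap:
  assumes "double_series c z w v"
  shows "double_series (\<lambda>m n. c n m) w z v"
proof -
  have "((\<lambda>(m, n). c m n * z ^ m * w ^ n) has_sum v) UNIV \<longleftrightarrow>
      ((\<lambda>(m, n). c n m * w ^ m * z ^ n) has_sum v) UNIV"
    by (rule has_sum_reindex_bij_witness[where i = prod.swap and j = prod.swap]) auto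
  then show ?thesis using assms by (simp add: double_series_def)
qed

lemma double_series_fst:
  assumes "double_series c z 0 v"
  shows "(\<lambda>n. c n 0 * z ^ n) sums v"
proof -
  \<comment> \<open>As 0 ^ 0 = 1, setting w = 0 keeps exactly the terms with n = 0.\<close>
  have "((\<lambda>(m, n). c m n * z ^ m * 0 ^ n) has_sum v) (range (\<lambda>m. (m, 0 :: nat)))"
    using assms unfolding double_series_def
    by (subst has_sum_cong_neutral[where T = UNIV]) (auto simp: image_iff)
  then have "((\<lambda>m. c m 0 * z ^ m) has_sum v) UNIV"
    by (subst (asm) has_sum_reindex) (auto intro: injI simp: o_def)
  then show ?thesis by (rule has_sum_imp_sums)
qed

section \<open>Analytic functions of two variables\<close>

definition analytic2_at :: "(complex \<Rightarrow> complex \<Rightarrow> complex) \<Rightarrow> complex \<Rightarrow> complex \<Rightarrow> bool" where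
  "analytic2_at f z0 w0 \<longleftrightarrow>
     (\<exists>r>0. \<exists>c. \<forall>z\<in>ball z0 r. \<forall>w\<in>ball w0 r. double_series c (z - z0) (w - w0) (f z w))"

lemma analytic2_on_eq: "analytic2_on f S \<longleftrightarrow> (\<forall>(z, w)\<in>S. analytic2_at (\<lambda>z w. f (z, w)) z w)"
  by (simp add: analytic2_on_def analytic2_at_def double_series_def)

lemma analytic2_at_const: "analytic2_at (\<lambda>_ _. v) z0 w0"
  unfolding analytic2_at_def using double_series_const[of v] zero_less_one by blast

lemma analytic2_at_fst: "analytic2_at (\<lambda>z _. z) z0 w0"
proof -
  let ?c = "\<lambda>m n :: nat. if n = 0 then (if m = 0 then z0 else if m = 1 then 1 else 0) else 0"
  have "double_series ?c (z - z0) (w - w0) z" for z w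
    by (rule double_series_finite[of "{(0, 0), (1, 0)}"]) auto
  then show ?thesis unfolding analytic2_at_def using zero_less_one by blast
qed

lemma analytic2_at_swap: "analytic2_at f z0 w0 \<Longrightarrow> analytic2_at (\<lambda>w z. f z w) w0 z0"
  unfolding analytic2_at_def using double_series_swap by meson

lemma analytic2_at_binop:
  assumes "analytic2_at f z0 w0" "analytic2_at g z0 w0"
    and op: "\<And>c d z w u v. double_series c z w u \<Longrightarrow> double_series d z w v \<Longrightarrow>
      double_series (F c d) z w (op u v)"
  shows "analytic2_at (\<lambda>z w. op (f z w) (g z w)) z0 w0"
proof -
  obtain r c where r: "r > 0"
    "\<And>z w. z \<in> ball z0 r \<Longrightarrow> w \<in> ball w0 r \<Longrightarrow> double_series c (z - z0) (w - w0) (f z w)"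
    using assms(1) unfolding analytic2_at_def by blast
  obtain s d where s: "s > 0"
    "\<And>z w. z \<in> ball z0 s \<Longrightarrow> w \<in> ball w0 s \<Longrightarrow> double_series d (z - z0) (w - w0) (g z w)"
    using assms(2) unfolding analytic2_at_def by blast
  show ?thesis
    unfolding analytic2_at_def
    by (rule exI[of _ "min r s"]) (use r s in \<open>auto intro!: exI[of _ "F c d"] op\<close>)
qed

lemma analytic2_at_add:
  "analytic2_at f z0 w0 \<Longrightarrow> analytic2_at g z0 w0 \<Longrightarrow> analytic2_at (\<lambda>z w. f z w + g z w) z0 w0"
  by (rule analytic2_at_binop[where op = "(+)", OF _ _ double_series_add])

lemma analytic2_at_mult:
  "analytic2_at f z0 w0 \<Longrightarrow> analytic2_at g z0 w0 \<Longrightarrow> analytic2_at (\<lambda>z w. f z w * g z w) z0 w0"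
  by (rule analytic2_at_binop[where op = "(*)", OF _ _ double_series_mult])

lemma analytic2_at_diff:
  assumes "analytic2_at f z0 w0" "analytic2_at g z0 w0"
  shows "analytic2_at (\<lambda>z w. f z w - g z w) z0 w0"
  using analytic2_at_add[OF assms(1) analytic2_at_mult[OF analytic2_at_const[of "-1"] assms(2)]]
  by simp

lemma analytic2_at_sum:
  "(\<And>i. i \<in> I \<Longrightarrow> analytic2_at (f i) z0 w0) \<Longrightarrow> analytic2_at (\<lambda>z w. \<Sum>i\<in>I. f i z w) z0 w0"
  by (induction I rule: infinite_finite_induct)
    (simp_all add: analytic2_at_const analytic2_at_add)

lemma analytic2_at_diag:
  assumes "analytic2_at f z0 z0"
  shows "analytic2_at (\<lambda>z w. f z z) z0 w0"
  using assms double_series_diag unfolding analytic2_at_def by (metis (no_types, lifting))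

lemma analytic2_at_imp_holomorphic:
  assumes "analytic2_at f z0 w0"
  shows "\<exists>r>0. (\<lambda>z. f z w0) holomorphic_on ball z0 r"
proof -
  obtain r c where r: "r > 0"
    "\<And>z w. z \<in> ball z0 r \<Longrightarrow> w \<in> ball w0 r \<Longrightarrow> double_series c (z - z0) (w - w0) (f z w)"
    using assms(1) unfolding analytic2_at_def by blast
  have "(\<lambda>n. c n 0 * (z - z0) ^ n) sums f z w0" if "z \<in> ball z0 r" for z
    using double_series_fst r(2)[OF that, of w0] r(1) by simp
  then have "(\<lambda>z. f z w0) holomorphic_on ball z0 r"
    by (rule power_series_holomorphic[where a = "\<lambda>n. c n 0"])
  then show ?thesis using r(1) by blast
qed

lemma analytic2_at_holomorphic_on:
  assumes "\<And>z. z \<in> S \<Longrightarrow> analytic2_at f z w" "open S"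
  shows "(\<lambda>z. f z w) holomorphic_on S"
  unfolding holomorphic_on_def
proof
  fix z assume "z \<in> S"
  then obtain r where "r > 0" "(\<lambda>z. f z w) holomorphic_on ball z r"
    using analytic2_at_imp_holomorphic assms(1) by blast
  then show "(\<lambda>z. f z w) field_differentiable at z within S"
    by (meson centre_in_ball field_differentiable_at_within holomorphic_on_imp_differentiable_at open_ball)
qed

text \<open>For fixed w near 0 the identity theorem in z reaches all of \<open>S\<close>; then, with
  any z of \<open>S\<close> fixed, the identity theorem in w reaches all of \<open>T\<close>. This
  order of steps is what requires a product domain.\<close>

lemma analytic2_continuation:
  assumes f: "\<And>z w. z \<in> S \<Longrightarrow> w \<in> T \<Longrightarrow> analytic2_at f z w"
    and S: "open S" "connected S" "0 \<in> S" and T: "open T" "connected T" "0 \<in> T"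
    and r: "r > 0" and zero: "\<And>z w. z \<in> ball 0 r \<inter> S \<Longrightarrow> w \<in> ball 0 r \<inter> T \<Longrightarrow> f z w = 0"
    and z: "z \<in> S" and w: "w \<in> T"
  shows "f z w = 0"
proof -
  have lim: "0 islimpt ball 0 r \<inter> U" if "open U" "0 \<in> U" for U :: "complex set"
    using that r by (intro interior_limit_point) (auto simp: interior_open)
  have f1: "f z w = 0" if "w \<in> ball 0 r \<inter> T" for w
    by (rule analytic_continuation[of "\<lambda>z. f z w" S "ball 0 r \<inter> S" 0])
      (use S z zero that f lim in \<open>auto intro!: analytic2_at_holomorphic_on\<close>)
  have "(\<lambda>w. f z w) holomorphic_on T"
    using analytic2_at_holomorphic_on[of T "\<lambda>w z. f z w" z] f[OF z] T analytic2_at_swap by blast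
  then show ?thesis
    by (rule analytic_continuation[where U = "ball 0 r \<inter> T" and \<xi> = 0]) (use T w f1 lim in auto)
qed

section \<open>Algebra-valued power series and bounded pairings\<close>

context cstar_algebra
begin

definition closed_subalgebra :: "'b set \<Rightarrow> bool" where
  "closed_subalgebra S \<longleftrightarrow> unital_subalgebra scl S \<and> closed S"

text \<open>The Cauchy bound on the coefficients is carried along because it yields the absolute
  convergence of double series; the coefficients are kept in \<open>S\<close> so that they may enter
  the second argument of a pairing.\<close>

definition power_family :: "'b set \<Rightarrow> (complex \<Rightarrow> 'b) \<Rightarrow> complex \<Rightarrow> real \<Rightarrow> (nat \<Rightarrow> 'b) \<Rightarrow> bool"
  where
  "power_family S u z0 r y \<longleftrightarrow> r > 0 \<and> range y \<subseteq> S \<and> (\<exists>C. \<forall>n. norm (y n) * r ^ n \<le> C) \<and>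
     (\<forall>z\<in>ball z0 r. (\<lambda>n. scl ((z - z0) ^ n) (y n)) sums u z)"

text \<open>The second argument is confined to \<open>S\<close> because \<open>rev_pairing\<close>
  has a meaning only on the closure of the span of the words.\<close>

definition bounded_pairing :: "'b set \<Rightarrow> ('b \<Rightarrow> 'b \<Rightarrow> complex) \<Rightarrow> bool" where
  "bounded_pairing S \<beta> \<longleftrightarrow>
     (\<forall>x x'. \<forall>y\<in>S. \<beta> (x + x') y = \<beta> x y + \<beta> x' y) \<and>
     (\<forall>c x. \<forall>y\<in>S. \<beta> (scl c x) y = c * \<beta> x y) \<and>
     (\<forall>x. \<forall>y\<in>S. \<forall>y'\<in>S. \<beta> x (y + y') = \<beta> x y + \<beta> x y') \<and>
     (\<forall>c x. \<forall>y\<in>S. \<beta> x (scl c y) = c * \<beta> x y) \<and>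
     (\<forall>x. \<forall>y\<in>S. cmod (\<beta> x y) \<le> norm x * norm y)"

lemma closed_subalgebraD:
  assumes "closed_subalgebra S"
  shows "1 \<in> S" "0 \<in> S" "x \<in> S \<Longrightarrow> y \<in> S \<Longrightarrow> x + y \<in> S" "x \<in> S \<Longrightarrow> y \<in> S \<Longrightarrow> x * y \<in> S"
    "x \<in> S \<Longrightarrow> scl c x \<in> S" "x \<in> S \<Longrightarrow> - x \<in> S" "x \<in> S \<Longrightarrow> y \<in> S \<Longrightarrow> x - y \<in> S" "closed S"
proof -
  have S: "1 \<in> S" "\<And>x y. x \<in> S \<Longrightarrow> y \<in> S \<Longrightarrow> x + y \<in> S" "\<And>x y. x \<in> S \<Longrightarrow> y \<in> S \<Longrightarrow> x * y \<in> S"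
    "\<And>c x. x \<in> S \<Longrightarrow> scl c x \<in> S" "closed S"
    using assms by (auto simp: closed_subalgebra_def unital_subalgebra_def)
  show "1 \<in> S" "x \<in> S \<Longrightarrow> y \<in> S \<Longrightarrow> x + y \<in> S" "x \<in> S \<Longrightarrow> y \<in> S \<Longrightarrow> x * y \<in> S"
    "x \<in> S \<Longrightarrow> scl c x \<in> S" "closed S" by (simp_all add: S)
  show "0 \<in> S" using S(1) S(4)[of 1 0] by simp
  have m: "- x \<in> S" if "x \<in> S" for x using S(4)[OF that, of "-1"] by (simp add: scl_minus_one)
  then show "x \<in> S \<Longrightarrow> - x \<in> S" .
  show "x \<in> S \<Longrightarrow> y \<in> S \<Longrightarrow> x - y \<in> S" using S(2)[of x "- y"] m by simp
qed

lemma closed_subalgebra_sum: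
  assumes "closed_subalgebra S" "\<And>i. i \<in> I \<Longrightarrow> f i \<in> S"
  shows "sum f I \<in> S"
  using assms(2) by (induction I rule: infinite_finite_induct) (auto intro: closed_subalgebraD[OF assms(1)])

lemma closed_subalgebra_UNIV: "closed_subalgebra UNIV"
  by (simp add: closed_subalgebra_def unital_subalgebra_def)

lemma sums_scl: "f sums s \<Longrightarrow> (\<lambda>n. scl c (f n)) sums scl c s"
  by (rule bounded_linear.sums[OF bounded_linear_scl])

lemma power_family_limit_in:
  assumes S: "closed_subalgebra S" and u: "power_family S u z0 r y" and z: "z \<in> ball z0 r"
  shows "u z \<in> S"
proof -
  have "(\<lambda>N. \<Sum>n<N. scl ((z - z0) ^ n) (y n)) \<longlonglongrightarrow> u z"
    using u z by (simp add: power_family_def sums_def)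
  moreover have "(\<Sum>n<N. scl ((z - z0) ^ n) (y n)) \<in> S" for N
    using u by (intro closed_subalgebra_sum[OF S] closed_subalgebraD[OF S]) (auto simp: power_family_def)
  ultimately show ?thesis
    by (rule closed_sequentially[OF closed_subalgebraD(8)[OF S], rotated])
qed

lemma power_family_scl:
  assumes "closed_subalgebra S" "power_family S u z0 r y"
  shows "power_family S (\<lambda>z. scl c (u z)) z0 r (\<lambda>n. scl c (y n))"
proof -
  obtain C where C: "\<And>n. norm (y n) * r ^ n \<le> C" using assms(2) by (auto simp: power_family_def)
  have "norm (scl c (y n)) * r ^ n \<le> cmod c * C" for n
    using mult_left_mono[OF C[of n], of "cmod c"] by (simp add: norm_scl mult.assoc)
  moreover have "(\<lambda>n. scl (t ^ n) (scl c (y n))) sums scl c v" if "(\<lambda>n. scl (t ^ n) (y n)) sums v" for t v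
    using sums_scl[OF that, of c] by (simp add: scl_scl mult.commute)
  ultimately show ?thesis
    using assms closed_subalgebraD(5)[OF assms(1)] unfolding power_family_def
    by (auto intro!: exI[of _ "cmod c * C"])
qed

lemma power_family_add:
  assumes "closed_subalgebra S" "power_family S u z0 r y" "power_family S u' z0 r y'"
  shows "power_family S (\<lambda>z. u z + u' z) z0 r (\<lambda>n. y n + y' n)"
proof -
  obtain C where C: "\<And>n. norm (y n) * r ^ n \<le> C" using assms(2) by (auto simp: power_family_def)
  obtain C' where C': "\<And>n. norm (y' n) * r ^ n \<le> C'" using assms(3) by (auto simp: power_family_def)
  have r: "r > 0" using assms by (simp add: power_family_def)
  have "norm (y n + y' n) * r ^ n \<le> C + C'" for n
    using mult_right_mono[OF norm_triangle_ineq[of "y n" "y' n"], of "r ^ n"] C[of n] C'[of n] r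
    by (simp add: distrib_right)
  then show ?thesis
    using assms closed_subalgebraD(3)[OF assms(1)] unfolding power_family_def
    by (auto intro!: exI[of _ "C + C'"] sums_add simp: scl_add_right image_subset_iff)
qed

lemma power_family_zero:
  "closed_subalgebra S \<Longrightarrow> r > 0 \<Longrightarrow> power_family S (\<lambda>_. 0) z0 r (\<lambda>_. 0)"
  by (auto simp: power_family_def closed_subalgebraD(2))

lemma power_family_sum:
  assumes "closed_subalgebra S" "r > 0" "\<And>i. i \<in> I \<Longrightarrow> power_family S (u i) z0 r (y i)"
  shows "power_family S (\<lambda>z. \<Sum>i\<in>I. u i z) z0 r (\<lambda>n. \<Sum>i\<in>I. y i n)"
  using assms(3)
  by (induction I rule: infinite_finite_induct)
    (simp_all add: assms power_family_zero power_family_add)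

lemma power_family_const:
  assumes "closed_subalgebra S" "r > 0" "x \<in> S"
  shows "power_family S (\<lambda>_. x) z0 r (\<lambda>n. if n = 0 then x else 0)"
proof -
  have "(\<lambda>n. scl (t ^ n) (if n = 0 then x else 0)) sums x" for t
    using sums_single[of 0 "\<lambda>_. x"] by (simp add: if_distrib cong: if_cong)
  then show ?thesis
    using assms closed_subalgebraD(2)[OF assms(1)] unfolding power_family_def
    by (auto intro!: exI[of _ "norm x"])
qed

lemma power_family_shift:
  assumes "closed_subalgebra S" "power_family S u z0 r y"
  shows "power_family S (\<lambda>z. scl (z - z0) (u z)) z0 r (\<lambda>n. case n of 0 \<Rightarrow> 0 | Suc m \<Rightarrow> y m)"
proof -
  obtain C where C: "\<And>n. norm (y n) * r ^ n \<le> C" using assms(2) by (auto simp: power_family_def)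
  have r: "r > 0" using assms by (simp add: power_family_def)
  have "C \<ge> 0" using C[of 0] norm_ge_zero[of "y 0"] by (simp del: norm_ge_zero)
  then have "norm (case n of 0 \<Rightarrow> 0 | Suc m \<Rightarrow> y m) * r ^ n \<le> C * r" for n
    using C r by (cases n) (auto simp: mult_ac intro: mult_left_mono[of _ _ r, simplified mult_ac])
  moreover have "(\<lambda>n. scl (t ^ n) (case n of 0 \<Rightarrow> 0 | Suc m \<Rightarrow> y m)) sums scl t v"
    if "(\<lambda>n. scl (t ^ n) (y n)) sums v" for t v
  proof -
    have "(\<lambda>n. scl (t ^ Suc n) (y n)) sums scl t v"
      using sums_scl[OF that, of t] by (simp add: scl_scl)
    then show ?thesis
      using sums_Suc[of "\<lambda>n. scl (t ^ n) (case n of 0 \<Rightarrow> 0 | Suc m \<Rightarrow> y m)"] by simp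
  qed
  ultimately show ?thesis
    using assms(2) closed_subalgebraD(2)[OF assms(1)] unfolding power_family_def
    by (intro conjI exI[of _ "C * r"] allI) (auto simp: image_subset_iff split: nat.split)
qed

text \<open>Split z as (z - z0) + z0: a shift of the coefficients plus a constant multiple.\<close>

lemma power_family_times:
  assumes "closed_subalgebra S" "power_family S u z0 r y"
  shows "power_family S (\<lambda>z. scl z (u z)) z0 r
    (\<lambda>n. (case n of 0 \<Rightarrow> 0 | Suc m \<Rightarrow> y m) + scl z0 (y n))"
  using power_family_add[OF assms(1) power_family_shift[OF assms] power_family_scl[OF assms, of z0]]
  by (simp flip: scl_add_left)

lemma power_family_isCont:
  assumes u: "power_family UNIV u z0 r y"
  shows "isCont u z0"
proof -
  obtain C where C: "\<And>n. norm (y n) * r ^ n \<le> C" using u by (auto simp: power_family_def)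
  have r: "r > 0" and s: "\<And>z. z \<in> ball z0 r \<Longrightarrow> (\<lambda>n. scl ((z - z0) ^ n) (y n)) sums u z"
    using u by (auto simp: power_family_def)
  have C0: "C \<ge> 0" using C[of 0] norm_ge_zero[of "y 0"] by (simp del: norm_ge_zero)
  have "(\<lambda>n. scl ((z0 - z0) ^ n) (y n)) = (\<lambda>n. if n = 0 then y n else 0)"
    by (auto simp: fun_eq_iff power_0_left)
  then have "(\<lambda>n. scl ((z0 - z0) ^ n) (y n)) sums y 0"
    using sums_single[of 0 y] by simp
  then have u0: "u z0 = y 0" using s[of z0] r sums_unique2 by fastforce
  have bound: "norm (u z - u z0) \<le> (2 * C / r) * cmod (z - z0)" if z: "cmod (z - z0) \<le> r / 2" for z
  proof -
    define q where "q = cmod (z - z0) / r"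
    have q: "0 \<le> q" "q \<le> 1/2" using z r by (simp_all add: q_def field_simps)
    have sz: "(\<lambda>n. scl ((z - z0) ^ n) (y n)) sums u z"
      using z r by (intro s) (simp add: dist_norm norm_minus_commute)
    then have d: "(\<lambda>n. scl ((z - z0) ^ Suc n) (y (Suc n))) sums (u z - u z0)"
      by (subst sums_Suc_iff) (simp add: u0)
    have g: "(\<lambda>n. C * q * q ^ n) sums (C * q * (1 / (1 - q)))"
      using q by (intro sums_mult geometric_sums) auto
    have n: "norm (scl ((z - z0) ^ Suc n) (y (Suc n))) \<le> C * q * q ^ n" for n
    proof -
      have "norm (scl ((z - z0) ^ Suc n) (y (Suc n))) = (norm (y (Suc n)) * r ^ Suc n) * q ^ Suc n"
        using r by (simp add: norm_scl norm_power norm_mult q_def power_divide)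
      also have "\<dots> \<le> C * q ^ Suc n" using q by (intro mult_right_mono C) auto
      finally show ?thesis by (simp add: mult_ac)
    qed
    have "norm (u z - u z0) \<le> C * q * (1 / (1 - q))"
      using norm_suminf_le[OF n sums_summable[OF g]] sums_unique[OF d] sums_unique[OF g] by simp
    also have "\<dots> \<le> C * q * 2"
      using q C0 by (intro mult_left_mono) (auto simp: field_simps)
    finally show ?thesis by (simp add: q_def mult_ac)
  qed
  have "((\<lambda>z. u z - u z0) \<longlongrightarrow> 0) (at z0)"
  proof (rule Lim_null_comparison)
    show "eventually (\<lambda>z. norm (u z - u z0) \<le> (2 * C / r) * cmod (z - z0)) (at z0)"
      using r bound unfolding eventually_at
      by (intro exI[of _ "r / 2"]) (auto simp: dist_norm)
    have "((\<lambda>z. (2 * C / r) * cmod (z - z0)) \<longlongrightarrow> (2 * C / r) * cmod (z0 - z0)) (at z0)"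
      by (intro tendsto_intros)
    then show "((\<lambda>z. (2 * C / r) * cmod (z - z0)) \<longlongrightarrow> 0) (at z0)" by simp
  qed
  then show ?thesis
    unfolding isCont_def by (rule LIM_zero_cancel)
qed

text \<open>Boundedness exchanges the pairing with each of the two series, and the coefficient
  bounds dominate the double family by C D p^m q^n with p, q < 1. The joint expansion thus needs no
  theorem on separate analyticity.\<close>

lemma double_series_pairing:
  assumes S: "closed_subalgebra S" and \<beta>: "bounded_pairing S \<beta>"
    and u: "power_family UNIV u z0 r x" and v: "power_family S v w0 s y"
    and z: "z \<in> ball z0 r" and w: "w \<in> ball w0 s"
  shows "double_series (\<lambda>m n. \<beta> (x m) (y n)) (z - z0) (w - w0) (\<beta> (u z) (v w))"
proof -
  have \<beta>add1: "\<beta> (x + x') y = \<beta> x y + \<beta> x' y" and \<beta>scl1: "\<beta> (scl c x) y = c * \<beta> x y"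
    and \<beta>scl2: "\<beta> x (scl c y) = c * \<beta> x y" and \<beta>bd: "cmod (\<beta> x y) \<le> norm x * norm y"
    if "y \<in> S" for x x' y c
    using \<beta> that by (auto simp: bounded_pairing_def)
  have \<beta>add2: "\<beta> x (y + y') = \<beta> x y + \<beta> x y'" if "y \<in> S" "y' \<in> S" for x y y'
    using \<beta> that by (auto simp: bounded_pairing_def)
  note Sc = closed_subalgebraD[OF S]
  have yS: "y n \<in> S" for n using v by (auto simp: power_family_def)
  have vS: "v w \<in> S" by (rule power_family_limit_in[OF S v w])
  obtain C where C: "\<And>n. norm (x n) * r ^ n \<le> C" using u by (auto simp: power_family_def)
  obtain D where D: "\<And>n. norm (y n) * s ^ n \<le> D" using v by (auto simp: power_family_def)
  have r: "r > 0" and s: "s > 0" using u v by (auto simp: power_family_def)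
  have C0: "C \<ge> 0" using C[of 0] norm_ge_zero[of "x 0"] by (simp del: norm_ge_zero)
  have D0: "D \<ge> 0" using D[of 0] norm_ge_zero[of "y 0"] by (simp del: norm_ge_zero)
  define p where "p = cmod (z - z0) / r"
  define q where "q = cmod (w - w0) / s"
  have p: "0 \<le> p" "p < 1" and q: "0 \<le> q" "q < 1"
    using z w r s by (simp_all add: p_def q_def dist_norm norm_minus_commute)
  have xp: "norm (x m) * cmod (z - z0) ^ m \<le> C * p ^ m" for m
  proof -
    have "norm (x m) * cmod (z - z0) ^ m = (norm (x m) * r ^ m) * p ^ m"
      using r by (simp add: p_def power_divide)
    also have "\<dots> \<le> C * p ^ m" using p by (intro mult_right_mono C) auto
    finally show ?thesis .
  qed
  have yq: "norm (y n) * cmod (w - w0) ^ n \<le> D * q ^ n" for n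
  proof -
    have "norm (y n) * cmod (w - w0) ^ n = (norm (y n) * s ^ n) * q ^ n"
      using s by (simp add: q_def power_divide)
    also have "\<dots> \<le> D * q ^ n" using q by (intro mult_right_mono D) auto
    finally show ?thesis .
  qed
  have geo: "(\<lambda>n. c * t ^ n) summable_on UNIV" if "0 \<le> t" "t < 1" for c t :: real
    using that by (intro summable_on_cmult_right norm_summable_imp_summable_on)
      (simp add: abs_of_nonneg norm_power)
  have sx: "(\<lambda>m. scl ((z - z0) ^ m) (x m)) sums u z" and sy: "(\<lambda>n. scl ((w - w0) ^ n) (y n)) sums v w"
    using u v z w by (auto simp: power_family_def)
  \<comment> \<open>Linearity in the second argument is available on \<open>S\<close> only, so
    partial sums, limit and remainders are all kept in \<open>S\<close>.\<close>
  have inner: "(\<lambda>n. \<beta> x' (y n) * (w - w0) ^ n) sums \<beta> x' (v w)" for x'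
  proof -
    have part: "(\<Sum>n<N. scl ((w - w0) ^ n) (y n)) \<in> S" for N
      using yS by (intro closed_subalgebra_sum[OF S] Sc)
    have \<beta>sum: "\<beta> x' (\<Sum>n<N. scl ((w - w0) ^ n) (y n)) = (\<Sum>n<N. \<beta> x' (y n) * (w - w0) ^ n)" for N
    proof (induction N)
      case 0
      show ?case using \<beta>scl2[OF Sc(2), of x' 0] by simp
    next
      case (Suc N)
      then show ?case using \<beta>add2[OF part Sc(5)[OF yS]] by (simp add: \<beta>scl2[OF yS])
    qed
    have diff: "\<beta> x' (y1 - y2) = \<beta> x' y1 - \<beta> x' y2" if "y1 \<in> S" "y2 \<in> S" for y1 y2
      using \<beta>add2[OF Sc(7)[OF that] that(2), of x'] by simp
    have "norm (\<beta> x' (v w) - (\<Sum>n<N. \<beta> x' (y n) * (w - w0) ^ n))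
        \<le> norm x' * norm (v w - (\<Sum>n<N. scl ((w - w0) ^ n) (y n)))" for N
      using \<beta>bd[OF Sc(7)[OF vS part], where x = x'] by (simp add: diff[OF vS part] flip: \<beta>sum)
    moreover have "(\<lambda>N. norm x' * norm (v w - (\<Sum>n<N. scl ((w - w0) ^ n) (y n)))) \<longlonglongrightarrow> norm x' * norm (v w - v w)"
      using sy unfolding sums_def by (intro tendsto_intros)
    then have "(\<lambda>N. norm x' * norm (v w - (\<Sum>n<N. scl ((w - w0) ^ n) (y n)))) \<longlonglongrightarrow> 0" by simp
    ultimately have "(\<lambda>N. \<beta> x' (v w) - (\<Sum>n<N. \<beta> x' (y n) * (w - w0) ^ n)) \<longlonglongrightarrow> 0"
      by (rule Lim_null_comparison[OF always_eventually[OF allI]])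
    from tendsto_diff[OF tendsto_const[of "\<beta> x' (v w)"] this] show ?thesis
      by (simp add: sums_def)
  qed
  have outer: "(\<lambda>m. \<beta> (x m) (v w) * (z - z0) ^ m) sums \<beta> (u z) (v w)"
  proof -
    have "bounded_linear (\<lambda>x. \<beta> x (v w))"
      using \<beta>scl1[OF vS, of "complex_of_real _"]
      by (intro bounded_linear_intro[of _ "norm (v w)"])
        (simp_all add: \<beta>add1 vS \<beta>bd scl_of_real scaleR_conv_of_real)
    from bounded_linear.sums[OF this sx] show ?thesis by (simp add: \<beta>scl1 vS mult.commute)
  qed
  show ?thesis
    unfolding double_series_def UNIV_Times_UNIV[symmetric]
  proof (rule has_sum_SigmaI)
    fix m
    have "(\<lambda>n. \<beta> (x m) (y n) * (w - w0) ^ n) sums \<beta> (x m) (v w)" by (rule inner)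
    moreover have "summable (\<lambda>n. norm (\<beta> (x m) (y n) * (w - w0) ^ n))"
    proof (rule summable_comparison_test')
      show "summable (\<lambda>n. norm (x m) * D * q ^ n)" using q by (intro summable_mult summable_geometric) auto
      fix n
      have "norm (\<beta> (x m) (y n) * (w - w0) ^ n) \<le> norm (x m) * norm (y n) * cmod (w - w0) ^ n"
        by (simp add: norm_mult norm_power mult_right_mono \<beta>bd yS)
      also have "\<dots> \<le> norm (x m) * (D * q ^ n)"
        using mult_left_mono[OF yq[of n], of "norm (x m)"] by (simp add: mult.assoc)
      finally show "norm (norm (\<beta> (x m) (y n) * (w - w0) ^ n)) \<le> norm (x m) * D * q ^ n"
        by (simp add: mult.assoc)
    qed
    ultimately have "((\<lambda>n. \<beta> (x m) (y n) * (w - w0) ^ n) has_sum \<beta> (x m) (v w)) UNIV"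
      by (intro norm_summable_imp_has_sum)
    from has_sum_cmult_left[OF this, of "(z - z0) ^ m"]
    show "((\<lambda>n. case (m, n) of (m, n) \<Rightarrow> \<beta> (x m) (y n) * (z - z0) ^ m * (w - w0) ^ n) has_sum
        \<beta> (x m) (v w) * (z - z0) ^ m) UNIV"
      by (simp add: mult_ac)
  next
    have "summable (\<lambda>m. norm (\<beta> (x m) (v w) * (z - z0) ^ m))"
    proof (rule summable_comparison_test')
      show "summable (\<lambda>n. norm (v w) * C * p ^ n)" using p by (intro summable_mult summable_geometric) auto
      fix n
      have "norm (\<beta> (x n) (v w) * (z - z0) ^ n) \<le> norm (x n) * norm (v w) * cmod (z - z0) ^ n"
        by (simp add: norm_mult norm_power mult_right_mono \<beta>bd vS)
      also have "\<dots> \<le> norm (v w) * (C * p ^ n)"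
        using mult_left_mono[OF xp[of n], of "norm (v w)"] by (simp add: mult_ac)
      finally show "norm (norm (\<beta> (x n) (v w) * (z - z0) ^ n)) \<le> norm (v w) * C * p ^ n"
        by (simp add: mult_ac)
    qed
    then show "((\<lambda>m. \<beta> (x m) (v w) * (z - z0) ^ m) has_sum \<beta> (u z) (v w)) UNIV"
      using outer by (intro norm_summable_imp_has_sum)
  next
    have "(\<lambda>pq. norm (case pq of (m, n) \<Rightarrow> (C * p ^ m) * (D * q ^ n))) summable_on UNIV \<times> UNIV"
      using geo[OF p, of C] geo[OF q, of D] p q C0 D0
      by (intro abs_summable_on_product) (simp_all add: abs_mult norm_power)
    then have "(\<lambda>pq. norm (case pq of (m, n) \<Rightarrow> \<beta> (x m) (y n) * (z - z0) ^ m * (w - w0) ^ n))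
        summable_on UNIV \<times> UNIV"
    proof (rule Infinite_Sum.abs_summable_on_comparison_test)
      fix mn :: "nat \<times> nat"
      obtain m n where mn: "mn = (m, n)" by (cases mn)
      have "norm (\<beta> (x m) (y n) * (z - z0) ^ m * (w - w0) ^ n)
          \<le> norm (x m) * norm (y n) * cmod (z - z0) ^ m * cmod (w - w0) ^ n"
        by (simp add: norm_mult norm_power mult_right_mono \<beta>bd yS)
      also have "\<dots> = (norm (x m) * cmod (z - z0) ^ m) * (norm (y n) * cmod (w - w0) ^ n)" by simp
      also have "\<dots> \<le> (C * p ^ m) * (D * q ^ n)"
        by (rule mult_mono[OF xp yq]) (use p C0 in auto)
      finally show "norm (case mn of (m, n) \<Rightarrow> \<beta> (x m) (y n) * (z - z0) ^ m * (w - w0) ^ n)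
          \<le> norm (case mn of (m, n) \<Rightarrow> (C * p ^ m) * (D * q ^ n))"
        using p q C0 D0 by (simp add: mn abs_mult norm_power)
    qed
    then show "(\<lambda>(m, n). \<beta> (x m) (y n) * (z - z0) ^ m * (w - w0) ^ n) summable_on UNIV \<times> UNIV"
      by (rule Infinite_Sum.abs_summable_summable)
  qed
qed

lemma analytic2_at_pairing:
  assumes "closed_subalgebra S" "bounded_pairing S \<beta>"
    and u: "power_family UNIV u z0 r x" and v: "power_family S v w0 s y"
  shows "analytic2_at (\<lambda>z w. \<beta> (u z) (v w)) z0 w0"
proof -
  have "r > 0" "s > 0" using u v by (auto simp: power_family_def)
  then show ?thesis
    unfolding analytic2_at_def using double_series_pairing[OF assms]
    by (intro exI[of _ "min r s"] conjI exI[of _ "\<lambda>m n. \<beta> (x m) (y n)"]) auto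
qed

end

section \<open>Resolvents\<close>

lemma matrix_diff_ldistrib: "A ** (B - C) = A ** B - A ** (C :: 'a :: ring_1 ^ 'n ^ 'm)"
  by (simp add: matrix_matrix_mult_def vec_eq_iff right_diff_distrib sum_subtractf)

lemma matrix_diff_rdistrib: "(A - B) ** C = A ** C - B ** (C :: 'a :: ring_1 ^ 'n ^ 'm)"
  by (simp add: matrix_matrix_mult_def vec_eq_iff left_diff_distrib sum_subtractf)

lemma invertible_mult_ring:
  fixes A B :: "'a :: ring_1 ^ 'n :: finite ^ 'n"
  assumes "invertible A" "invertible B"
  shows "invertible (A ** B)" "matrix_inv (A ** B) = matrix_inv B ** matrix_inv A"
proof -
  note inv = matrix_inv_inverse[OF assms(1)] matrix_inv_inverse[OF assms(2)]
  have "A ** B ** (matrix_inv B ** matrix_inv A) = A ** (B ** matrix_inv B) ** matrix_inv A"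
    "matrix_inv B ** matrix_inv A ** (A ** B) = matrix_inv B ** (matrix_inv A ** A) ** B"
    by (simp_all only: matrix_mul_assoc)
  then have 1: "A ** B ** (matrix_inv B ** matrix_inv A) = mat 1"
    "matrix_inv B ** matrix_inv A ** (A ** B) = mat 1"
    by (simp_all add: inv)
  then show "invertible (A ** B)" unfolding invertible_def by blast
  show "matrix_inv (A ** B) = matrix_inv B ** matrix_inv A" by (rule matrix_inv_unique[OF 1])
qed

text \<open>The entrywise sum is submultiplicative but gives the identity the norm d, which explains
  the constant factor in \<open>mat_norm_pow\<close>.\<close>

definition mat_norm :: "'a :: real_normed_vector ^ 'n :: finite ^ 'n \<Rightarrow> real" where
  "mat_norm M = (\<Sum>i\<in>UNIV. \<Sum>j\<in>UNIV. norm (M $ i $ j))"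

lemma mat_norm_nonneg: "0 \<le> mat_norm M"
  by (simp add: mat_norm_def sum_nonneg)

lemma row_norm_le: "(\<Sum>j\<in>UNIV. norm (M $ i $ j)) \<le> mat_norm M"
  unfolding mat_norm_def
  by (rule member_le_sum[of i UNIV "\<lambda>i. \<Sum>j\<in>UNIV. norm (M $ i $ j)"]) (auto simp: sum_nonneg)

lemma norm_entry_le: "norm (M $ i $ j) \<le> mat_norm M"
proof -
  have "norm (M $ i $ j) \<le> (\<Sum>j\<in>UNIV. norm (M $ i $ j))" by (rule member_le_sum) auto
  then show ?thesis using row_norm_le[of M i] by linarith
qed

lemma mat_norm_mult:
  fixes M N :: "'a :: real_normed_algebra_1 ^ 'n :: finite ^ 'n"
  shows "mat_norm (M ** N) \<le> mat_norm M * mat_norm N"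
proof -
  have "mat_norm (M ** N) \<le> (\<Sum>i\<in>UNIV. \<Sum>j\<in>UNIV. \<Sum>k\<in>UNIV. norm (M $ i $ k) * norm (N $ k $ j))"
    unfolding mat_norm_def matrix_matrix_mult_def
    by (intro sum_mono) (auto intro!: sum_norm_le norm_mult_ineq)
  also have "\<dots> = (\<Sum>i\<in>UNIV. \<Sum>k\<in>UNIV. norm (M $ i $ k) * (\<Sum>j\<in>UNIV. norm (N $ k $ j)))"
    unfolding sum_distrib_left by (intro sum.cong refl sum.swap)
  also have "\<dots> \<le> (\<Sum>i\<in>UNIV. \<Sum>k\<in>UNIV. norm (M $ i $ k) * mat_norm N)"
    by (intro sum_mono mult_left_mono row_norm_le) auto
  finally show ?thesis by (simp add: mat_norm_def sum_distrib_right)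
qed

fun mat_pow :: "'a :: semiring_1 ^ 'n :: finite ^ 'n \<Rightarrow> nat \<Rightarrow> 'a ^ 'n ^ 'n" where
  "mat_pow M 0 = mat 1"
| "mat_pow M (Suc n) = M ** mat_pow M n"

lemma mat_pow_Suc2: "mat_pow M (Suc n) = mat_pow M n ** M"
proof (induction n)
  case (Suc n)
  have "mat_pow M (Suc (Suc n)) = M ** (mat_pow M n ** M)" by (simp flip: Suc)
  then show ?case by (simp add: matrix_mul_assoc)
qed simp

lemma mat_norm_pow:
  fixes M :: "'a :: real_normed_algebra_1 ^ 'n :: finite ^ 'n"
  shows "mat_norm (mat_pow M n) \<le> mat_norm (mat 1 :: 'a ^ 'n ^ 'n) * mat_norm M ^ n"
proof (induction n)
  case (Suc n)
  have "mat_norm (mat_pow M (Suc n)) \<le> mat_norm M * mat_norm (mat_pow M n)"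
    by (simp add: mat_norm_mult)
  also have "\<dots> \<le> mat_norm M * (mat_norm (mat 1 :: 'a ^ 'n ^ 'n) * mat_norm M ^ n)"
    by (intro mult_left_mono Suc mat_norm_nonneg)
  finally show ?case by (simp add: mult_ac)
qed simp

context cstar_algebra
begin

definition scl_mat :: "complex \<Rightarrow> 'b ^ 'd :: finite ^ 'd \<Rightarrow> 'b ^ 'd ^ 'd" where
  "scl_mat t M = (\<chi> i j. scl t (M $ i $ j))"

lemma scl_mat_mult: "scl_mat t M ** N = scl_mat t (M ** N)" "M ** scl_mat t N = scl_mat t (M ** N)"
  by (simp_all add: scl_mat_def matrix_matrix_mult_def vec_eq_iff scl_mult_left scl_mult_right
      scl_sum_right)

lemma scl_mat_add_left: "scl_mat (s + t) M = scl_mat s M + scl_mat t M"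
  by (simp add: scl_mat_def vec_eq_iff scl_add_left)

lemma scl_mat_zero: "scl_mat 0 M = 0"
  by (simp add: scl_mat_def vec_eq_iff)

lemma Neumann_series:
  fixes M :: "'b ^ 'd :: finite ^ 'd"
  assumes "cmod t * mat_norm M < 1"
  obtains N where "N ** (mat 1 - scl_mat t M) = mat 1" "(mat 1 - scl_mat t M) ** N = mat 1"
    "\<And>i j. (\<lambda>n. scl (t ^ n) (mat_pow M n $ i $ j)) sums (N $ i $ j)"
proof -
  define q where "q = cmod t * mat_norm M"
  have q: "0 \<le> q" "q < 1" using assms by (simp_all add: q_def mat_norm_nonneg)
  have "summable (\<lambda>n. scl (t ^ n) (mat_pow M n $ i $ j))" for i j
  proof (rule summable_comparison_test')
    show "summable (\<lambda>n. mat_norm (mat 1 :: 'b ^ 'd ^ 'd) * q ^ n)"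
      using q by (intro summable_mult summable_geometric) auto
    fix n
    have "norm (scl (t ^ n) (mat_pow M n $ i $ j)) \<le> cmod t ^ n * mat_norm (mat_pow M n)"
      by (simp add: norm_scl norm_power mult_left_mono norm_entry_le)
    also have "\<dots> \<le> cmod t ^ n * (mat_norm (mat 1 :: 'b ^ 'd ^ 'd) * mat_norm M ^ n)"
      by (intro mult_left_mono mat_norm_pow) auto
    finally show "norm (scl (t ^ n) (mat_pow M n $ i $ j)) \<le> mat_norm (mat 1 :: 'b ^ 'd ^ 'd) * q ^ n"
      by (simp add: q_def power_mult_distrib mult_ac)
  qed
  then have "(\<lambda>n. scl (t ^ n) (mat_pow M n $ i $ j)) sums (\<Sum>n. scl (t ^ n) (mat_pow M n $ i $ j))" for i j
    by (rule summable_sums)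
  moreover define N :: "'b ^ 'd ^ 'd" where "N = (\<chi> i j. \<Sum>n. scl (t ^ n) (mat_pow M n $ i $ j))"
  ultimately have sums: "(\<lambda>n. scl (t ^ n) (mat_pow M n $ i $ j)) sums (N $ i $ j)" for i j
    by simp
  have tail: "(\<lambda>n. scl (t ^ Suc n) (mat_pow M (Suc n) $ i $ j)) sums (N $ i $ j - mat 1 $ i $ j)" for i j
    using sums[of i j] by (subst sums_Suc_iff) simp
  have "(\<lambda>n. \<Sum>k\<in>UNIV. M $ i $ k * scl (t ^ n) (mat_pow M n $ k $ j)) sums ((M ** N) $ i $ j)" for i j
    unfolding matrix_matrix_mult_def vec_lambda_beta
    by (intro sums_sum sums_mult sums)
  from sums_scl[OF this, of t]
  have "(\<lambda>n. scl (t ^ Suc n) (mat_pow M (Suc n) $ i $ j)) sums ((scl_mat t (M ** N)) $ i $ j)" for i j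
    by (simp add: matrix_matrix_mult_def scl_mat_def scl_mult_right scl_sum_right scl_scl)
  then have eq1: "N - mat 1 = scl_mat t (M ** N)"
    using tail sums_unique2 by (simp add: vec_eq_iff) blast
  have "(\<lambda>n. \<Sum>k\<in>UNIV. scl (t ^ n) (mat_pow M n $ i $ k) * M $ k $ j) sums ((N ** M) $ i $ j)" for i j
    unfolding matrix_matrix_mult_def vec_lambda_beta
    by (intro sums_sum sums_mult2 sums)
  from sums_scl[OF this, of t]
  have "(\<lambda>n. scl (t ^ Suc n) (mat_pow M (Suc n) $ i $ j)) sums ((scl_mat t (N ** M)) $ i $ j)" for i j
    unfolding mat_pow_Suc2
    by (simp add: matrix_matrix_mult_def scl_mat_def scl_mult_left scl_sum_right scl_scl)
  then have eq2: "N - mat 1 = scl_mat t (N ** M)"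
    using tail sums_unique2 by (simp add: vec_eq_iff) blast
  show ?thesis
  proof (rule that[OF _ _ sums])
    show "N ** (mat 1 - scl_mat t M) = mat 1"
      by (simp add: matrix_diff_ldistrib scl_mat_mult flip: eq2)
    show "(mat 1 - scl_mat t M) ** N = mat 1"
      by (simp add: matrix_diff_rdistrib scl_mat_mult flip: eq1)
  qed
qed

text \<open>In this normalisation 0 always belongs to the resolvent set, with value 1; it is the
  base point of all continuations.\<close>

definition resolvent :: "'b ^ 'd :: finite ^ 'd \<Rightarrow> complex \<Rightarrow> 'b ^ 'd ^ 'd" where
  "resolvent K z = matrix_inv (mat 1 - scl_mat z K)"

definition resolvent_set :: "'b ^ 'd :: finite ^ 'd \<Rightarrow> complex set" where
  "resolvent_set K = {z. invertible (mat 1 - scl_mat z K)}"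

lemma resolvent_inverse:
  assumes "z \<in> resolvent_set K"
  shows "(mat 1 - scl_mat z K) ** resolvent K z = mat 1" "resolvent K z ** (mat 1 - scl_mat z K) = mat 1"
  using assms matrix_inv_inverse unfolding resolvent_def resolvent_set_def by auto

lemma resolvent_zero: "0 \<in> resolvent_set K" "resolvent K 0 = mat 1"
proof -
  have "mat 1 ** mat 1 = (mat 1 :: 'b ^ 'd :: finite ^ 'd)" by simp
  then show "0 \<in> resolvent_set K" "resolvent K 0 = mat 1"
    by (auto simp: resolvent_set_def resolvent_def scl_mat_zero invertible_def intro!: matrix_inv_unique)
qed

text \<open>\<open>1 - z K = (1 - (z - z\<^sub>0) K R) (1 - z\<^sub>0 K)\<close> for \<open>R = (1 - z\<^sub>0 K)\<^sup>-\<^sup>1\<close>.\<close>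

lemma resolvent_power_family:
  fixes K :: "'b ^ 'd :: finite ^ 'd"
  assumes z0: "z0 \<in> resolvent_set K"
  shows "\<exists>r>0. ball z0 r \<subseteq> resolvent_set K \<and>
    (\<forall>S. closed_subalgebra S \<longrightarrow> (\<forall>i j. K $ i $ j \<in> S) \<longrightarrow> (\<forall>i j. resolvent K z0 $ i $ j \<in> S) \<longrightarrow>
      (\<forall>i j. power_family S (\<lambda>z. resolvent K z $ i $ j) z0 r
        (\<lambda>n. (resolvent K z0 ** mat_pow (K ** resolvent K z0) n) $ i $ j)))"
proof -
  define R where "R = resolvent K z0"
  have R: "(mat 1 - scl_mat z0 K) ** R = mat 1" "R ** (mat 1 - scl_mat z0 K) = mat 1"
    unfolding R_def by (rule resolvent_inverse[OF z0])+
  define M where "M = K ** R"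
  \<comment> \<open>Adding 1 covers the case M = 0; the product of \<open>r\<close> and the norm of
    \<open>M\<close> stays at most 1, which bounds the coefficients.\<close>
  define r where "r = 1 / (mat_norm M + 1)"
  have M0: "mat_norm M \<ge> 0" by (rule mat_norm_nonneg)
  then have r: "r > 0" "r * mat_norm M \<le> 1" by (simp_all add: r_def field_simps)
  have factor: "mat 1 - scl_mat z K = (mat 1 - scl_mat (z - z0) M) ** (mat 1 - scl_mat z0 K)" for z
  proof -
    have "scl_mat (z - z0) M ** (mat 1 - scl_mat z0 K) = scl_mat (z - z0) K"
      unfolding M_def scl_mat_mult by (simp add: R flip: matrix_mul_assoc)
    then have "(mat 1 - scl_mat (z - z0) M) ** (mat 1 - scl_mat z0 K)
        = mat 1 - (scl_mat z0 K + scl_mat (z - z0) K)"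
      by (simp add: matrix_diff_rdistrib)
    then show ?thesis by (simp flip: scl_mat_add_left)
  qed
  have near: "z \<in> resolvent_set K \<and>
      (\<forall>i j. (\<lambda>n. scl ((z - z0) ^ n) ((R ** mat_pow M n) $ i $ j)) sums (resolvent K z $ i $ j))"
    if "z \<in> ball z0 r" for z
  proof -
    have "cmod (z - z0) * mat_norm M < 1"
    proof -
      have "cmod (z - z0) * (mat_norm M + 1) < 1"
        using that M0 by (simp add: r_def dist_norm norm_minus_commute field_simps)
      then show ?thesis using norm_ge_zero[of "z - z0"] by (simp add: distrib_left del: norm_ge_zero)
    qed
    then obtain N where N: "N ** (mat 1 - scl_mat (z - z0) M) = mat 1"
        "(mat 1 - scl_mat (z - z0) M) ** N = mat 1"
      "\<And>i j. (\<lambda>n. scl ((z - z0) ^ n) (mat_pow M n $ i $ j)) sums (N $ i $ j)"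
      using Neumann_series by blast
    have inv: "invertible (mat 1 - scl_mat (z - z0) M)" "invertible (mat 1 - scl_mat z0 K)"
      using N R unfolding invertible_def by blast+
    have "resolvent K z = R ** N"
      unfolding resolvent_def factor[of z] invertible_mult_ring(2)[OF inv]
      using matrix_inv_unique[OF N(2) N(1)] by (simp add: R_def resolvent_def)
    moreover have "(\<lambda>n. scl ((z - z0) ^ n) ((R ** mat_pow M n) $ i $ j)) sums ((R ** N) $ i $ j)" for i j
    proof -
      have "(\<lambda>n. \<Sum>k\<in>UNIV. R $ i $ k * scl ((z - z0) ^ n) (mat_pow M n $ k $ j)) sums
          (\<Sum>k\<in>UNIV. R $ i $ k * N $ k $ j)"
        by (intro sums_sum sums_mult N(3))
      then show ?thesis by (simp add: matrix_matrix_mult_def scl_mult_right scl_sum_right)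
    qed
    moreover have "z \<in> resolvent_set K"
      unfolding resolvent_set_def mem_Collect_eq factor[of z] using invertible_mult_ring(1)[OF inv] by simp
    ultimately show ?thesis by simp
  qed
  have bound: "norm ((R ** mat_pow M n) $ i $ j) * r ^ n \<le> mat_norm R * mat_norm (mat 1 :: 'b ^ 'd ^ 'd)" for n i j
  proof -
    have "norm ((R ** mat_pow M n) $ i $ j) \<le> mat_norm R * (mat_norm (mat 1 :: 'b ^ 'd ^ 'd) * mat_norm M ^ n)"
      by (meson norm_entry_le mat_norm_mult mat_norm_pow mat_norm_nonneg mult_left_mono order_trans)
    then have "norm ((R ** mat_pow M n) $ i $ j) * r ^ n
        \<le> mat_norm R * (mat_norm (mat 1 :: 'b ^ 'd ^ 'd) * mat_norm M ^ n) * r ^ n"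
      using r by (intro mult_right_mono) auto
    also have "\<dots> = mat_norm R * mat_norm (mat 1 :: 'b ^ 'd ^ 'd) * (r * mat_norm M) ^ n"
      by (simp add: power_mult_distrib)
    also have "\<dots> \<le> mat_norm R * mat_norm (mat 1 :: 'b ^ 'd ^ 'd) * 1"
      using r M0 by (intro mult_left_mono power_le_one) (auto simp: mat_norm_nonneg)
    finally show ?thesis by simp
  qed
  show ?thesis
  proof (intro exI[of _ r] conjI allI impI)
    show "r > 0" by (rule r)
    show "ball z0 r \<subseteq> resolvent_set K" using near by auto
    fix S :: "'b set" and i j
    assume S: "closed_subalgebra S" and "\<forall>i j. K $ i $ j \<in> S" and "\<forall>i j. resolvent K z0 $ i $ j \<in> S"
    then have KS: "\<And>i j. K $ i $ j \<in> S" and RS: "\<And>i j. resolvent K z0 $ i $ j \<in> S" by auto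
    have mult: "(A ** B) $ i $ j \<in> S" if "\<And>i j. A $ i $ j \<in> S" "\<And>i j. B $ i $ j \<in> S"
      for A B :: "'b ^ 'd ^ 'd" and i j
      unfolding matrix_matrix_mult_def using that
      by (auto intro!: closed_subalgebra_sum[OF S] closed_subalgebraD[OF S])
    have "mat_pow M n $ i $ j \<in> S" for n i j
      by (induction n arbitrary: i j)
        (auto simp: M_def R_def mat_def intro: mult KS RS closed_subalgebraD[OF S])
    then have "(R ** mat_pow M n) $ i $ j \<in> S" for n i j
      by (intro mult) (auto simp: R_def RS)
    then show "power_family S (\<lambda>z. resolvent K z $ i $ j) z0 r
        (\<lambda>n. (resolvent K z0 ** mat_pow (K ** resolvent K z0) n) $ i $ j)"
      unfolding power_family_def R_def[symmetric] M_def[symmetric] using r bound near by blast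
  qed
qed

lemma open_resolvent_set: "open (resolvent_set K)"
  unfolding open_contains_ball
proof
  fix z assume "z \<in> resolvent_set K"
  from resolvent_power_family[OF this] show "\<exists>e>0. ball z e \<subseteq> resolvent_set K" by auto
qed

lemma isCont_resolvent:
  assumes "z0 \<in> resolvent_set K"
  shows "isCont (\<lambda>z. resolvent K z $ i $ j) z0"
proof -
  obtain r where "power_family UNIV (\<lambda>z. resolvent K z $ i $ j) z0 r
      (\<lambda>n. (resolvent K z0 ** mat_pow (K ** resolvent K z0) n) $ i $ j)"
    using resolvent_power_family[OF assms] closed_subalgebra_UNIV by blast
  then show ?thesis by (rule power_family_isCont)
qed

text \<open>
  No spectral permanence is needed: on the component of \<open>0\<close> the resolvent stays in the closed
  subalgebra by analytic continuation.
\<close>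

lemma resolvent_in_subalgebra:
  assumes S: "closed_subalgebra S" and K: "\<And>i j. K $ i $ j \<in> S"
    and z: "z \<in> connected_component_set (resolvent_set K) 0"
  shows "resolvent K z $ i $ j \<in> S"
proof -
  let ?D = "connected_component_set (resolvent_set K) 0"
  let ?E = "{z \<in> ?D. \<forall>i j. resolvent K z $ i $ j \<in> S}"
  have D: "?D \<subseteq> resolvent_set K" by (rule connected_component_subset)
  have openD: "open ?D" by (rule open_connected_component[OF open_resolvent_set])
  have "openin (top_of_set ?D) ?E"
  proof -
    \<comment> \<open>At a point of \<open>?E\<close> the Taylor coefficients are polynomials in the
      entries of \<open>K\<close> and of the resolvent at z0, hence lie in \<open>S\<close>.\<close>
    have "\<exists>e>0. ball z0 e \<subseteq> ?E" if z0: "z0 \<in> ?E" for z0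
    proof -
      have z0D: "z0 \<in> ?D" and z0S: "\<And>i j. resolvent K z0 $ i $ j \<in> S" using z0 by auto
      obtain r where r: "r > 0" "\<And>i j. power_family S (\<lambda>z. resolvent K z $ i $ j) z0 r
          (\<lambda>n. (resolvent K z0 ** mat_pow (K ** resolvent K z0) n) $ i $ j)"
        using resolvent_power_family[OF subsetD[OF D z0D]] S K z0S by auto
      obtain e where e: "e > 0" "ball z0 e \<subseteq> ?D" using openD z0D open_contains_ball by blast
      have "ball z0 (min r e) \<subseteq> ?E"
        using e power_family_limit_in[OF S r(2)] by auto
      then show ?thesis using r(1) e(1) by (intro exI[of _ "min r e"]) simp
    qed
    then have "open ?E" unfolding open_contains_ball by blast
    then show ?thesis by (intro open_subset) auto
  qed
  moreover have "closedin (top_of_set ?D) ?E"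
  proof -
    have "continuous_on ?D (\<lambda>z. resolvent K z $ i $ j)" for i j
      by (intro continuous_at_imp_continuous_on ballI isCont_resolvent subsetD[OF D])
    then have "closedin (top_of_set ?D) (?D \<inter> (\<lambda>z. resolvent K z $ i $ j) -` S)" for i j
      by (rule continuous_closedin_preimage[OF _ closed_subalgebraD(8)[OF S]])
    then have "closedin (top_of_set ?D) (\<Inter>i. \<Inter>j. ?D \<inter> (\<lambda>z. resolvent K z $ i $ j) -` S)"
      by (intro closedin_INT) auto
    moreover have "(\<Inter>i. \<Inter>j. ?D \<inter> (\<lambda>z. resolvent K z $ i $ j) -` S) = ?E" by auto
    ultimately show ?thesis by simp
  qed
  ultimately have "?E = {} \<or> ?E = ?D"
    using connected_connected_component connected_clopen by blast
  moreover have "0 \<in> ?E"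
    using resolvent_zero[of K] closed_subalgebraD(1,2)[OF S]
    by (auto simp: mat_def)
  ultimately show ?thesis using z by blast
qed

end

section \<open>Reversal of words\<close>

context semicircular_matrix
begin

text \<open>A relation rather than a map: linear relations between words can give an element several
  representations, and if the state is not faithful, their reversals are only known to agree up to
  2-norm 0.\<close>

inductive reversal :: "'b \<Rightarrow> 'b \<Rightarrow> bool" where
  reversal_zero: "reversal 0 0"
| reversal_step: "reversal x x' \<Longrightarrow> reversal (x + scl c (word X w)) (x' + scl c (word X (rev w)))"

lemma reversal_word: "reversal (word X w) (word X (rev w))"
  using reversal_step[OF reversal_zero, of 1 w] by simp

lemma reversal_scl_one: "reversal (scl c 1) (scl c 1)"
  using reversal_step[OF reversal_zero, of c "[]"] by (simp add: word_def)

lemma reversal_one: "reversal 1 1"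
  using reversal_scl_one[of 1] by simp

lemma reversal_X: "reversal (X $ p $ q) (X $ p $ q)"
  using reversal_word[of "[(p, q)]"] by (simp add: word_def)

lemma reversal_add:
  assumes "reversal x x'" "reversal y y'"
  shows "reversal (x + y) (x' + y')"
  using assms(2)
  by induction (use assms(1) reversal_step in \<open>simp_all flip: add.assoc\<close>)

lemma reversal_scl: "reversal x x' \<Longrightarrow> reversal (scl c x) (scl c x')"
  by (induction rule: reversal.induct)
    (simp_all add: reversal_zero scl_add_right scl_scl reversal_step)

lemma reversal_diff: "reversal x x' \<Longrightarrow> reversal y y' \<Longrightarrow> reversal (x - y) (x' - y')"
  using reversal_add[of x x' "- y" "- y'"] reversal_scl[of y y' "-1"] by (simp add: scl_minus_one)

lemma reversal_sum:
  "(\<And>i. i \<in> I \<Longrightarrow> reversal (f i) (f' i)) \<Longrightarrow> reversal (sum f I) (sum f' I)"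
  by (induction I rule: infinite_finite_induct) (simp_all add: reversal_zero reversal_add)

lemma reversal_mult_word: "reversal x x' \<Longrightarrow> reversal (x * word X v) (word X (rev v) * x')"
proof (induction rule: reversal.induct)
  case (reversal_step x x' c w)
  then show ?case
    using reversal.reversal_step[OF reversal_step.IH, of c "w @ v"]
    by (simp add: word_append distrib_left distrib_right scl_mult_left scl_mult_right)
qed (simp add: reversal_zero)

lemma reversal_mult:
  assumes "reversal x x'" "reversal y y'"
  shows "reversal (x * y) (y' * x')"
  using assms(2)
proof induction
  case (reversal_step y y' c w)
  then show ?case
    using reversal_add[OF _ reversal_scl[OF reversal_mult_word[OF assms(1), of w], of c]]
    by (simp add: distrib_left distrib_right scl_mult_left scl_mult_right)
qed (simp add: reversal_zero)

lemma reversal_power: "reversal x x' \<Longrightarrow> reversal (x ^ n) (x' ^ n)"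
proof (induction n)
  case (Suc n)
  then show ?case using reversal_mult[of x x' "x ^ n" "x' ^ n"] by (simp add: power_commutes)
qed (simp add: reversal_one)

lemma reversal_star: "reversal x x' \<Longrightarrow> reversal (star x) (star x')"
proof (induction rule: reversal.induct)
  case (reversal_step x x' c w)
  then show ?case
    using reversal.reversal_step[OF reversal_step.IH, of "cnj c" "rev w"]
    by (simp add: star_add star_scl star_word)
qed (simp add: reversal_zero)

lemma reversal_psi: "reversal x x' \<Longrightarrow> \<psi> x' = \<psi> x"
  by (induction rule: reversal.induct) (simp_all add: psi_add psi_scl psi_word_rev)

text \<open>Reversal turns \<open>x * star x\<close> into \<open>star x' * x'\<close>, and the trace
  absorbs the exchange of factors.\<close>

lemma reversal_norm2_sq:
  assumes "reversal x x'"
  shows "norm2_sq x' = norm2_sq x"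
  using reversal_psi[OF reversal_mult[OF assms reversal_star[OF assms]]]
  by (simp add: norm2_sq_def psi_trace)

text \<open>The powers of \<open>star x' * x'\<close> are reversals of those of
  \<open>x * star x\<close>, so the moment criterion applies with \<open>star x\<close> as the
  comparison element.\<close>

lemma reversal_norm_le:
  assumes "faithful_state star \<psi>" "reversal x x'"
  shows "norm x' \<le> norm x"
proof -
  have "\<psi> ((star x' * x') ^ n) = \<psi> ((star (star x) * star x) ^ n)" for n
    using reversal_psi[OF reversal_power[OF reversal_mult[OF assms(2) reversal_star[OF assms(2)]]]]
    by (simp add: star_star)
  then show ?thesis
    using norm_le_of_moments[OF assms(1)] norm_star by metis
qed

text \<open>The estimate passes through the 2-norm, which reversal preserves for every tracial state
  here. The norm of y' itself is controlled only for a faithful state.\<close>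

lemma reversal_psi_mult_bound:
  assumes "reversal y y'"
  shows "cmod (\<psi> (x * y')) \<le> norm x * norm y"
proof -
  have "cmod (\<psi> (x * y')) \<le> sqrt (norm2_sq x) * sqrt (norm2_sq y)"
    using Cauchy_Schwarz[of x y'] by (simp add: reversal_norm2_sq[OF assms])
  also have "\<dots> \<le> norm x * norm y"
    by (intro mult_mono sqrt_norm2_sq_le) (auto simp: norm2_sq_nonneg)
  finally show ?thesis .
qed

text \<open>The domain of \<open>reversal\<close> is the span of the words, so this is the closed
  unital algebra generated by the entries of \<open>X\<close>, written so that approximants come
  with their reversals.\<close>

definition word_algebra :: "'b set" where
  "word_algebra = closure {x. \<exists>x'. reversal x x'}"

lemma word_algebra_approx:
  assumes "y \<in> word_algebra"
  shows "\<exists>z z'. (\<forall>n. reversal (z n) (z' n)) \<and> z \<longlonglongrightarrow> y"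
proof -
  obtain z where z: "\<forall>n. \<exists>x'. reversal (z n) x'" "z \<longlonglongrightarrow> y"
    using assms unfolding word_algebra_def closure_sequential by blast
  obtain z' where "\<forall>n. reversal (z n) (z' n)" using choice[OF z(1)] by blast
  then show ?thesis using z(2) by blast
qed

lemma word_algebraI:
  assumes "\<And>n. reversal (z n) (z' n)" "z \<longlonglongrightarrow> y"
  shows "y \<in> word_algebra"
proof -
  have "z n \<in> {x. \<exists>x'. reversal x x'}" for n using assms(1) by auto
  then show ?thesis
    unfolding word_algebra_def closure_sequential using assms(2) by (intro exI[of _ z]) simp
qed

lemma reversal_in_word_algebra: "reversal x x' \<Longrightarrow> x \<in> word_algebra"
  using word_algebraI[of "\<lambda>_. x" "\<lambda>_. x'"] by simp

lemma closed_subalgebra_word_algebra: "closed_subalgebra word_algebra"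
  unfolding closed_subalgebra_def unital_subalgebra_def
proof (intro conjI ballI allI)
  show "1 \<in> word_algebra" by (rule reversal_in_word_algebra[OF reversal_one])
  show "closed word_algebra" by (simp add: word_algebra_def)
  fix x assume "x \<in> word_algebra"
  then obtain u u' where u: "\<And>n. reversal (u n) (u' n)" "u \<longlonglongrightarrow> x" using word_algebra_approx by blast
  show "scl c x \<in> word_algebra" for c
    by (rule word_algebraI[OF reversal_scl[OF u(1)] bounded_linear.tendsto[OF bounded_linear_scl u(2)]])
  fix y assume "y \<in> word_algebra"
  then obtain v v' where v: "\<And>n. reversal (v n) (v' n)" "v \<longlonglongrightarrow> y" using word_algebra_approx by blast
  show "x + y \<in> word_algebra"
    by (rule word_algebraI[OF reversal_add[OF u(1) v(1)] tendsto_add[OF u(2) v(2)]])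
  show "x * y \<in> word_algebra"
    by (rule word_algebraI[OF reversal_mult[OF u(1) v(1)] tendsto_mult[OF u(2) v(2)]])
qed

lemma X_in_word_algebra: "X $ p $ q \<in> word_algebra"
  by (rule reversal_in_word_algebra[OF reversal_X])

text \<open>
  The extension of \<open>(x, y) \<mapsto> \<psi> (x * y')\<close>, \<open>y'\<close> the reversal of \<open>y\<close>, to the closure. The
  reversal itself need not extend when the state is not faithful.
\<close>

definition rev_pairing :: "'b \<Rightarrow> 'b \<Rightarrow> complex" where
  "rev_pairing x y =
     (THE v. \<forall>z z'. (\<forall>n. reversal (z n) (z' n)) \<longrightarrow> z \<longlonglongrightarrow> y \<longrightarrow> (\<lambda>n. \<psi> (x * z' n)) \<longlonglongrightarrow> v)"

text \<open>This justifies the description in \<open>rev_pairing\<close>: by the 2-norm bound the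
  values along an approximating sequence are Cauchy, and their limit does not depend on the
  sequence.\<close>

lemma rev_pairing_tendsto:
  assumes z: "\<And>n. reversal (z n) (z' n)" "z \<longlonglongrightarrow> y"
  shows "(\<lambda>n. \<psi> (x * z' n)) \<longlonglongrightarrow> rev_pairing x y"
proof -
  have diff: "cmod (\<psi> (x * u') - \<psi> (x * v')) \<le> norm x * norm (u - v)"
    if "reversal u u'" "reversal v v'" for u u' v v'
    using reversal_psi_mult_bound[OF reversal_diff[OF that], of x]
    by (simp add: right_diff_distrib psi_diff)
  have "Cauchy (\<lambda>n. \<psi> (x * z' n))"
  proof (rule CauchyI)
    fix e :: real assume e: "e > 0"
    \<comment> \<open>Adding 1 covers x = 0.\<close>
    have pos: "0 < norm x + 1" by (simp add: add_nonneg_pos)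
    obtain M where M: "\<And>m n. m \<ge> M \<Longrightarrow> n \<ge> M \<Longrightarrow> norm (z m - z n) < e / (norm x + 1)"
      using CauchyD[OF LIMSEQ_imp_Cauchy[OF z(2)], of "e / (norm x + 1)"] e pos by auto
    have "norm (\<psi> (x * z' m) - \<psi> (x * z' n)) < e" if "m \<ge> M" "n \<ge> M" for m n
    proof -
      have "norm (\<psi> (x * z' m) - \<psi> (x * z' n)) \<le> (norm x + 1) * norm (z m - z n)"
        using diff[OF z(1) z(1), of m n] norm_ge_zero[of "z m - z n"]
        by (simp add: distrib_right del: norm_ge_zero)
      also have "\<dots> < e" using M[OF that] pos by (simp add: field_simps)
      finally show ?thesis .
    qed
    then show "\<exists>M. \<forall>m\<ge>M. \<forall>n\<ge>M. norm (\<psi> (x * z' m) - \<psi> (x * z' n)) < e" by blast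
  qed
  then obtain v where v: "(\<lambda>n. \<psi> (x * z' n)) \<longlonglongrightarrow> v"
    using Cauchy_convergent convergent_def by blast
  have all: "(\<lambda>n. \<psi> (x * u' n)) \<longlonglongrightarrow> v" if u: "\<And>n. reversal (u n) (u' n)" "u \<longlonglongrightarrow> y" for u u'
  proof -
    have "(\<lambda>n. norm x * norm (u n - z n)) \<longlonglongrightarrow> norm x * norm (y - y)"
      by (intro tendsto_intros u z)
    then have lim: "(\<lambda>n. norm x * norm (u n - z n)) \<longlonglongrightarrow> 0" by simp
    have "(\<lambda>n. \<psi> (x * u' n) - \<psi> (x * z' n)) \<longlonglongrightarrow> 0"
      by (rule Lim_null_comparison[OF always_eventually[OF allI] lim]) (rule diff[OF u(1) z(1)])
    from tendsto_add[OF this v] show ?thesis by simp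
  qed
  have "rev_pairing x y = v"
    unfolding rev_pairing_def
  proof (rule the_equality)
    show "\<forall>z z'. (\<forall>n. reversal (z n) (z' n)) \<longrightarrow> z \<longlonglongrightarrow> y \<longrightarrow> (\<lambda>n. \<psi> (x * z' n)) \<longlonglongrightarrow> v"
      using all by blast
    show "v' = v" if "\<forall>z z'. (\<forall>n. reversal (z n) (z' n)) \<longrightarrow> z \<longlonglongrightarrow> y \<longrightarrow> (\<lambda>n. \<psi> (x * z' n)) \<longlonglongrightarrow> v'" for v'
      using that z v LIMSEQ_unique by blast
  qed
  then show ?thesis using v by simp
qed

lemma rev_pairing_reversal:
  assumes "reversal y y'"
  shows "rev_pairing x y = \<psi> (x * y')"
  by (rule LIMSEQ_unique[OF rev_pairing_tendsto[of "\<lambda>_. y" "\<lambda>_. y'"]]) (use assms in simp_all)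

lemma rev_pairing_eqI:
  assumes "\<And>n. reversal (z n) (z' n)" "z \<longlonglongrightarrow> y" "(\<lambda>n. \<psi> (x * z' n)) \<longlonglongrightarrow> v"
  shows "rev_pairing x y = v"
  by (rule LIMSEQ_unique[OF rev_pairing_tendsto[OF assms(1,2)] assms(3)])

lemma bounded_pairing_rev_pairing: "bounded_pairing word_algebra rev_pairing"
  unfolding bounded_pairing_def
proof (intro conjI allI ballI)
  fix x y assume "y \<in> word_algebra"
  then obtain v v' where v: "\<And>n. reversal (v n) (v' n)" "v \<longlonglongrightarrow> y" using word_algebra_approx by blast
  note lim = rev_pairing_tendsto[OF v]
  show "rev_pairing (x + x') y = rev_pairing x y + rev_pairing x' y" for x'
    by (rule rev_pairing_eqI[OF v]) (simp add: distrib_right psi_add tendsto_add lim)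
  show "rev_pairing (scl c x) y = c * rev_pairing x y" for c
    by (rule rev_pairing_eqI[OF v]) (simp add: scl_mult_left psi_scl tendsto_mult lim)
  show "rev_pairing x (scl c y) = c * rev_pairing x y" for c
    by (rule rev_pairing_eqI[OF reversal_scl[OF v(1)] bounded_linear.tendsto[OF bounded_linear_scl v(2)]])
      (simp add: scl_mult_right psi_scl tendsto_mult lim)
  show "cmod (rev_pairing x y) \<le> norm x * norm y"
  proof (rule LIMSEQ_le)
    show "(\<lambda>n. cmod (\<psi> (x * v' n))) \<longlonglongrightarrow> cmod (rev_pairing x y)" by (intro tendsto_norm lim)
    show "(\<lambda>n. norm x * norm (v n)) \<longlonglongrightarrow> norm x * norm y" by (intro tendsto_intros v)
  qed (use reversal_psi_mult_bound[OF v(1)] in blast)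
  fix y' assume "y' \<in> word_algebra"
  then obtain u u' where u: "\<And>n. reversal (u n) (u' n)" "u \<longlonglongrightarrow> y'" using word_algebra_approx by blast
  show "rev_pairing x (y + y') = rev_pairing x y + rev_pairing x y'"
    by (rule rev_pairing_eqI[OF reversal_add[OF v(1) u(1)] tendsto_add[OF v(2) u(2)]])
      (simp add: distrib_left psi_add tendsto_add lim rev_pairing_tendsto[OF u])
qed

lemma rev_pairing_one:
  assumes "y \<in> word_algebra"
  shows "rev_pairing 1 y = \<psi> y"
proof -
  obtain v v' where v: "\<And>n. reversal (v n) (v' n)" "v \<longlonglongrightarrow> y"
    using assms word_algebra_approx by blast
  show ?thesis
    by (rule rev_pairing_eqI[OF v])
      (simp add: reversal_psi[OF v(1)] bounded_linear.tendsto[OF bounded_linear_psi v(2)])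
qed

text \<open>The reversal of y c is c' y', so c' moves to the first argument. Right multiplications
  in the equation for \<open>U\<close> thereby become multiplications by the transposed
  coefficients.\<close>

lemma rev_pairing_mult_right:
  assumes "y \<in> word_algebra" "reversal c c'"
  shows "rev_pairing x (y * c) = rev_pairing (x * c') y"
proof -
  obtain v v' where v: "\<And>n. reversal (v n) (v' n)" "v \<longlonglongrightarrow> y"
    using assms(1) word_algebra_approx by blast
  show ?thesis
    by (rule rev_pairing_eqI[OF reversal_mult[OF v(1) assms(2)] tendsto_mult_right[OF v(2)]])
      (use rev_pairing_tendsto[OF v, of "x * c'"] in \<open>simp add: mult.assoc\<close>)
qed

text \<open>The relation makes sense for any state; existence and uniqueness of y' are derived from
  \<open>reversal_norm_le\<close>, hence for faithful states.\<close>

definition closure_reversal :: "'b \<Rightarrow> 'b \<Rightarrow> bool" where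
  "closure_reversal y y' \<longleftrightarrow> (\<exists>z z'. (\<forall>n. reversal (z n) (z' n)) \<and> z \<longlonglongrightarrow> y \<and> z' \<longlonglongrightarrow> y')"

lemma closure_reversal_refl: "reversal y y' \<Longrightarrow> closure_reversal y y'"
  unfolding closure_reversal_def by (rule exI[of _ "\<lambda>_. y"], rule exI[of _ "\<lambda>_. y'"]) simp

lemma closure_reversal_add:
  assumes "closure_reversal x x'" "closure_reversal y y'"
  shows "closure_reversal (x + y) (x' + y')"
proof -
  obtain z z' where z: "\<And>n. reversal (z n) (z' n)" "z \<longlonglongrightarrow> x" "z' \<longlonglongrightarrow> x'"
    using assms(1) unfolding closure_reversal_def by blast
  obtain w w' where w: "\<And>n. reversal (w n) (w' n)" "w \<longlonglongrightarrow> y" "w' \<longlonglongrightarrow> y'"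
    using assms(2) unfolding closure_reversal_def by blast
  show ?thesis
    unfolding closure_reversal_def
    by (rule exI[of _ "\<lambda>n. z n + w n"], rule exI[of _ "\<lambda>n. z' n + w' n"])
      (intro conjI allI reversal_add z w tendsto_add)
qed

lemma closure_reversal_mult:
  assumes "closure_reversal x x'" "closure_reversal y y'"
  shows "closure_reversal (x * y) (y' * x')"
proof -
  obtain z z' where z: "\<And>n. reversal (z n) (z' n)" "z \<longlonglongrightarrow> x" "z' \<longlonglongrightarrow> x'"
    using assms(1) unfolding closure_reversal_def by blast
  obtain w w' where w: "\<And>n. reversal (w n) (w' n)" "w \<longlonglongrightarrow> y" "w' \<longlonglongrightarrow> y'"
    using assms(2) unfolding closure_reversal_def by blast
  show ?thesis
    unfolding closure_reversal_def
    by (rule exI[of _ "\<lambda>n. z n * w n"], rule exI[of _ "\<lambda>n. w' n * z' n"])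
      (intro conjI allI reversal_mult z w tendsto_mult)
qed

lemma closure_reversal_sum:
  "(\<And>i. i \<in> I \<Longrightarrow> closure_reversal (f i) (f' i)) \<Longrightarrow> closure_reversal (sum f I) (sum f' I)"
  by (induction I rule: infinite_finite_induct)
    (simp_all add: closure_reversal_refl reversal_zero closure_reversal_add)

lemma closure_reversal_unique:
  assumes faithful: "faithful_state star \<psi>"
    and "closure_reversal y u" "closure_reversal y v"
  shows "u = v"
proof -
  obtain z z' where z: "\<And>n. reversal (z n) (z' n)" "z \<longlonglongrightarrow> y" "z' \<longlonglongrightarrow> u"
    using assms(2) unfolding closure_reversal_def by blast
  obtain w w' where w: "\<And>n. reversal (w n) (w' n)" "w \<longlonglongrightarrow> y" "w' \<longlonglongrightarrow> v"
    using assms(3) unfolding closure_reversal_def by blast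
  have "norm (u - v) \<le> norm (y - y)"
  proof (rule LIMSEQ_le)
    show "(\<lambda>n. norm (z' n - w' n)) \<longlonglongrightarrow> norm (u - v)" by (intro tendsto_intros z w)
    show "(\<lambda>n. norm (z n - w n)) \<longlonglongrightarrow> norm (y - y)" by (intro tendsto_intros z w)
  qed (use reversal_norm_le[OF faithful reversal_diff[OF z(1) w(1)]] in blast)
  then show ?thesis by simp
qed

lemma closure_reversal_exists:
  assumes faithful: "faithful_state star \<psi>" and "y \<in> word_algebra"
  obtains y' where "closure_reversal y y'"
proof -
  obtain z z' where z: "\<And>n. reversal (z n) (z' n)" "z \<longlonglongrightarrow> y"
    using assms(2) word_algebra_approx by blast
  have "Cauchy z'"
  proof (rule CauchyI)
    fix e :: real assume e: "e > 0"
    obtain M where "\<forall>m\<ge>M. \<forall>n\<ge>M. norm (z m - z n) < e"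
      using CauchyD[OF LIMSEQ_imp_Cauchy[OF z(2)] e] by blast
    moreover have "norm (z' m - z' n) \<le> norm (z m - z n)" for m n
      by (rule reversal_norm_le[OF faithful reversal_diff[OF z(1) z(1)]])
    ultimately show "\<exists>M. \<forall>m\<ge>M. \<forall>n\<ge>M. norm (z' m - z' n) < e"
      using le_less_trans by blast
  qed
  then obtain y' where "z' \<longlonglongrightarrow> y'" using Cauchy_convergent convergent_def by blast
  then have "closure_reversal y y'" using z unfolding closure_reversal_def by blast
  then show ?thesis by (rule that)
qed

end

section \<open>Functional equations for the second-order transforms\<close>

lemma double_series_shift:
  assumes "double_series c z w v"
  shows "double_series (\<lambda>m n. case m of 0 \<Rightarrow> 0 | Suc m \<Rightarrow> c m n) z w (z * v)"
proof -
  let ?c = "\<lambda>m n. case m of 0 \<Rightarrow> 0 | Suc m \<Rightarrow> c m n"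
  let ?k = "\<lambda>(m, n). (Suc m, n :: nat)"
  have "((\<lambda>(m, n). z * (c m n * z ^ m * w ^ n)) has_sum z * v) UNIV"
    using has_sum_cmult_right[OF assms[unfolded double_series_def], of z]
    by (simp add: case_prod_beta')
  also have "(\<lambda>(m, n). z * (c m n * z ^ m * w ^ n)) = (\<lambda>(m, n). ?c m n * z ^ m * w ^ n) \<circ> ?k"
    by (auto simp: fun_eq_iff mult_ac)
  finally have comp: "((\<lambda>(m, n). ?c m n * z ^ m * w ^ n) \<circ> ?k has_sum z * v) UNIV" .
  have "inj ?k" by (auto intro: injI)
  from has_sum_reindex[OF this] comp
  have "((\<lambda>(m, n). ?c m n * z ^ m * w ^ n) has_sum z * v) (range ?k)" by blast
  also have "?this \<longleftrightarrow> ((\<lambda>(m, n). ?c m n * z ^ m * w ^ n) has_sum z * v) UNIV"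
    by (rule has_sum_cong_neutral) (auto simp: image_iff split: nat.split)
  finally show ?thesis by (simp add: double_series_def)
qed

lemma sum_case_diff:
  fixes g :: "nat \<Rightarrow> 'a :: comm_semiring_0"
  shows "(\<Sum>i\<le>m. g i * (case m - i of 0 \<Rightarrow> 0 | Suc i \<Rightarrow> h i)) = (\<Sum>i<m. g i * h (m - Suc i))"
proof -
  have "(\<Sum>i\<le>m. g i * (case m - i of 0 \<Rightarrow> 0 | Suc i \<Rightarrow> h i)) =
      (\<Sum>i<m. g i * (case m - i of 0 \<Rightarrow> 0 | Suc i \<Rightarrow> h i))"
    by (simp flip: lessThan_Suc_atMost)
  also have "\<dots> = (\<Sum>i<m. g i * h (m - Suc i))"
    by (intro sum.cong refl) (simp flip: Suc_diff_Suc)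
  finally show ?thesis .
qed

text \<open>The series of \<open>U\<close> have no term of degree 0, which the \<open>case\<close>
  encodes: the coefficient of degree \<open>Suc i\<close> has index \<open>i\<close>. A Cauchy
  product of two such series loses one more index, whence the range i < m at degree
  \<open>Suc m\<close> and the argument \<open>m - Suc i\<close>.\<close>

lemma convolution_left:
  fixes g :: "nat \<Rightarrow> 'a :: comm_semiring_0"
  shows "(\<Sum>i\<le>Suc m. \<Sum>j\<le>Suc n. (if j = 0 then case i of 0 \<Rightarrow> 0 | Suc i \<Rightarrow> g i else 0) *
      (case Suc m - i of 0 \<Rightarrow> 0 | Suc i \<Rightarrow> case Suc n - j of 0 \<Rightarrow> 0 | Suc j \<Rightarrow> t i j)) =
    (\<Sum>i<m. g i * t (m - Suc i) n)"
  unfolding sum_case_diff[of g "\<lambda>i. t i n" m, symmetric]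
  by (simp add: sum.atMost_Suc_shift atMost_0 del: sum.atMost_Suc cong: nat.case_cong)

lemma convolution_right:
  fixes h :: "nat \<Rightarrow> 'a :: comm_semiring_0"
  shows "(\<Sum>i\<le>Suc m. \<Sum>j\<le>Suc n. (case i of 0 \<Rightarrow> 0 | Suc i \<Rightarrow> case j of 0 \<Rightarrow> 0 | Suc j \<Rightarrow> t i j) *
      (if Suc m - i = 0 then case Suc n - j of 0 \<Rightarrow> 0 | Suc j \<Rightarrow> h j else 0)) =
    (\<Sum>j<n. t m j * h (n - Suc j))"
proof -
  have "(\<Sum>i\<le>Suc m. \<Sum>j\<le>Suc n. (case i of 0 \<Rightarrow> 0 | Suc i \<Rightarrow> case j of 0 \<Rightarrow> 0 | Suc j \<Rightarrow> t i j) *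
      (if Suc m - i = 0 then case Suc n - j of 0 \<Rightarrow> 0 | Suc j \<Rightarrow> h j else 0)) =
    (\<Sum>j\<le>Suc n. (case j of 0 \<Rightarrow> 0 | Suc j \<Rightarrow> t m j) * (case Suc n - j of 0 \<Rightarrow> 0 | Suc j \<Rightarrow> h j))"
    by (subst sum.atMost_Suc) simp
  also have "\<dots> = (\<Sum>j<n. t m j * h (n - Suc j))"
    unfolding sum_case_diff[of "t m" h n, symmetric]
    by (simp add: sum.atMost_Suc_shift del: sum.atMost_Suc)
  finally show ?thesis .
qed

lemma convolution_single:
  fixes g :: "nat \<Rightarrow> 'a :: comm_semiring_0"
  shows "(\<Sum>i\<le>Suc m. \<Sum>j\<le>0 :: nat. (if j = 0 then case i of 0 \<Rightarrow> 0 | Suc i \<Rightarrow> g i else 0) *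
      (if 0 - j = 0 then case Suc m - i of 0 \<Rightarrow> 0 | Suc i \<Rightarrow> h i else 0)) =
    (\<Sum>i<m. g i * h (m - Suc i))"
  unfolding sum_case_diff[of g h m, symmetric]
  by (simp add: sum.atMost_Suc_shift atMost_0 del: sum.atMost_Suc cong: nat.case_cong)

lemma (in cstar_algebra) bounded_pairing_zero:
  assumes "closed_subalgebra S" "bounded_pairing S \<beta>"
  shows "y \<in> S \<Longrightarrow> \<beta> 0 y = 0" "\<beta> x 0 = 0"
  using assms(2) closed_subalgebraD(2)[OF assms(1)] scl_zero[of 0]
  unfolding bounded_pairing_def by (metis mult_zero_left)+

section \<open>Equations for means and mixed moments of resolvents\<close>

context semicircular_matrix
begin

lemma bounded_pairing_mult: "bounded_pairing UNIV (\<lambda>x y. \<psi> (x * y))"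
  unfolding bounded_pairing_def
  by (simp add: distrib_left distrib_right psi_add scl_mult_left scl_mult_right psi_scl)
    (meson norm_mult_ineq order_trans psi_bound)

definition mulX :: "complex ^ 'd ^ 'd \<Rightarrow> 'b ^ 'd ^ 'd" where
  "mulX a = emb_mat scl a ** X"

definition res_comp :: "complex ^ 'd ^ 'd \<Rightarrow> complex set" where
  "res_comp a = connected_component_set (resolvent_set (mulX a)) 0"

text \<open>\<open>U a z\<close> is \<open>((z a)\<^sup>-\<^sup>1 - X)\<^sup>-\<^sup>1\<close>, extended to non-invertible \<open>z a\<close>.\<close>

definition U :: "complex ^ 'd ^ 'd \<Rightarrow> complex \<Rightarrow> 'b ^ 'd ^ 'd" where
  "U a z = resolvent (mulX a) z ** emb_mat scl (scale_mat z a)"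

lemma U_entry: "U a z $ p $ q = scl z (\<Sum>k\<in>UNIV. scl (a $ k $ q) (resolvent (mulX a) z $ p $ k))"
  by (simp add: U_def matrix_matrix_mult_def emb_mat_def scale_mat_def scl_mult_right scl_sum_right scl_scl)

lemma X_power_eq: "X_power a n = mat_pow (mulX a) n ** emb_mat scl a"
  by (induction n) (simp_all add: X_power_0 X_power_Suc mulX_def matrix_mul_assoc)

lemma open_res_comp: "open (res_comp a)"
  unfolding res_comp_def by (rule open_connected_component[OF open_resolvent_set])

lemma connected_res_comp: "connected (res_comp a)"
  unfolding res_comp_def by (rule connected_connected_component)

lemma zero_in_res_comp: "0 \<in> res_comp a"
  unfolding res_comp_def by (simp add: resolvent_zero)

lemma res_comp_subset: "res_comp a \<subseteq> resolvent_set (mulX a)"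
  unfolding res_comp_def by (rule connected_component_subset)

lemma mulX_in:
  assumes S: "closed_subalgebra S" and X: "\<And>p q. X $ p $ q \<in> S"
  shows "mulX a $ i $ j \<in> S"
  unfolding mulX_def matrix_matrix_mult_def emb_mat_def
  by (auto simp: scl_one_mult intro!: closed_subalgebra_sum[OF S] closed_subalgebraD(5)[OF S] X)

lemma U_family:
  assumes S: "closed_subalgebra S" and X: "\<And>p q. X $ p $ q \<in> S" and z0: "z0 \<in> res_comp a"
  shows "\<exists>r>0. \<exists>y. \<forall>p q. power_family S (\<lambda>z. U a z $ p $ q) z0 r (y p q)"
proof -
  let ?R = "resolvent (mulX a)"
  have "?R z0 $ i $ j \<in> S" for i j
    using resolvent_in_subalgebra[OF S mulX_in[OF S X]] z0 unfolding res_comp_def by blast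
  then obtain r where r: "r > 0" "\<And>i j. power_family S (\<lambda>z. ?R z $ i $ j) z0 r
      (\<lambda>n. (?R z0 ** mat_pow (mulX a ** ?R z0) n) $ i $ j)"
    using resolvent_power_family[OF subsetD[OF res_comp_subset z0]] S mulX_in[OF S X] by auto
  have fam: "power_family S (\<lambda>z. U a z $ p $ q) z0 r
      (\<lambda>n. (case n of 0 \<Rightarrow> 0 | Suc m \<Rightarrow> \<Sum>k\<in>UNIV. scl (a $ k $ q) ((?R z0 ** mat_pow (mulX a ** ?R z0) m) $ p $ k))
        + scl z0 (\<Sum>k\<in>UNIV. scl (a $ k $ q) ((?R z0 ** mat_pow (mulX a ** ?R z0) n) $ p $ k)))" for p q
    unfolding U_entry
    by (intro power_family_times power_family_sum power_family_scl S r)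
  show ?thesis using r(1) by (intro exI[of _ r] conjI exI allI) (assumption, rule fam)
qed

lemma U_in_subalgebra:
  assumes S: "closed_subalgebra S" and X: "\<And>p q. X $ p $ q \<in> S" and z0: "z0 \<in> res_comp a"
  shows "U a z0 $ p $ q \<in> S"
  unfolding U_entry using resolvent_in_subalgebra[OF S mulX_in[OF S X]] z0
  by (intro closed_subalgebraD(5)[OF S] closed_subalgebra_sum[OF S]) (simp add: res_comp_def)

text \<open>At the base point the coefficients must be explicit, for comparison with the recursion;
  elsewhere \<open>U_family\<close> only asserts that they exist. \<open>U\<close> vanishes at 0,
  hence the shifted index.\<close>

lemma U_family_zero:
  assumes S: "closed_subalgebra S" and X: "\<And>p q. X $ p $ q \<in> S"
  shows "\<exists>r>0. \<forall>p q. power_family S (\<lambda>z. U a z $ p $ q) 0 r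
    (\<lambda>n. case n of 0 \<Rightarrow> 0 | Suc m \<Rightarrow> X_power a m $ p $ q)"
proof -
  let ?R = "resolvent (mulX a)"
  have "?R 0 $ i $ j \<in> S" for i j
    using closed_subalgebraD(1,2)[OF S] by (simp add: resolvent_zero mat_def)
  then obtain r where r: "r > 0" "\<And>i j. power_family S (\<lambda>z. ?R z $ i $ j) 0 r
      (\<lambda>n. (?R 0 ** mat_pow (mulX a ** ?R 0) n) $ i $ j)"
    using resolvent_power_family[OF resolvent_zero(1), of "mulX a"] S mulX_in[OF S X, of a] by auto
  have "power_family S (\<lambda>z. scl (z - 0) (\<Sum>k\<in>UNIV. scl (a $ k $ q) (?R z $ p $ k))) 0 r
      (\<lambda>n. case n of 0 \<Rightarrow> 0 | Suc m \<Rightarrow>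
        \<Sum>k\<in>UNIV. scl (a $ k $ q) ((?R 0 ** mat_pow (mulX a ** ?R 0) m) $ p $ k))" for p q
    by (intro power_family_shift power_family_sum power_family_scl S r)
  moreover have "(\<Sum>k\<in>UNIV. scl (a $ k $ q) ((?R 0 ** mat_pow (mulX a ** ?R 0) m) $ p $ k)) = X_power a m $ p $ q"
    for p q m
    by (simp add: resolvent_zero X_power_eq matrix_matrix_mult_def[of "mat_pow _ _"] emb_mat_def scl_one_mult)
  ultimately show ?thesis
    using r(1) by (intro exI[of _ r]) (simp add: U_entry cong: nat.case_cong)
qed

lemma analytic2_at_psi_U:
  assumes "z0 \<in> res_comp a"
  shows "analytic2_at (\<lambda>z w. \<psi> (U a z $ p $ q)) z0 w0"
proof -
  obtain r y where "power_family UNIV (\<lambda>z. U a z $ p $ q) z0 r (y p q)"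
    using U_family[OF closed_subalgebra_UNIV UNIV_I assms] by blast
  from analytic2_at_pairing[OF closed_subalgebra_UNIV bounded_pairing_mult this
      power_family_const[OF closed_subalgebra_UNIV zero_less_one UNIV_I[of 1], of w0]]
  show ?thesis by simp
qed

lemma psi_U_double_series:
  "\<exists>r>0. \<forall>z\<in>ball 0 r. \<forall>w. \<forall>p q. double_series
     (\<lambda>m n. if n = 0 then case m of 0 \<Rightarrow> 0 | Suc m \<Rightarrow> \<psi> (X_power a m $ p $ q) else 0) z w (\<psi> (U a z $ p $ q))"
proof -
  obtain r where r: "r > 0" "\<And>p q. power_family UNIV (\<lambda>z. U a z $ p $ q) 0 r
    (\<lambda>n. case n of 0 \<Rightarrow> 0 | Suc m \<Rightarrow> X_power a m $ p $ q)"
    using U_family_zero[OF closed_subalgebra_UNIV UNIV_I] by blast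
  have "double_series
     (\<lambda>m n. if n = 0 then case m of 0 \<Rightarrow> 0 | Suc m \<Rightarrow> \<psi> (X_power a m $ p $ q) else 0) z w (\<psi> (U a z $ p $ q))"
    if z: "z \<in> ball 0 r" for z w p q
  proof -
    \<comment> \<open>The second factor is constant, so its radius can be enlarged to reach any
      w.\<close>
    have w: "w \<in> ball 0 (cmod w + 1)" and pos: "cmod w + 1 > 0" by (simp_all add: add_nonneg_pos)
    have eq: "(\<lambda>m n. \<psi> ((case m of 0 \<Rightarrow> 0 | Suc m \<Rightarrow> X_power a m $ p $ q) * (if n = 0 then 1 else 0))) =
        (\<lambda>m n. if n = 0 then case m of 0 \<Rightarrow> 0 | Suc m \<Rightarrow> \<psi> (X_power a m $ p $ q) else 0)"
      by (auto simp: fun_eq_iff split: nat.split)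
    note ds = double_series_pairing[OF closed_subalgebra_UNIV bounded_pairing_mult r(2)[of p q]
      power_family_const[OF closed_subalgebra_UNIV pos UNIV_I[of 1], of 0] z w]
    show ?thesis unfolding eq[symmetric] using ds by (simp only: diff_zero mult_1_right)
  qed
  then show ?thesis using r(1) by blast
qed

text \<open>This is the matrix Dyson equation g = za (1 + eta(g) g), where eta(x) is the mean of X x
  X. Near 0 it is \<open>mean_power_Suc\<close> compared coefficient by coefficient; the identity
  theorem extends it.\<close>

lemma psi_U_equation:
  assumes z: "z \<in> res_comp a"
  shows "\<psi> (U a z $ p $ q) = z * (a $ p $ q + (\<Sum>k\<in>UNIV. \<Sum>l\<in>UNIV. a $ p $ k *
    (\<Sum>c\<in>UNIV. of_real (\<sigma> (k, l) c) * (\<psi> (U a z $ l $ fst c) * \<psi> (U a z $ snd c $ q)))))"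
proof -
  let ?g = "\<lambda>p q z. \<psi> (U a z $ p $ q)"
  let ?rhs = "\<lambda>z. z * (a $ p $ q + (\<Sum>k\<in>UNIV. \<Sum>l\<in>UNIV. a $ p $ k *
    (\<Sum>c\<in>UNIV. of_real (\<sigma> (k, l) c) * (?g l (fst c) z * ?g (snd c) q z))))"
  let ?G = "\<lambda>p q m n :: nat. if n = 0 then case m of 0 \<Rightarrow> 0 | Suc m \<Rightarrow> \<psi> (X_power a m $ p $ q) else 0"
  obtain r where r: "r > 0" "\<And>z w p q. z \<in> ball 0 r \<Longrightarrow> double_series (?G p q) z w (?g p q z)"
    using psi_U_double_series[of a] by blast
  have near: "?g p q z - ?rhs z = 0" if z: "z \<in> ball 0 r" for z
  proof -
    let ?B = "\<lambda>m n. (if m = 0 \<and> n = 0 then a $ p $ q else 0) + (\<Sum>k\<in>UNIV. \<Sum>l\<in>UNIV. a $ p $ k *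
      (\<Sum>c\<in>UNIV. of_real (\<sigma> (k, l) c) *
        (\<Sum>i\<le>m. \<Sum>j\<le>n. ?G l (fst c) i j * ?G (snd c) q (m - i) (n - j))))"
    have "double_series (\<lambda>m n. case m of 0 \<Rightarrow> 0 | Suc m \<Rightarrow> ?B m n) z 0 (?rhs z)"
      by (intro double_series_shift double_series_add double_series_const double_series_sum
          double_series_cmult double_series_mult r z)
    moreover have "(case m of 0 \<Rightarrow> 0 | Suc m \<Rightarrow> ?B m n) = ?G p q m n" for m n
    proof (cases m)
      case (Suc m')
      show ?thesis
      proof (cases n)
        case 0
        show ?thesis
        proof (cases m')
          case 0
          then show ?thesis using Suc \<open>n = 0\<close>
            by (simp add: X_power_0 emb_mat_def psi_scl state_one)
        next
          case (Suc k)
          have "(\<Sum>i\<le>Suc k. \<Sum>j\<le>0. ?G l (fst c) i j * ?G (snd c) q (Suc k - i) (0 - j)) =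
            (\<Sum>i<k. \<psi> (X_power a i $ l $ fst c) * \<psi> (X_power a (k - Suc i) $ snd c $ q))" for l c
            by (rule convolution_single)
          then show ?thesis
            unfolding \<open>m = Suc m'\<close> \<open>n = 0\<close> Suc
            by (simp add: mean_power_Suc sum_distrib_left mult.assoc del: sum.atMost_Suc)
              (intro sum.cong refl sum.swap)
        qed
      qed (auto simp: Suc intro!: sum.neutral split: nat.split)
    qed simp
    ultimately have "double_series (?G p q) z 0 (?rhs z)" by simp
    then show ?thesis using double_series_unique[OF r(2)[OF z]] by simp
  qed
  \<comment> \<open>The second variable is a dummy ranging over the whole plane.\<close>
  have "?g p q z - ?rhs z = 0"
    by (rule analytic2_continuation[of "res_comp a" UNIV "\<lambda>z w. ?g p q z - ?rhs z" r z 0])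
      (use near r z in \<open>auto intro!: analytic2_at_diff analytic2_at_mult analytic2_at_fst analytic2_at_add
        analytic2_at_const analytic2_at_sum analytic2_at_psi_U open_res_comp connected_res_comp zero_in_res_comp\<close>)
  then show ?thesis by simp
qed

text \<open>
  The family \<open>v\<close> stands for the second resolvent, either itself or with reversed words and
  transposed indices; \<open>b\<close> is its coefficient matrix in the first reading.
\<close>

lemma pairing_U_equation:
  fixes v :: "'d \<Rightarrow> 'd \<Rightarrow> complex \<Rightarrow> 'b"
  assumes S: "closed_subalgebra S" and \<beta>: "bounded_pairing S \<beta>"
    and D: "open D" "connected D" "0 \<in> D"
    and fam: "\<And>r s w0. w0 \<in> D \<Longrightarrow> \<exists>\<rho> y. power_family S (v r s) w0 \<rho> y"
    and fam0: "\<rho> > 0" "\<And>r s. power_family S (v r s) 0 \<rho> (\<lambda>n. case n of 0 \<Rightarrow> 0 | Suc m \<Rightarrow> y r s m)"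
    and mom: "\<And>x r s n. \<beta> x (y r s n) = \<psi> (x * X_power b n $ r $ s)"
    and z: "z \<in> res_comp a" and w: "w \<in> D"
  shows "\<beta> (U a z $ p $ q) (v r s w) = z * (a $ p $ q * \<beta> 1 (v r s w) +
    (\<Sum>k\<in>UNIV. \<Sum>l\<in>UNIV. a $ p $ k * (
      (\<Sum>c\<in>UNIV. of_real (\<sigma> (k, l) c) *
        (\<psi> (U a z $ l $ fst c) * \<beta> (U a z $ snd c $ q) (v r s w))) +
      (\<Sum>c\<in>UNIV. of_real (\<sigma> (k, l) c) *
        (\<beta> (U a z $ l $ q) (v r (fst c) w) * \<beta> 1 (v (snd c) s w))))))"
proof -
  let ?g = "\<lambda>p q z. \<psi> (U a z $ p $ q)" and ?h = "\<lambda>r s w. \<beta> 1 (v r s w)"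
  let ?f = "\<lambda>p q r s z w. \<beta> (U a z $ p $ q) (v r s w)"
  let ?rhs = "\<lambda>z w. z * (a $ p $ q * ?h r s w +
    (\<Sum>k\<in>UNIV. \<Sum>l\<in>UNIV. a $ p $ k * (
      (\<Sum>c\<in>UNIV. of_real (\<sigma> (k, l) c) * (?g l (fst c) z * ?f (snd c) q r s z w)) +
      (\<Sum>c\<in>UNIV. of_real (\<sigma> (k, l) c) * (?f l q r (fst c) z w * ?h (snd c) s w)))))"
  let ?G = "\<lambda>p q m n :: nat. if n = 0 then case m of 0 \<Rightarrow> 0 | Suc m \<Rightarrow> \<psi> (X_power a m $ p $ q) else 0"
  let ?H = "\<lambda>r s m n :: nat. if m = 0 then case n of 0 \<Rightarrow> 0 | Suc n \<Rightarrow> \<psi> (X_power b n $ r $ s) else 0"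
  let ?t = "\<lambda>p q r s m n. \<psi> (X_power a m $ p $ q * X_power b n $ r $ s)"
  let ?F = "\<lambda>p q r s m n. case m of 0 \<Rightarrow> 0 | Suc m \<Rightarrow> case n of 0 \<Rightarrow> 0 | Suc n \<Rightarrow> ?t p q r s m n"
  note zero = bounded_pairing_zero[OF S \<beta>]
  have yS: "y r s m \<in> S" for r s m
  proof -
    have "(case Suc m of 0 \<Rightarrow> 0 | Suc m \<Rightarrow> y r s m) \<in> S"
      using fam0(2)[of r s] unfolding power_family_def by blast
    then show ?thesis by simp
  qed
  obtain r1 where r1: "r1 > 0" "\<And>z w p q. z \<in> ball 0 r1 \<Longrightarrow> double_series (?G p q) z w (?g p q z)"
    using psi_U_double_series[of a] by blast
  obtain r2 where r2: "r2 > 0" "\<And>p q. power_family UNIV (\<lambda>z. U a z $ p $ q) 0 r2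
    (\<lambda>n. case n of 0 \<Rightarrow> 0 | Suc m \<Rightarrow> X_power a m $ p $ q)"
    using U_family_zero[OF closed_subalgebra_UNIV UNIV_I] by blast
  define R where "R = min r1 (min r2 \<rho>)"
  have R: "R > 0" using r1 r2 fam0 by (simp add: R_def)
  have dsF: "double_series (?F p q r s) z w (?f p q r s z w)"
    if "z \<in> ball 0 R" "w \<in> ball 0 R" for p q r s z w
  proof -
    have "(\<lambda>m n. \<beta> (case m of 0 \<Rightarrow> 0 | Suc m \<Rightarrow> X_power a m $ p $ q) (case n of 0 \<Rightarrow> 0 | Suc m \<Rightarrow> y r s m))
        = ?F p q r s"
      by (auto simp: fun_eq_iff zero yS mom split: nat.split)
    then show ?thesis
      using double_series_pairing[OF S \<beta> r2(2) fam0(2), of z w p q r s] that by (simp add: R_def)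
  qed
  have dsH: "double_series (?H r s) z w (?h r s w)" if "w \<in> ball 0 R" for r s z w
  proof -
    have z: "z \<in> ball 0 (cmod z + 1)" and pos: "cmod z + 1 > 0" by (simp_all add: add_nonneg_pos)
    have eq: "(\<lambda>m n. \<beta> (if m = 0 then 1 else 0) (case n of 0 \<Rightarrow> 0 | Suc m \<Rightarrow> y r s m)) = ?H r s"
      by (auto simp: fun_eq_iff zero yS mom split: nat.split)
    have w: "w \<in> ball 0 \<rho>" using that by (simp add: R_def)
    note ds = double_series_pairing[OF S \<beta> power_family_const[OF closed_subalgebra_UNIV pos UNIV_I[of 1], of 0]
        fam0(2)[of r s] z w]
    show ?thesis unfolding eq[symmetric] using ds by (simp only: diff_zero)
  qed
  have anF: "analytic2_at (?f p q r s) z w" if zw: "z \<in> res_comp a" "w \<in> D" for p q r s z w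
  proof -
    obtain r' y' where "power_family UNIV (\<lambda>z. U a z $ p $ q) z r' (y' p q)"
      using U_family[OF closed_subalgebra_UNIV UNIV_I zw(1)] by blast
    moreover obtain \<rho>' y'' where "power_family S (v r s) w \<rho>' y''" using fam[OF zw(2)] by blast
    ultimately show ?thesis by (rule analytic2_at_pairing[OF S \<beta>])
  qed
  have anH: "analytic2_at (\<lambda>z w. ?h r s w) z w" if w: "w \<in> D" for r s z w
  proof -
    obtain \<rho>' y'' where "power_family S (v r s) w \<rho>' y''" using fam[OF w] by blast
    from analytic2_at_pairing[OF S \<beta> power_family_const[OF closed_subalgebra_UNIV zero_less_one UNIV_I[of 1], of z] this]
    show ?thesis by simp
  qed
  have near: "?f p q r s z w - ?rhs z w = 0" if zw: "z \<in> ball 0 R" "w \<in> ball 0 R" for z w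
  proof -
    have z1: "z \<in> ball 0 r1" using zw by (simp add: R_def)
    let ?B = "\<lambda>m n. a $ p $ q * ?H r s m n + (\<Sum>k\<in>UNIV. \<Sum>l\<in>UNIV. a $ p $ k * (
      (\<Sum>c\<in>UNIV. of_real (\<sigma> (k, l) c) *
        (\<Sum>i\<le>m. \<Sum>j\<le>n. ?G l (fst c) i j * ?F (snd c) q r s (m - i) (n - j))) +
      (\<Sum>c\<in>UNIV. of_real (\<sigma> (k, l) c) *
        (\<Sum>i\<le>m. \<Sum>j\<le>n. ?F l q r (fst c) i j * ?H (snd c) s (m - i) (n - j)))))"
    have "double_series (\<lambda>m n. case m of 0 \<Rightarrow> 0 | Suc m \<Rightarrow> ?B m n) z w (?rhs z w)"
      by (intro double_series_shift double_series_add double_series_sum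
          double_series_cmult double_series_mult r1(2) dsF dsH z1 zw)
    \<comment> \<open>Degree 1 in z is the contribution of the matrix a alone
      (\<open>moment_power_0\<close>), higher degrees are \<open>moment_power_Suc\<close>, and both
      sides vanish when m or n is 0.\<close>
    moreover have "(case m of 0 \<Rightarrow> 0 | Suc m \<Rightarrow> ?B m n) = ?F p q r s m n" for m n
    proof (cases m)
      case (Suc m')
      show ?thesis
      proof (cases n)
        case 0
        show ?thesis
        proof -
          have A: "(\<Sum>i\<le>m'. \<Sum>j\<le>0. ?G l (fst c) i j * ?F (snd c) q r s (m' - i) (0 - j)) = 0" for l c
            by (auto intro!: sum.neutral split: nat.split)
          have B: "(\<Sum>i\<le>m'. \<Sum>j\<le>0. ?F l q r (fst c) i j * ?H (snd c) s (m' - i) (0 - j)) = 0" for l c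
            by (auto intro!: sum.neutral split: nat.split)
          show ?thesis unfolding Suc 0 nat.case A B by simp
        qed
      next
        case (Suc n')
        show ?thesis
        proof (cases m')
          case 0
          show ?thesis
          proof -
            have A: "(\<Sum>i\<le>0. \<Sum>j\<le>Suc n'. ?G l (fst c) i j * ?F (snd c) q r s (0 - i) (Suc n' - j)) = 0" for l c
              by (auto intro!: sum.neutral)
            have B: "(\<Sum>i\<le>0. \<Sum>j\<le>Suc n'. ?F l q r (fst c) i j * ?H (snd c) s (0 - i) (Suc n' - j)) = 0" for l c
              by (auto intro!: sum.neutral)
            show ?thesis unfolding \<open>m = Suc m'\<close> Suc 0 nat.case A B by (simp add: moment_power_0)
          qed
        next
          case (Suc k)
          have A: "(\<Sum>i\<le>Suc k. \<Sum>j\<le>Suc n'. ?G l (fst c) i j * ?F (snd c) q r s (Suc k - i) (Suc n' - j)) =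
            (\<Sum>i<k. \<psi> (X_power a i $ l $ fst c) * ?t (snd c) q r s (k - Suc i) n')" for l c
            by (rule convolution_left)
          have B: "(\<Sum>i\<le>Suc k. \<Sum>j\<le>Suc n'. ?F l q r (fst c) i j * ?H (snd c) s (Suc k - i) (Suc n' - j)) =
            (\<Sum>j<n'. ?t l q r (fst c) k j * \<psi> (X_power b (n' - Suc j) $ snd c $ s))" for l c
            by (rule convolution_right)
          have "?F p q r s (Suc (Suc k)) (Suc n') = (\<Sum>k'\<in>UNIV. \<Sum>l\<in>UNIV. a $ p $ k' * (
            (\<Sum>c\<in>UNIV. of_real (\<sigma> (k', l) c) *
               (\<Sum>i<k. \<psi> (X_power a i $ l $ fst c) * ?t (snd c) q r s (k - Suc i) n')) +
            (\<Sum>c\<in>UNIV. of_real (\<sigma> (k', l) c) *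
               (\<Sum>j<n'. ?t l q r (fst c) k j * \<psi> (X_power b (n' - Suc j) $ snd c $ s)))))"
            by (simp only: nat.case moment_power_Suc sum_distrib_left mult.assoc
                sum.swap[where B = "{..<k}"] sum.swap[where B = "{..<n'}"])
          then show ?thesis
            unfolding \<open>m = Suc m'\<close> \<open>n = Suc n'\<close> Suc nat.case(2) A B by simp
        qed
      qed
    qed simp
    ultimately have "double_series (?F p q r s) z w (?rhs z w)" by simp
    then show ?thesis using double_series_unique[OF dsF[OF zw]] by simp
  qed
  have "?f p q r s z w - ?rhs z w = 0"
    by (rule analytic2_continuation[of "res_comp a" D "\<lambda>z w. ?f p q r s z w - ?rhs z w" R z w])
      (use near R z w D in \<open>auto intro!: analytic2_at_diff analytic2_at_mult analytic2_at_fst analytic2_at_add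
        analytic2_at_const analytic2_at_sum analytic2_at_psi_U anF anH open_res_comp connected_res_comp zero_in_res_comp\<close>)
  then show ?thesis by simp
qed

end

section \<open>Matrix algebra of the covariance equation\<close>

lemma matrix_add_rdistrib: "(A + B) ** C = A ** C + B ** (C :: 'a :: semiring_1 ^ 'n ^ 'm)"
  by (simp add: matrix_matrix_mult_def vec_eq_iff distrib_right sum.distrib)

lemma kron_nth: "(A \<otimes>\<^sub>K B) $ x $ y = A $ fst x $ fst y * B $ snd x $ snd y"
  by (simp add: kron_def mk_sqmat_def)

lemma cov_mat_nth: "cov_mat \<sigma> $ x $ y = of_real (\<sigma> (fst x, fst y) (snd x, snd y))"
  by (simp add: cov_mat_def mk_sqmat_def)

lemma denom_inverse:
  assumes "T = g \<otimes>\<^sub>K h + (g \<otimes>\<^sub>K h) ** cov_mat \<sigma> ** T"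
  shows "invertible (denom \<sigma> g h)" "GD_of \<sigma> g h = T"
    "H_of \<sigma> g h = cov_mat \<sigma> + cov_mat \<sigma> ** T ** cov_mat \<sigma>"
proof -
  let ?L = "g \<otimes>\<^sub>K h" and ?S = "cov_mat \<sigma>"
  have "denom \<sigma> g h ** (mat 1 + ?S ** T) = mat 1 + ?S ** T - ?S ** (?L + ?L ** ?S ** T)"
    by (simp add: denom_def matrix_diff_rdistrib matrix_add_ldistrib matrix_mul_assoc)
  also have "\<dots> = mat 1" by (simp flip: assms)
  finally have inv: "denom \<sigma> g h ** (mat 1 + ?S ** T) = mat 1" .
  \<comment> \<open>A one-sided inverse of a square complex matrix is two-sided.\<close>
  then have inv': "(mat 1 + ?S ** T) ** denom \<sigma> g h = mat 1"
    by (simp add: matrix_left_right_inverse)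
  show "invertible (denom \<sigma> g h)" using inv inv' unfolding invertible_def by blast
  have mi: "matrix_inv (denom \<sigma> g h) = mat 1 + ?S ** T" by (rule matrix_inv_unique[OF inv inv'])
  show "GD_of \<sigma> g h = T"
    unfolding GD_of_def mi by (subst (2) assms) (simp add: matrix_add_ldistrib matrix_mul_assoc)
  show "H_of \<sigma> g h = ?S + ?S ** T ** ?S"
    unfolding H_of_def mi
    by (simp add: matrix_matrix_mult_def vec_eq_iff distrib_right sum.distrib)
      (simp add: mat_def if_distrib[of "\<lambda>x. x * _"] sum.delta cong: if_cong)
qed

text \<open>
  With \<open>\<eta>(c) = E(X c X)\<close> the hypotheses read \<open>g = \<alpha> + \<alpha> \<eta>(g) g\<close> and
  \<open>t = \<alpha> c h\<^sup>T + \<alpha> \<eta>(g) t + \<alpha> \<eta>(t) h\<^sup>T\<close>, where \<open>\<alpha> = z a\<close> and \<open>c\<close> is a matrix unit; since \<open>\<alpha>\<close> is invertible for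
  \<open>z \<noteq> 0\<close>, they give \<open>t = g c h\<^sup>T + g \<eta>(t) h\<^sup>T\<close>.
\<close>

lemma linearized_equation:
  fixes a g h :: "complex ^ 'd :: finite ^ 'd" and T :: "'d sqmat"
  assumes a: "invertible a" and swap: "\<And>p q r s. \<sigma> (p, q) (r, s) = \<sigma> (p, q) (s, r)"
    and g: "\<And>p q. g $ p $ q = z * (a $ p $ q + (\<Sum>k\<in>UNIV. \<Sum>l\<in>UNIV. a $ p $ k *
      (\<Sum>c\<in>UNIV. of_real (\<sigma> (k, l) c) * (g $ l $ fst c * g $ snd c $ q))))"
    and T: "\<And>p q r s. T $ (p, s) $ (q, r) = z * (a $ p $ q * h $ s $ r +
      (\<Sum>k\<in>UNIV. \<Sum>l\<in>UNIV. a $ p $ k * (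
        (\<Sum>c\<in>UNIV. of_real (\<sigma> (k, l) c) * (g $ l $ fst c * T $ (snd c, s) $ (q, r))) +
        (\<Sum>c\<in>UNIV. of_real (\<sigma> (k, l) c) * (T $ (l, fst c) $ (q, r) * h $ s $ snd c)))))"
  shows "T = g \<otimes>\<^sub>K h + (g \<otimes>\<^sub>K h) ** cov_mat \<sigma> ** T"
proof (cases "z = 0")
  case True
  then have "g = 0" "T = 0" using g T by (simp_all add: vec_eq_iff)
  moreover from this have "g \<otimes>\<^sub>K h = 0" by (simp add: vec_eq_iff kron_nth)
  ultimately show ?thesis by (simp add: matrix_matrix_mult_def zero_vec_def)
next
  case False
  define eta :: "complex ^ 'd ^ 'd \<Rightarrow> complex ^ 'd ^ 'd" where
    "eta x = (\<chi> k m. \<Sum>l\<in>UNIV. \<Sum>n\<in>UNIV. of_real (\<sigma> (k, l) (n, m)) * x $ l $ n)" for x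
  have conv: "(\<Sum>k\<in>UNIV. \<Sum>l\<in>UNIV. a $ p $ k *
      (\<Sum>c\<in>UNIV. of_real (\<sigma> (k, l) c) * (x $ l $ fst c * y $ snd c $ q)))
      = (a ** (eta x ** y)) $ p $ q" for x y :: "complex ^ 'd ^ 'd" and p q
  proof -
    have "(\<Sum>l\<in>UNIV. \<Sum>n\<in>UNIV. \<Sum>m\<in>UNIV. of_real (\<sigma> (k, l) (n, m)) * (x $ l $ n * y $ m $ q))
        = (\<Sum>m\<in>UNIV. \<Sum>l\<in>UNIV. \<Sum>n\<in>UNIV. of_real (\<sigma> (k, l) (n, m)) * (x $ l $ n * y $ m $ q))" for k
    proof -
      have "(\<Sum>l\<in>UNIV. \<Sum>n\<in>UNIV. \<Sum>m\<in>UNIV. of_real (\<sigma> (k, l) (n, m)) * (x $ l $ n * y $ m $ q))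
          = (\<Sum>l\<in>UNIV. \<Sum>m\<in>UNIV. \<Sum>n\<in>UNIV. of_real (\<sigma> (k, l) (n, m)) * (x $ l $ n * y $ m $ q))"
        by (intro sum.cong refl sum.swap)
      also have "\<dots> = (\<Sum>m\<in>UNIV. \<Sum>l\<in>UNIV. \<Sum>n\<in>UNIV. of_real (\<sigma> (k, l) (n, m)) * (x $ l $ n * y $ m $ q))"
        by (rule sum.swap)
      finally show ?thesis .
    qed
    then show ?thesis
      by (simp add: matrix_matrix_mult_def eta_def sum_UNIV_prod sum_distrib_right mult.assoc
          flip: sum_distrib_left)
  qed
  have ga: "g = scale_mat z (a + a ** (eta g ** g))"
    using g by (simp add: vec_eq_iff scale_mat_def conv)
  obtain a' where a': "a ** a' = mat 1" "a' ** a = mat 1" using a unfolding invertible_def by blast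
  \<comment> \<open>By the Dyson equation this is the inverse of \<open>g\<close>. Multiplication by
    it absorbs the term with \<open>eta g\<close> in the equation for \<open>t\<close>.\<close>
  define N where "N = scale_mat (1 / z) a' - eta g"
  have scale: "scale_mat u x ** y = scale_mat u (x ** y)" "x ** scale_mat u y = scale_mat u (x ** y)"
    "scale_mat u (scale_mat v x) = scale_mat (u * v) x"
    for u v and x y :: "complex ^ 'd ^ 'd"
    by (simp_all add: scale_mat_def matrix_matrix_mult_def vec_eq_iff sum_distrib_left mult_ac)
  have cancel: "scale_mat (1 / z) a' ** scale_mat z (a ** x) = x" for x
    using False by (simp add: scale matrix_mul_assoc a') (simp add: scale_mat_def vec_eq_iff)
  have "N ** g = mat 1"
  proof -
    have "scale_mat (1 / z) a' ** g = mat 1 + eta g ** g"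
      using cancel[of "mat 1 + eta g ** g"] ga by (simp add: matrix_add_ldistrib)
    then show ?thesis by (simp add: N_def matrix_diff_rdistrib)
  qed
  then have gN: "g ** N = mat 1" by (simp add: matrix_left_right_inverse)
  show ?thesis
  proof -
    have "T $ (p, s) $ (q, r) = (g \<otimes>\<^sub>K h + (g \<otimes>\<^sub>K h) ** cov_mat \<sigma> ** T) $ (p, s) $ (q, r)" for p s q r
    proof -
      define t :: "complex ^ 'd ^ 'd" where "t = (\<chi> p s. T $ (p, s) $ (q, r))"
      \<comment> \<open>\<open>e\<close> is c h^T for the matrix unit c at position (q, r);
        \<open>t\<close> collects the entries of \<open>T\<close> in the column (q, r).\<close>
      define e :: "complex ^ 'd ^ 'd" where "e = (\<chi> p s. if p = q then h $ s $ r else 0)"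
      have ae: "(a ** e) $ p $ s = a $ p $ q * h $ s $ r" for p s
        by (simp add: matrix_matrix_mult_def e_def if_distrib cong: if_cong)
      have "t $ p $ s = scale_mat z (a ** (e + eta g ** t + eta t ** transpose h)) $ p $ s" for p s
      proof -
        have "t $ p $ s = z * (a $ p $ q * h $ s $ r +
          ((\<Sum>k\<in>UNIV. \<Sum>l\<in>UNIV. a $ p $ k *
            (\<Sum>c\<in>UNIV. of_real (\<sigma> (k, l) c) * (g $ l $ fst c * t $ snd c $ s))) +
          (\<Sum>k\<in>UNIV. \<Sum>l\<in>UNIV. a $ p $ k *
            (\<Sum>c\<in>UNIV. of_real (\<sigma> (k, l) c) * (t $ l $ fst c * transpose h $ snd c $ s)))))"
          using T[of p s q r] by (simp add: t_def transpose_def distrib_left sum.distrib)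
        also have "\<dots> = scale_mat z (a ** (e + eta g ** t + eta t ** transpose h)) $ p $ s"
          unfolding conv by (simp add: scale_mat_def matrix_add_ldistrib ae)
        finally show ?thesis .
      qed
      then have "t = scale_mat z (a ** (e + eta g ** t + eta t ** transpose h))"
        by (simp add: vec_eq_iff)
      then have "scale_mat (1 / z) a' ** t = e + eta g ** t + eta t ** transpose h"
        using cancel by metis
      then have "N ** t = e + eta t ** transpose h"
        by (simp add: N_def matrix_diff_rdistrib)
      then have "g ** (e + eta t ** transpose h) = t"
        using gN by (metis matrix_mul_assoc matrix_mul_lid)
      then have "T $ (p, s) $ (q, r) = (g ** e) $ p $ s + (g ** (eta t ** transpose h)) $ p $ s"
        by (simp add: t_def matrix_add_ldistrib vec_eq_iff)
      also have "(g ** e) $ p $ s = (g \<otimes>\<^sub>K h) $ (p, s) $ (q, r)"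
        by (simp add: matrix_matrix_mult_def e_def kron_nth if_distrib cong: if_cong)
      \<comment> \<open>\<open>eta\<close> carries the second index pair of the covariance in the
        order (n, m), the product with \<open>cov_mat\<close> in the order (m, n);
        \<open>swap\<close> reconciles them.\<close>
      also have "(g ** (eta t ** transpose h)) $ p $ s = (\<Sum>k\<in>UNIV. \<Sum>m\<in>UNIV. \<Sum>l\<in>UNIV. \<Sum>n\<in>UNIV.
          g $ p $ k * h $ s $ m * of_real (\<sigma> (k, l) (m, n)) * T $ (l, n) $ (q, r))"
        unfolding matrix_matrix_mult_def eta_def transpose_def t_def vec_lambda_beta
          sum_distrib_left sum_distrib_right
        by (intro sum.cong refl) (simp add: mult_ac swap)
      also have "\<dots> = ((g \<otimes>\<^sub>K h) ** (cov_mat \<sigma> ** T)) $ (p, s) $ (q, r)"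
        unfolding matrix_matrix_mult_def vec_lambda_beta kron_nth cov_mat_nth sum_UNIV_prod
          sum_distrib_left fst_conv snd_conv mult.assoc ..
      finally show ?thesis by (simp add: matrix_mul_assoc)
    qed
    then show ?thesis by (simp add: vec_eq_iff split_paired_all)
  qed
qed

section \<open>Moment matrices and the transposed resolvent\<close>

context semicircular_matrix
begin

lemma X_power_Suc2: "X_power a (Suc n) = X_power a n ** X ** emb_mat scl a"
proof -
  have "mat_pow (mulX a) (Suc n) = mat_pow (mulX a) n ** emb_mat scl a ** X"
    unfolding mat_pow_Suc2 by (simp add: mulX_def matrix_mul_assoc)
  then show ?thesis by (simp add: X_power_eq del: mat_pow.simps)
qed

text \<open>As \<open>X\<close> is symmetric, reversing words and transposing positions together
  turn (bX)^n b into the same expression for the transpose of b.\<close>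

lemma reversal_X_power: "reversal (X_power b n $ s $ r) (X_power (transpose b) n $ r $ s)"
proof (induction n arbitrary: s r)
  case 0
  show ?case by (simp add: X_power_0 emb_mat_def transpose_def reversal_scl_one)
next
  case (Suc n)
  have l: "X_power b (Suc n) $ s $ r =
      (\<Sum>l\<in>UNIV. \<Sum>k\<in>UNIV. scl (b $ s $ k) 1 * X $ k $ l * X_power b n $ l $ r)"
    by (simp add: X_power_Suc matrix_matrix_mult_def emb_mat_def sum_distrib_right)
  have r: "X_power (transpose b) (Suc n) $ r $ s =
      (\<Sum>k\<in>UNIV. \<Sum>l\<in>UNIV. X_power (transpose b) n $ r $ l * (X $ l $ k * scl (b $ s $ k) 1))"
    by (simp add: X_power_Suc2 matrix_matrix_mult_def emb_mat_def sum_distrib_right transpose_def mult.assoc)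
  have "reversal (\<Sum>l\<in>UNIV. \<Sum>k\<in>UNIV. scl (b $ s $ k) 1 * X $ k $ l * X_power b n $ l $ r)
      (\<Sum>l\<in>UNIV. \<Sum>k\<in>UNIV. X_power (transpose b) n $ r $ l * (X $ k $ l * scl (b $ s $ k) 1))"
    by (intro reversal_sum reversal_mult reversal_X reversal_scl_one Suc)
  then show ?case
    unfolding l r by (subst (asm) (2) sum.swap) (simp add: X_sym)
qed

definition G_mat :: "complex ^ 'd ^ 'd \<Rightarrow> complex \<Rightarrow> complex ^ 'd ^ 'd" where
  "G_mat a z = (\<chi> p q. \<psi> (U a z $ p $ q))"

text \<open>Row (p, s) and column (q, r) hold the mean of U_pq U_rs. The second factor is transposed
  so that the leading term is the tensor product of the mean with its transpose, as the argument
  (za)^(-T) demands.\<close>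

definition T_self :: "complex ^ 'd ^ 'd \<Rightarrow> complex \<Rightarrow> 'd sqmat" where
  "T_self a z = (\<chi> x y. \<psi> (U a z $ fst x $ fst y * U a z $ snd y $ snd x))"

text \<open>Same index pattern: the reversal of entry (s, r) of \<open>U b w\<close> stands for
  entry (r, s) of the resolvent built from the transpose of b, which need not exist. The leading
  term is the product of the two means, untransposed.\<close>

definition T_cross :: "complex ^ 'd ^ 'd \<Rightarrow> complex ^ 'd ^ 'd \<Rightarrow> complex \<Rightarrow> complex \<Rightarrow> 'd sqmat" where
  "T_cross a b z w = (\<chi> x y. rev_pairing (U a z $ fst x $ fst y) (U b w $ snd x $ snd y))"

lemma G_mat_equation:
  assumes "z \<in> res_comp a"
  shows "G_mat a z $ p $ q = z * (a $ p $ q + (\<Sum>k\<in>UNIV. \<Sum>l\<in>UNIV. a $ p $ k *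
      (\<Sum>c\<in>UNIV. of_real (\<sigma> (k, l) c) * (G_mat a z $ l $ fst c * G_mat a z $ snd c $ q))))"
  using psi_U_equation[OF assms, of p q] by (simp add: G_mat_def)

text \<open>The recursion is proved for two independent variables and ordinary multiplication as
  pairing, and the variables are set equal afterwards.\<close>

lemma T_self_equation:
  assumes a: "invertible a" and z: "z \<in> res_comp a"
  defines "L \<equiv> G_mat a z \<otimes>\<^sub>K transpose (G_mat a z)"
  shows "T_self a z = L + L ** cov_mat \<sigma> ** T_self a z"
  unfolding L_def
proof (rule linearized_equation[where \<sigma> = \<sigma>, OF a cov_swap G_mat_equation[OF z]])
  obtain \<rho> where \<rho>: "\<rho> > 0" "\<And>r s. power_family UNIV (\<lambda>z. U a z $ r $ s) 0 \<rho>
      (\<lambda>n. case n of 0 \<Rightarrow> 0 | Suc m \<Rightarrow> X_power a m $ r $ s)"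
    using U_family_zero[OF closed_subalgebra_UNIV UNIV_I] by blast
  have fam: "\<exists>\<rho> y. power_family UNIV (\<lambda>w. U a w $ r $ s) w0 \<rho> y" if "w0 \<in> res_comp a" for r s w0
    using U_family[OF closed_subalgebra_UNIV UNIV_I that] by blast
  show "T_self a z $ (p, s) $ (q, r) = z * (a $ p $ q * transpose (G_mat a z) $ s $ r +
      (\<Sum>k\<in>UNIV. \<Sum>l\<in>UNIV. a $ p $ k * (
        (\<Sum>c\<in>UNIV. of_real (\<sigma> (k, l) c) * (G_mat a z $ l $ fst c * T_self a z $ (snd c, s) $ (q, r))) +
        (\<Sum>c\<in>UNIV. of_real (\<sigma> (k, l) c) * (T_self a z $ (l, fst c) $ (q, r) * transpose (G_mat a z) $ s $ snd c)))))"
    for p q r s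
    using pairing_U_equation[OF closed_subalgebra_UNIV bounded_pairing_mult open_res_comp
        connected_res_comp zero_in_res_comp fam \<rho> refl z z,
        where p = p and q = q and r = r and s = s]
    by (simp add: G_mat_def T_self_def transpose_def)
qed

lemma T_cross_equation:
  assumes a: "invertible a" and z: "z \<in> res_comp a" and w: "w \<in> res_comp b"
  defines "L \<equiv> G_mat a z \<otimes>\<^sub>K G_mat b w"
  shows "T_cross a b z w = L + L ** cov_mat \<sigma> ** T_cross a b z w"
  unfolding L_def
proof (rule linearized_equation[where \<sigma> = \<sigma>, OF a cov_swap G_mat_equation[OF z]])
  note S = closed_subalgebra_word_algebra
  obtain \<rho> where \<rho>: "\<rho> > 0" "\<And>r s. power_family word_algebra (\<lambda>z. U b z $ r $ s) 0 \<rho>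
      (\<lambda>n. case n of 0 \<Rightarrow> 0 | Suc m \<Rightarrow> X_power b m $ r $ s)"
    using U_family_zero[OF S X_in_word_algebra] by blast
  have fam: "\<exists>\<rho> y. power_family word_algebra (\<lambda>w. U b w $ s $ r) w0 \<rho> y" if "w0 \<in> res_comp b" for r s w0
    using U_family[OF S X_in_word_algebra that] by blast
  \<comment> \<open>\<open>pairing_U_equation\<close> is used with interchanged indices and
    \<open>transpose b\<close> as coefficient matrix; reversal makes the moments match.\<close>
  have mom: "rev_pairing x (X_power b n $ s $ r) = \<psi> (x * X_power (transpose b) n $ r $ s)" for x n r s
    by (rule rev_pairing_reversal[OF reversal_X_power])
  have one: "rev_pairing 1 (U b w $ s $ r) = \<psi> (U b w $ s $ r)" for s r
    by (rule rev_pairing_one[OF U_in_subalgebra[OF S X_in_word_algebra w]])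
  show "T_cross a b z w $ (p, s) $ (q, r) = z * (a $ p $ q * G_mat b w $ s $ r +
      (\<Sum>k\<in>UNIV. \<Sum>l\<in>UNIV. a $ p $ k * (
        (\<Sum>c\<in>UNIV. of_real (\<sigma> (k, l) c) * (G_mat a z $ l $ fst c * T_cross a b z w $ (snd c, s) $ (q, r))) +
        (\<Sum>c\<in>UNIV. of_real (\<sigma> (k, l) c) * (T_cross a b z w $ (l, fst c) $ (q, r) * G_mat b w $ s $ snd c)))))"
    for p q r s
    using pairing_U_equation[where v = "\<lambda>r s w. U b w $ s $ r", OF S bounded_pairing_rev_pairing open_res_comp
        connected_res_comp zero_in_res_comp fam \<rho>(1) \<rho>(2) mom z w,
        where p = p and q = q and r = r and s = s]
    by (simp add: G_mat_def T_cross_def one)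
qed

lemma resolvent_arg_eq: "resolvent_arg scl X (scale_mat z a) = mat 1 - scl_mat z (mulX a)"
proof -
  have "emb_mat scl (scale_mat z a) = scl_mat z (emb_mat scl a)"
    by (simp add: emb_mat_def scale_mat_def scl_mat_def vec_eq_iff scl_scl)
  then show ?thesis by (simp add: resolvent_arg_def mulX_def scl_mat_mult)
qed

lemma resolvent_set_iff:
  "z \<in> resolvent_set (mulX a) \<longleftrightarrow> invertible (resolvent_arg scl X (scale_mat z a))"
  by (simp add: resolvent_set_def resolvent_arg_eq)

lemma G_inv_scale: "G_inv scl \<psi> X (scale_mat z a) = G_mat a z"
  unfolding G_inv_def resolvent_arg_eq
  by (simp add: id_tensor_def matrix_matrix_mult_def G_mat_def U_entry resolvent_def scale_mat_def
      vec_eq_iff psi_scl psi_sum sum_distrib_left mult_ac)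

lemma U_fixed_point:
  assumes z: "z \<in> res_comp a"
  defines "\<alpha> \<equiv> emb_mat scl (scale_mat z a)"
  shows "U a z = \<alpha> + U a z ** X ** \<alpha>" "U a z = \<alpha> + \<alpha> ** X ** U a z"
proof -
  let ?R = "resolvent (mulX a) z"
  have \<alpha>X: "scl_mat z (mulX a) = \<alpha> ** X"
    by (simp add: \<alpha>_def mulX_def emb_mat_def scale_mat_def scl_mat_def matrix_matrix_mult_def
        vec_eq_iff scl_sum_right scl_one_mult scl_scl)
  have "?R - ?R ** (\<alpha> ** X) = mat 1" "?R - \<alpha> ** X ** ?R = mat 1"
    using resolvent_inverse[OF subsetD[OF res_comp_subset z]]
    by (simp_all add: matrix_diff_ldistrib matrix_diff_rdistrib \<alpha>X)
  then have "?R = mat 1 + ?R ** (\<alpha> ** X)" "?R = mat 1 + \<alpha> ** X ** ?R"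
    by (simp_all add: diff_eq_eq)
  then have 1: "?R ** \<alpha> = (mat 1 + ?R ** (\<alpha> ** X)) ** \<alpha>" and 2: "?R ** \<alpha> = (mat 1 + \<alpha> ** X ** ?R) ** \<alpha>"
    by simp_all
  show "U a z = \<alpha> + U a z ** X ** \<alpha>"
    unfolding U_def \<alpha>_def[symmetric] using 1 by (simp add: matrix_add_rdistrib matrix_mul_assoc)
  show "U a z = \<alpha> + \<alpha> ** X ** U a z"
    unfolding U_def \<alpha>_def[symmetric]
    by (rule trans[OF 2]) (simp only: matrix_add_rdistrib matrix_mul_assoc matrix_mul_lid)
qed

text \<open>
  In the faithful case reversal extends to the closure, and the reversed entries of
  \<open>U a z\<close> provide the transposed resolvent.
\<close>

lemma transpose_resolvent_invertible:
  assumes faithful: "faithful_state star \<psi>" and z: "z \<in> res_comp a"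
  shows "invertible (resolvent_arg scl X (transpose (scale_mat z a)))"
proof -
  define \<alpha> where "\<alpha> = scale_mat z a"
  have "\<exists>y. closure_reversal (U a z $ r $ s) y" for r s
    using closure_reversal_exists[OF faithful
        U_in_subalgebra[OF closed_subalgebra_word_algebra X_in_word_algebra z]] by blast
  then obtain y where y: "\<And>r s. closure_reversal (U a z $ r $ s) (y r s)" by metis
  \<comment> \<open>Candidate for the transposed counterpart of \<open>U a z\<close>: reversed
    entries at transposed positions, so that reversing products matches transposing matrix
    products.\<close>
  define W :: "'b ^ 'd ^ 'd" where "W = (\<chi> s r. y r s)"
  let ?A = "emb_mat scl (transpose \<alpha>)"
  have u1: "U a z $ r $ s = scl (\<alpha> $ r $ s) 1 + (\<Sum>l\<in>UNIV. \<Sum>k\<in>UNIV. U a z $ r $ k * X $ k $ l * scl (\<alpha> $ l $ s) 1)" for r s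
    by (subst U_fixed_point(1)[OF z]) (simp add: \<alpha>_def emb_mat_def matrix_matrix_mult_def sum_distrib_right)
  have u2: "U a z $ r $ s = scl (\<alpha> $ r $ s) 1 + (\<Sum>l\<in>UNIV. \<Sum>k\<in>UNIV. scl (\<alpha> $ r $ k) 1 * X $ k $ l * U a z $ l $ s)" for r s
    by (subst U_fixed_point(2)[OF z]) (simp add: \<alpha>_def emb_mat_def matrix_matrix_mult_def sum_distrib_right)
  have cX: "closure_reversal (X $ p $ q) (X $ p $ q)" for p q by (rule closure_reversal_refl[OF reversal_X])
  have cS: "closure_reversal (scl c 1) (scl c 1)" for c by (rule closure_reversal_refl[OF reversal_scl_one])
  have y1: "y r s = scl (\<alpha> $ r $ s) 1 + (\<Sum>l\<in>UNIV. \<Sum>k\<in>UNIV. scl (\<alpha> $ l $ s) 1 * (X $ k $ l * y r k))" for r s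
  proof (rule closure_reversal_unique[OF faithful y])
    show "closure_reversal (U a z $ r $ s)
        (scl (\<alpha> $ r $ s) 1 + (\<Sum>l\<in>UNIV. \<Sum>k\<in>UNIV. scl (\<alpha> $ l $ s) 1 * (X $ k $ l * y r k)))"
      by (subst u1) (intro closure_reversal_add closure_reversal_sum closure_reversal_mult cX cS y)
  qed
  have y2: "y r s = scl (\<alpha> $ r $ s) 1 + (\<Sum>l\<in>UNIV. \<Sum>k\<in>UNIV. y l s * (X $ k $ l * scl (\<alpha> $ r $ k) 1))" for r s
  proof (rule closure_reversal_unique[OF faithful y])
    show "closure_reversal (U a z $ r $ s)
        (scl (\<alpha> $ r $ s) 1 + (\<Sum>l\<in>UNIV. \<Sum>k\<in>UNIV. y l s * (X $ k $ l * scl (\<alpha> $ r $ k) 1)))"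
      by (subst u2) (intro closure_reversal_add closure_reversal_sum closure_reversal_mult cX cS y)
  qed
  have "W = ?A + ?A ** (X ** W)"
    unfolding vec_eq_iff
  proof (intro allI)
    fix s r
    show "W $ s $ r = (?A + ?A ** (X ** W)) $ s $ r"
      using y1[of r s]
      by (simp add: W_def emb_mat_def transpose_def matrix_matrix_mult_def sum_distrib_left X_sym)
  qed
  moreover have "W = ?A + W ** X ** ?A"
    unfolding vec_eq_iff
  proof (intro allI)
    fix s r
    have "(W ** X ** ?A) $ s $ r = (\<Sum>k\<in>UNIV. \<Sum>l\<in>UNIV. y l s * (X $ l $ k * scl (\<alpha> $ r $ k) 1))"
      by (simp add: W_def emb_mat_def transpose_def matrix_matrix_mult_def sum_distrib_right mult.assoc)
    also have "\<dots> = (\<Sum>l\<in>UNIV. \<Sum>k\<in>UNIV. y l s * (X $ k $ l * scl (\<alpha> $ r $ k) 1))"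
      by (subst sum.swap) (simp add: X_sym)
    finally show "W $ s $ r = (?A + W ** X ** ?A) $ s $ r"
      using y2[of r s] by (simp add: W_def emb_mat_def transpose_def)
  qed
  ultimately have W: "?A ** X ** W = W - ?A" "W ** X ** ?A = W - ?A"
    by (simp_all add: matrix_mul_assoc eq_diff_eq add.commute)
  \<comment> \<open>\<open>W\<close> plays the role of \<open>U\<close>, for which (1 - AX)^(-1) = 1
    + UX.\<close>
  have "(mat 1 - ?A ** X) ** (mat 1 + W ** X) = mat 1 + W ** X - ?A ** X - ?A ** X ** W ** X"
    "(mat 1 + W ** X) ** (mat 1 - ?A ** X) = mat 1 + W ** X - ?A ** X - W ** X ** ?A ** X"
    by (simp_all add: matrix_diff_rdistrib matrix_diff_ldistrib matrix_add_ldistrib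
        matrix_add_rdistrib matrix_mul_assoc)
  then have "(mat 1 - ?A ** X) ** (mat 1 + W ** X) = mat 1" "(mat 1 + W ** X) ** (mat 1 - ?A ** X) = mat 1"
    unfolding W by (simp_all add: matrix_diff_rdistrib)
  then show ?thesis
    unfolding resolvent_arg_def \<alpha>_def[symmetric] invertible_def by blast
qed

text \<open>Reversal may fail to extend to the closure, so the transposed resolvent \<open>Q\<close>
  cannot be identified with reversed entries of \<open>U\<close>. Instead \<open>U\<close> is paired
  with an arbitrary x: its fixed-point equation, coefficients moved to the first argument, gives
  \<open>key\<close>. For x running through a row of \<open>Q\<close> one has Q ** (?A ** X) = Q -
  1, the pairings with \<open>Q\<close> cancel, and an identity between means remains.\<close>

lemma G_inv_transpose:
  assumes z: "z \<in> res_comp a"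
    and inv: "invertible (resolvent_arg scl X (transpose (scale_mat z a)))"
  shows "G_inv scl \<psi> X (transpose (scale_mat z a)) = transpose (G_mat a z)"
proof -
  define \<alpha> where "\<alpha> = scale_mat z a"
  let ?A = "emb_mat scl (transpose \<alpha>)"
  define Q where "Q = matrix_inv (resolvent_arg scl X (transpose \<alpha>))"
  note S = closed_subalgebra_word_algebra
  note \<beta> = bounded_pairing_rev_pairing[unfolded bounded_pairing_def]
  have US: "U a z $ r $ s \<in> word_algebra" for r s
    by (rule U_in_subalgebra[OF S X_in_word_algebra z])
  have XS: "reversal (X $ k $ l * scl c 1) (scl c 1 * X $ k $ l)" for k l c
    by (intro reversal_mult reversal_X reversal_scl_one)
  have XSw: "X $ k $ l * scl c 1 \<in> word_algebra" for k l c
    by (rule reversal_in_word_algebra[OF XS])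
  have add1: "rev_pairing (x + x') y = rev_pairing x y + rev_pairing x' y" if "y \<in> word_algebra" for x x' y
    using \<beta> that by blast
  have scl1: "rev_pairing (scl c x) y = c * rev_pairing x y" if "y \<in> word_algebra" for c x y
    using \<beta> that by blast
  have sum1: "rev_pairing (sum f I) y = (\<Sum>i\<in>I. rev_pairing (f i) y)"
    if "y \<in> word_algebra" for f :: "'d \<Rightarrow> 'b" and I y
    using scl1[OF that, of 0 0] by (induction I rule: infinite_finite_induct) (simp_all add: add1 that)
  have diff1: "rev_pairing (x - x') y = rev_pairing x y - rev_pairing x' y" if "y \<in> word_algebra" for x x' y
    using add1[OF that, of "x - x'" x'] by simp
  have add2: "rev_pairing x (y + y') = rev_pairing x y + rev_pairing x y'"
    if "y \<in> word_algebra" "y' \<in> word_algebra" for x y y'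
    using \<beta> that by blast
  have sum2: "rev_pairing x (sum f I) = (\<Sum>i\<in>I. rev_pairing x (f i))"
    if "\<And>i. f i \<in> word_algebra" for f :: "'d \<Rightarrow> 'b" and I x
    using bounded_pairing_zero(2)[OF S bounded_pairing_rev_pairing]
    by (induction I rule: infinite_finite_induct)
      (simp_all add: add2 that closed_subalgebra_sum[OF S])
  have u: "U a z $ r $ s = scl (\<alpha> $ r $ s) 1 + (\<Sum>l\<in>UNIV. \<Sum>k\<in>UNIV. U a z $ r $ k * (X $ k $ l * scl (\<alpha> $ l $ s) 1))" for r s
    by (subst U_fixed_point(1)[OF z])
      (simp add: \<alpha>_def emb_mat_def matrix_matrix_mult_def sum_distrib_right mult.assoc)
  have key: "rev_pairing x (U a z $ r $ s) = \<alpha> $ r $ s * \<psi> x +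
      (\<Sum>k\<in>UNIV. rev_pairing (x * (?A ** X) $ s $ k) (U a z $ r $ k))" for x r s
  proof -
    have mem: "U a z $ r $ k * (X $ k $ l * scl (\<alpha> $ l $ s) 1) \<in> word_algebra" for k l
      by (rule closed_subalgebraD(4)[OF S US XSw])
    have "rev_pairing x (U a z $ r $ s) = rev_pairing x (scl (\<alpha> $ r $ s) 1) +
        (\<Sum>l\<in>UNIV. \<Sum>k\<in>UNIV. rev_pairing x (U a z $ r $ k * (X $ k $ l * scl (\<alpha> $ l $ s) 1)))"
      by (subst u) (simp add: add2 sum2 mem closed_subalgebra_sum[OF S]
          reversal_in_word_algebra[OF reversal_scl_one])
    also have "rev_pairing x (scl (\<alpha> $ r $ s) 1) = \<alpha> $ r $ s * \<psi> x"
      by (simp add: rev_pairing_reversal[OF reversal_scl_one] scl_one_mult psi_scl)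
    also have "(\<Sum>l\<in>UNIV. \<Sum>k\<in>UNIV. rev_pairing x (U a z $ r $ k * (X $ k $ l * scl (\<alpha> $ l $ s) 1))) =
        (\<Sum>k\<in>UNIV. \<Sum>l\<in>UNIV. rev_pairing (x * (scl (\<alpha> $ l $ s) 1 * X $ l $ k)) (U a z $ r $ k))"
      by (subst sum.swap) (simp add: rev_pairing_mult_right[OF US XS] X_sym)
    also have "\<dots> = (\<Sum>k\<in>UNIV. rev_pairing (x * (?A ** X) $ s $ k) (U a z $ r $ k))"
      by (simp add: sum1[OF US, symmetric] matrix_matrix_mult_def emb_mat_def transpose_def sum_distrib_left)
    finally show ?thesis .
  qed
  have QA: "Q ** (mat 1 - ?A ** X) = mat 1"
    using matrix_inv_inverse(2)[OF inv] by (simp add: Q_def \<alpha>_def resolvent_arg_def)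
  then have QAX: "Q ** (?A ** X) = Q - mat 1"
    by (simp add: matrix_diff_ldistrib algebra_simps)
  have "\<psi> (U a z $ r $ i) = (\<Sum>s\<in>UNIV. \<psi> (Q $ i $ s) * \<alpha> $ r $ s)" for r i
  proof -
    have "(\<Sum>s\<in>UNIV. rev_pairing (Q $ i $ s) (U a z $ r $ s)) =
        (\<Sum>s\<in>UNIV. \<alpha> $ r $ s * \<psi> (Q $ i $ s)) +
        (\<Sum>s\<in>UNIV. \<Sum>k\<in>UNIV. rev_pairing (Q $ i $ s * (?A ** X) $ s $ k) (U a z $ r $ k))"
      by (subst key) (simp add: sum.distrib)
    also have "(\<Sum>s\<in>UNIV. \<Sum>k\<in>UNIV. rev_pairing (Q $ i $ s * (?A ** X) $ s $ k) (U a z $ r $ k)) =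
        (\<Sum>k\<in>UNIV. rev_pairing ((Q ** (?A ** X)) $ i $ k) (U a z $ r $ k))"
      by (subst sum.swap) (simp add: sum1[OF US, symmetric] matrix_matrix_mult_def[of Q])
    also have "\<dots> = (\<Sum>k\<in>UNIV. rev_pairing (Q $ i $ k) (U a z $ r $ k)) -
        (\<Sum>k\<in>UNIV. rev_pairing (mat 1 $ i $ k) (U a z $ r $ k))"
      by (simp add: QAX diff1[OF US] sum_subtractf)
    also have "(\<Sum>k\<in>UNIV. rev_pairing (mat 1 $ i $ k) (U a z $ r $ k)) = rev_pairing 1 (U a z $ r $ i)"
    proof -
      have "rev_pairing (mat 1 $ i $ k) (U a z $ r $ k) = (if k = i then rev_pairing 1 (U a z $ r $ k) else 0)" for k
        using scl1[OF US, of 0 0] by (simp add: mat_def)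
      then show ?thesis by simp
    qed
    finally show ?thesis
      by (simp add: rev_pairing_one[OF US] mult.commute)
  qed
  then show ?thesis
    unfolding G_inv_def \<alpha>_def[symmetric] Q_def[symmetric]
    by (simp add: vec_eq_iff id_tensor_def matrix_matrix_mult_def transpose_def G_mat_def)
qed

end

section \<open>Entrywise analyticity and the final assembly\<close>

definition analytic2_mat_at ::
  "(complex \<Rightarrow> complex \<Rightarrow> complex ^ 'n ^ 'm) \<Rightarrow> complex \<Rightarrow> complex \<Rightarrow> bool" where
  "analytic2_mat_at f z0 w0 \<longleftrightarrow> (\<forall>i j. analytic2_at (\<lambda>z w. f z w $ i $ j) z0 w0)"

lemma analytic2_mat_at_const: "analytic2_mat_at (\<lambda>_ _. A) z0 w0"
  by (simp add: analytic2_mat_at_def analytic2_at_const)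

lemma analytic2_mat_at_add:
  "analytic2_mat_at f z0 w0 \<Longrightarrow> analytic2_mat_at g z0 w0 \<Longrightarrow> analytic2_mat_at (\<lambda>z w. f z w + g z w) z0 w0"
  by (simp add: analytic2_mat_at_def analytic2_at_add)

lemma analytic2_mat_at_mult:
  "analytic2_mat_at f z0 w0 \<Longrightarrow> analytic2_mat_at g z0 w0 \<Longrightarrow> analytic2_mat_at (\<lambda>z w. f z w ** g z w) z0 w0"
  by (simp add: analytic2_mat_at_def matrix_matrix_mult_def analytic2_at_sum analytic2_at_mult)

lemma analytic2_mat_at_transpose:
  "analytic2_mat_at f z0 w0 \<Longrightarrow> analytic2_mat_at (\<lambda>z w. transpose (f z w)) z0 w0"
  by (simp add: analytic2_mat_at_def transpose_def)

lemma analytic2_mat_at_kron: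
  "analytic2_mat_at f z0 w0 \<Longrightarrow> analytic2_mat_at g z0 w0 \<Longrightarrow> analytic2_mat_at (\<lambda>z w. f z w \<otimes>\<^sub>K g z w) z0 w0"
  by (simp add: analytic2_mat_at_def kron_nth analytic2_at_mult)

lemma analytic2_mat_at_partial_transpose:
  "analytic2_mat_at f z0 w0 \<Longrightarrow> analytic2_mat_at (\<lambda>z w. partial_transpose (f z w)) z0 w0"
  by (simp add: analytic2_mat_at_def partial_transpose_def mk_sqmat_def entry_def)

lemma analytic2_mat_at_Theta:
  "analytic2_mat_at f z0 w0 \<Longrightarrow> analytic2_mat_at (\<lambda>z w. Theta (f z w)) z0 w0"
  by (simp add: analytic2_mat_at_def Theta_def mk_sqmat_def entry_def)

lemma analytic2_mat_at_Phi:
  "analytic2_mat_at f z0 w0 \<Longrightarrow> analytic2_mat_at (\<lambda>z w. Phi (f z w)) z0 w0"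
  unfolding Phi_def by (intro analytic2_mat_at_Theta analytic2_mat_at_partial_transpose)

lemma analytic2_mat_at_swap:
  "analytic2_mat_at f z0 w0 \<Longrightarrow> analytic2_mat_at (\<lambda>w z. f z w) w0 z0"
  by (simp add: analytic2_mat_at_def analytic2_at_swap)

context semicircular_matrix
begin

lemma analytic2_mat_at_G_mat:
  assumes "z0 \<in> res_comp a"
  shows "analytic2_mat_at (\<lambda>z w. G_mat a z) z0 w0"
  using assms by (simp add: analytic2_mat_at_def G_mat_def analytic2_at_psi_U)

lemma analytic2_mat_at_T_self:
  assumes "z0 \<in> res_comp a"
  shows "analytic2_mat_at (\<lambda>z w. T_self a z) z0 w0"
proof -
  have "analytic2_at (\<lambda>z w. \<psi> (U a z $ p $ q * U a z $ r $ s)) z0 w0" for p q r s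
  proof -
    obtain \<rho> y where y: "\<And>p q. power_family UNIV (\<lambda>z. U a z $ p $ q) z0 \<rho> (y p q)"
      using U_family[OF closed_subalgebra_UNIV UNIV_I assms] by blast
    have "analytic2_at (\<lambda>z w. \<psi> (U a z $ p $ q * U a w $ r $ s)) z0 z0"
      by (rule analytic2_at_pairing[OF closed_subalgebra_UNIV bounded_pairing_mult y y])
    from analytic2_at_diag[OF this] show ?thesis .
  qed
  then show ?thesis by (simp add: analytic2_mat_at_def T_self_def)
qed

lemma analytic2_mat_at_T_cross:
  assumes z0: "z0 \<in> res_comp a" and w0: "w0 \<in> res_comp b"
  shows "analytic2_mat_at (\<lambda>z w. T_cross a b z w) z0 w0"
proof -
  note S = closed_subalgebra_word_algebra
  have "analytic2_at (\<lambda>z w. rev_pairing (U a z $ p $ q) (U b w $ r $ s)) z0 w0" for p q r s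
  proof -
    obtain \<rho> y where u: "power_family UNIV (\<lambda>z. U a z $ p $ q) z0 \<rho> (y p q)"
      using U_family[OF closed_subalgebra_UNIV UNIV_I z0] by blast
    obtain \<rho>' y' where v: "power_family word_algebra (\<lambda>w. U b w $ r $ s) w0 \<rho>' (y' r s)"
      using U_family[OF S X_in_word_algebra w0] by blast
    show ?thesis by (rule analytic2_at_pairing[OF S bounded_pairing_rev_pairing u v])
  qed
  then show ?thesis by (simp add: analytic2_mat_at_def T_cross_def)
qed

definition H_cross :: "complex ^ 'd ^ 'd \<Rightarrow> complex ^ 'd ^ 'd \<Rightarrow> complex \<Rightarrow> complex \<Rightarrow> 'd sqmat" where
  "H_cross a b z w = cov_mat \<sigma> + cov_mat \<sigma> ** T_cross a b z w ** cov_mat \<sigma>"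

text \<open>The displayed expression with every inverse replaced by moments. It is therefore
  meaningful on the whole product of components, even where a transposed resolvent is
  missing.\<close>

definition second_order_ext ::
  "complex ^ 'd ^ 'd \<Rightarrow> complex ^ 'd ^ 'd \<Rightarrow> complex \<Rightarrow> complex \<Rightarrow> 'd sqmat" where
  "second_order_ext a b z w =
     T_self a z **
     (Theta (H_cross a b z w) + Phi (partial_transpose (H_cross a b z w) **
        partial_transpose (G_mat a z \<otimes>\<^sub>K G_mat b w) ** partial_transpose (H_cross a b z w))) **
     transpose (T_self b w)"

lemma analytic2_mat_at_second_order_ext:
  assumes z0: "z0 \<in> res_comp a" and w0: "w0 \<in> res_comp b"
  shows "analytic2_mat_at (\<lambda>z w. second_order_ext a b z w) z0 w0"
proof -
  have "analytic2_mat_at (\<lambda>z w. H_cross a b z w) z0 w0"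
    unfolding H_cross_def
    by (intro analytic2_mat_at_add analytic2_mat_at_mult analytic2_mat_at_const
        analytic2_mat_at_T_cross z0 w0)
  then show ?thesis
    unfolding second_order_ext_def
    by (intro analytic2_mat_at_add analytic2_mat_at_mult analytic2_mat_at_transpose
        analytic2_mat_at_kron analytic2_mat_at_partial_transpose analytic2_mat_at_Theta
        analytic2_mat_at_Phi analytic2_mat_at_T_self analytic2_mat_at_G_mat
        analytic2_mat_at_swap[OF analytic2_mat_at_T_self] analytic2_mat_at_swap[OF analytic2_mat_at_G_mat]
        z0 w0)
qed

text \<open>Invertibility of the transposed resolvents serves to identify \<open>G_inv\<close> at
  the transposes with transposed means; the three denominators are then handled by
  \<open>denom_inverse\<close>.\<close>

lemma second_order_map_eq:
  assumes a: "invertible a" and b: "invertible b" and z: "z \<in> res_comp a" and w: "w \<in> res_comp b"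
    and inv: "invertible (resolvent_arg scl X (transpose (scale_mat z a)))"
      "invertible (resolvent_arg scl X (transpose (scale_mat w b)))"
  shows "second_order_map_defined scl \<psi> X \<sigma> (scale_mat z a) (scale_mat w b)"
    "second_order_map scl \<psi> X \<sigma> (scale_mat z a) (scale_mat w b) = second_order_ext a b z w"
proof -
  have dom: "invertible (resolvent_arg scl X (scale_mat z a))" "invertible (resolvent_arg scl X (scale_mat w b))"
    using res_comp_subset z w by (auto simp flip: resolvent_set_iff)
  note cross = denom_inverse[OF T_cross_equation[OF a z w]]
  note selfa = denom_inverse[OF T_self_equation[OF a z]]
  note selfb = denom_inverse[OF T_self_equation[OF b w]]
  note G = G_inv_scale G_inv_transpose[OF z inv(1)] G_inv_transpose[OF w inv(2)]
  show "second_order_map_defined scl \<psi> X \<sigma> (scale_mat z a) (scale_mat w b)"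
    unfolding second_order_map_defined_def Let_def G using dom inv cross(1) selfa(1) selfb(1) by blast
  show "second_order_map scl \<psi> X \<sigma> (scale_mat z a) (scale_mat w b) = second_order_ext a b z w"
    unfolding second_order_map_def Let_def G cross selfa selfb second_order_ext_def H_cross_def ..
qed

text \<open>The coordinate projections of the component are connected and contain 0, so each stays
  in its one-variable component.\<close>

lemma connected_component_resolvent_domain:
  assumes "(z, w) \<in> connected_component_set (resolvent_domain scl X a b) (0, 0)"
  shows "z \<in> res_comp a" "w \<in> res_comp b"
proof -
  let ?C = "connected_component_set (resolvent_domain scl X a b) (0, 0)"
  have sub: "?C \<subseteq> resolvent_set (mulX a) \<times> resolvent_set (mulX b)"
    using connected_component_subset[of "resolvent_domain scl X a b" "(0, 0)"]
    by (auto simp: resolvent_domain_def resolvent_set_iff)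
  have "(0, 0) \<in> ?C"
    using assms by (metis connected_component_in connected_component_refl mem_Collect_eq)
  from imageI[OF this, of fst] imageI[OF this, of snd]
  have "0 \<in> fst ` ?C" "0 \<in> snd ` ?C" by simp_all
  moreover have "connected (fst ` ?C)" "connected (snd ` ?C)"
    by (intro connected_continuous_image continuous_on_fst continuous_on_snd continuous_on_id
        connected_connected_component)+
  ultimately have "fst ` ?C \<subseteq> res_comp a" "snd ` ?C \<subseteq> res_comp b"
    unfolding res_comp_def using sub by (intro connected_component_maximal; force)+
  then show "z \<in> res_comp a" "w \<in> res_comp b" using assms by force+
qed

end

text \<open>A function F on all of \<open>C\<close> is asked for because the displayed map involves
  resolvents at the transposes of za and wb, whose existence is not part of the definition of
  \<open>C\<close>. F agrees with the map wherever they exist, and for a faithful state that is all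
  of \<open>C\<close>.\<close>

theorem theorem41:
  fixes scl :: "complex \<Rightarrow> 'b \<Rightarrow> 'b :: {real_normed_algebra_1, banach}"
    and star :: "'b \<Rightarrow> 'b"
    and \<psi> :: "'b \<Rightarrow> complex"
    and A :: "'b set"
    and \<phi> :: "'b \<Rightarrow> complex"
    and \<phi>\<^sub>2 :: "'b \<Rightarrow> 'b \<Rightarrow> complex"
    and X :: "'b ^ 'd :: finite ^ 'd"
    and \<sigma> :: "'d \<times> 'd \<Rightarrow> 'd \<times> 'd \<Rightarrow> real"
    and a b :: "complex ^ 'd ^ 'd"
  assumes "tracial_cstar_prob_space scl star \<psi>"
    and "second_order_prob_space scl star A \<phi> \<phi>\<^sub>2"
    and "A = unital_subalgebra scl hull {X $ p $ q | p q. True}"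
    and "\<forall>x\<in>A. \<phi> x = \<psi> x"
    and "MSO_semicircular star A \<phi> \<phi>\<^sub>2 X \<sigma>"
    and "algebraically_free scl X"
    and "invertible a"
    and "invertible b"
  defines "C \<equiv> connected_component_set (resolvent_domain scl X a b) (0, 0)"
  shows "\<exists>F :: complex \<times> complex \<Rightarrow> 'd sqmat.
           (\<forall>i j. analytic2_on (\<lambda>x. F x $ i $ j) C) \<and>
           (\<forall>(z, w)\<in>C.
              invertible (resolvent_arg scl X (transpose (scale_mat z a))) \<and>
              invertible (resolvent_arg scl X (transpose (scale_mat w b))) \<longrightarrow>
              second_order_map_defined scl \<psi> X \<sigma> (scale_mat z a) (scale_mat w b) \<and>
              F (z, w) = second_order_map scl \<psi> X \<sigma> (scale_mat z a) (scale_mat w b)) \<and>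
           (faithful_state star \<psi> \<longrightarrow>
              (\<forall>(z, w)\<in>C.
                 second_order_map_defined scl \<psi> X \<sigma> (scale_mat z a) (scale_mat w b)))"
proof -
  have MSO: "X $ p $ q \<in> A" "X $ p $ q = X $ q $ p" "star (X $ p $ q) = X $ p $ q"
    "\<phi> (word X cs) = (\<Sum>\<pi>\<in>NC2 (length cs). pairing_weight \<sigma> cs \<pi>)" for p q cs
    using assms(5) unfolding MSO_semicircular_def by blast+
  have alg: "1 \<in> A" "x \<in> A \<Longrightarrow> y \<in> A \<Longrightarrow> x * y \<in> A" for x y
    using assms(2) unfolding second_order_prob_space_def unital_subalgebra_def by blast+
  \<comment> \<open>\<open>\<phi>\<close> and \<open>\<psi>\<close> are assumed to agree on
    \<open>A\<close> only, so the moment formula passes to \<open>\<psi>\<close> once words are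
    known to lie there.\<close>
  have word_in: "word X cs \<in> A" for cs
    by (induction cs) (auto simp: word_def alg MSO(1))
  interpret semicircular_matrix scl star \<psi> X \<sigma>
  proof (intro semicircular_matrix.intro semicircular_matrix_axioms.intro assms(1) MSO(2,3))
    show "\<psi> (word X cs) = (\<Sum>\<pi>\<in>NC2 (length cs). pairing_weight \<sigma> cs \<pi>)" for cs
      using assms(4) word_in MSO(4) by metis
  qed
  have C: "z \<in> res_comp a" "w \<in> res_comp b" if "(z, w) \<in> C" for z w
    using connected_component_resolvent_domain that unfolding C_def by blast+
  note eq = second_order_map_eq[OF assms(7,8) C]
  show ?thesis
  proof (intro exI[of _ "\<lambda>(z, w). second_order_ext a b z w"] conjI allI impI)
    fix i j
    have "analytic2_at (\<lambda>z w. second_order_ext a b z w $ i $ j) z w" if "(z, w) \<in> C" for z w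
      using analytic2_mat_at_second_order_ext[OF C[OF that]] unfolding analytic2_mat_at_def by blast
    then show "analytic2_on (\<lambda>x. (case x of (z, w) \<Rightarrow> second_order_ext a b z w) $ i $ j) C"
      by (auto simp: analytic2_on_eq)
  next
    show "\<forall>(z, w)\<in>C.
        invertible (resolvent_arg scl X (transpose (scale_mat z a))) \<and>
        invertible (resolvent_arg scl X (transpose (scale_mat w b))) \<longrightarrow>
        second_order_map_defined scl \<psi> X \<sigma> (scale_mat z a) (scale_mat w b) \<and>
        (case (z, w) of (z, w) \<Rightarrow> second_order_ext a b z w) =
          second_order_map scl \<psi> X \<sigma> (scale_mat z a) (scale_mat w b)"
      using eq by auto
  next
    assume "faithful_state star \<psi>"
    then show "\<forall>(z, w)\<in>C. second_order_map_defined scl \<psi> X \<sigma> (scale_mat z a) (scale_mat w b)"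
      using eq(1) transpose_resolvent_invertible C by auto
  qed
qed

end
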